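(* Let $X$ be a compact metric space, $\lambda$ a Borel probability measure on $X$ with $\operatorname{supp}(\lambda)=X$, and $\mathbf x=(x_n)_{n\in\mathbb N}$ a sequence in $X$ with $\mathbf x\approx\lambda$. Let $(\mathbf I,\mathbf m)$ be admissible. Then $M(\mathbf x\mathbf n)=M(\lambda,\mathbf I,\mathbf m)$ for most $\mathbf n\in S(\mathbf I,\mathbf m)$, i.e. the exceptional set of those $\mathbf n\in S(\mathbf I,\mathbf m)$ with $M(\mathbf x\mathbf n)\ne M(\lambda,\mathbf I,\mathbf m)$ is meager in $S(\mathbf I,\mathbf m)$.
   Context: $\mathbb N=\{1,2,\ldots\}$. $\mathcal M(X)$ is the set of Borel probability measures on $X$ with the topology of weak convergence, and $\mathcal P=\mathcal M([0,1])$. For a sequence $(y_n)$ in a compact metric space, $A((y_n))=\bigcap_{n_0\ge1}\overline{\{y_n:n\ge n_0\}}$ is its set of accumulation points. For a sequence $\mathbf x=(x_n)_{n\in\mathbb N}$ in $X$: $\mu_{\mathbf x,N}=\frac1N\sum_{n=1}^N\delta_{x_n}$, and $M(\mathbf x)=A((\mu_{\mathbf x,N})_{N\in\mathbb N})\subseteq\mathcal M(X)$. Let $\sigma$ denote the shift, $\sigma((x_n)_{n})=(x_{n+1})_{n}$. $\mathbf x\approx\lambda$ ($\mathbf x$ is well distributed with respect to $\lambda$) means $\lim_{N\to\infty}\mu_{\sigma^k(\mathbf x),N}=\lambda$ uniformly in $k\in\mathbb N$. $S_0$ is the set of strictly increasing sequences $\mathbf n=(n_k)_{k\in\mathbb N}$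 of positive integers, with the topology having as a base the cylinder sets $[n'_1,\ldots,n'_k]=\{\mathbf n\in S_0:n_i=n'_i\text{ for }i=1,\ldots,k\}$; $\mathbf x\mathbf n=(x_{n_k})_{k\in\mathbb N}$. $\mathbf I=(I_j)_{j\in\mathbb N}$ is a partition of $\mathbb N$ into intervals $I_j=\{n\in\mathbb N:a_{j-1}<n\le a_j\}$ with integers $0=a_0<a_1<a_2<\cdots$, and $b_j=a_j-a_{j-1}$. $\mathbf m=(m_j)_{j\in\mathbb N}$ is a sequence of nonnegative integers with $m_j\le b_j$, $M_k=\sum_{j=1}^k m_j$, and $q_j=m_j/b_j\in[0,1]$. $(\mathbf I,\mathbf m)$ is admissible if $\lim_{j\to\infty}b_j=\infty$ and $\lim_{n\to\infty}m_n/M_n=0$. $S(\mathbf I,\mathbf m)$ is the (closed, hence Baire) subspace of $S_0$ consisting of those $\mathbf n\in S_0$ such that for each $j$ exactly $m_j$ of the members of $\mathbf n$ lie in $I_j$, with the subspace topology. $\pi_{\mathbf I,\mathbf m,N}=M_N^{-1}\sum_{j=1}^N m_j\delta_{q_j}\in\mathcal P$ (for $N$ with $M_N>0$), and $P(\mathbf I,\mathbf m)=A((\pi_{\mathbf I,\mathbf m,N})_{N})\subseteq\mathcal P$. For $\pi\in\mathcal P$ define $F_\pi:[0,1]\to[0,1]$ by $F_\pi(t_0)=\pi([0,t_0])+t_0\int_{(t_0,1]}\frac{d\pi(t)}{t}$ (in particular $F_\pi(0)=\pi(\{0\})$). Put $M(\pi,\lambda)=\{\mu\in\mathcal M(X):\mu\le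 F_\pi\circ\lambda\}$, i.e. $\mu(B)\le F_\pi(\lambda(B))$ for all Borel $B\subseteq X$, and $M(\lambda,\mathbf I,\mathbf m)=\bigcup_{\pi\in P(\mathbf I,\mathbf m)}M(\pi,\lambda)$. *)

theory Defs
  imports "HOL-Probability.Probability"
begin

text \<open>
  Sequences indexed by the positive integers are functions on \<open>nat\<close> whose value at \<open>0\<close> is never
  used. The two exceptions are \<open>a\<close> (interval endpoints) and the members of \<open>S0\<close>, where the value at
  \<open>0\<close> is pinned to \<open>0\<close>; for the members of \<open>S0\<close> this makes the encoding of a sequence unique, and
  together with strict monotonicity it makes all the values at positive indices positive.
\<close>

definition borel_probs :: "'a::topological_space set \<Rightarrow> 'a measure set" where
  "borel_probs X = {\<mu>. sets \<mu> = sets (restrict_space borel X) \<and> prob_space \<mu>}"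

definition weak_topology :: "'a::topological_space set \<Rightarrow> 'a measure topology" where
  "weak_topology X = topology_generated_by
     {{\<mu> \<in> borel_probs X. (\<integral>t. f t \<partial>\<mu>) \<in> U} | (f :: 'a \<Rightarrow> real) U.
        continuous_on X f \<and> bounded (f ` X) \<and> open U}"

definition supp :: "'a::topological_space measure \<Rightarrow> 'a set" where
  "supp \<mu> = {t \<in> space \<mu>. \<forall>U. open U \<and> t \<in> U \<longrightarrow> emeasure \<mu> (U \<inter> space \<mu>) > 0}"

text \<open>The measure \<open>\<Sum>j\<in>J. w j \<cdot> \<delta>\<^bsub>p j\<^esub>\<close> on \<open>X\<close>.\<close>

definition dirac_sum ::
    "'a::topological_space set \<Rightarrow> 'i set \<Rightarrow> ('i \<Rightarrow> real) \<Rightarrow> ('i \<Rightarrow> 'a) \<Rightarrow> 'a measure" where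
  "dirac_sum X J w p = measure_of X (sets (restrict_space borel X))
     (\<lambda>B. \<Sum>j\<in>J. ennreal (w j) * emeasure (return (restrict_space borel X) (p j)) B)"

lemma sets_dirac_sum [simp]: "sets (dirac_sum X J w p) = sets (restrict_space borel X)"
proof -
  have "sigma_algebra X (sets (restrict_space borel X))"
    using sets.sigma_algebra_axioms[of "restrict_space borel X"]
    by (simp add: space_restrict_space)
  then show ?thesis
    unfolding dirac_sum_def
    by (simp add: sigma_algebra.sets_measure_of_eq)
qed

lemma emeasure_dirac_sum:
  assumes "B \<in> sets (restrict_space borel X)"
  shows "emeasure (dirac_sum X J w p) B = (\<Sum>j\<in>J. ennreal (w j) * indicator B (p j))"
proof -
  let ?R = "restrict_space borel X"
  let ?g = "\<lambda>B. \<Sum>j\<in>J. ennreal (w j) * emeasure (return ?R (p j)) B"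
  have pos: "positive (sets (dirac_sum X J w p)) ?g"
    by (simp add: positive_def)
  have ca: "countably_additive (sets (dirac_sum X J w p)) ?g"
  proof (rule countably_additiveI)
    fix A :: "nat \<Rightarrow> 'a set"
    assume A: "range A \<subseteq> sets (dirac_sum X J w p)" "disjoint_family A"
    have "(\<Sum>i. emeasure (return ?R (p j)) (A i)) = emeasure (return ?R (p j)) (\<Union>(range A))" for j
      using A by (intro suminf_emeasure) auto
    then show "(\<Sum>i. ?g (A i)) = ?g (\<Union>(range A))"
      by (simp add: suminf_sum)
  qed
  have "emeasure (dirac_sum X J w p) B = ?g B"
    using assms pos ca sets.sets_into_space[of _ ?R]
    by (intro emeasure_measure_of[OF dirac_sum_def]) (auto simp: space_restrict_space)
  also have "\<dots> = (\<Sum>j\<in>J. ennreal (w j) * indicator B (p j))"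
    using assms by simp
  finally show ?thesis .
qed

definition empirical :: "'a::topological_space set \<Rightarrow> (nat \<Rightarrow> 'a) \<Rightarrow> nat \<Rightarrow> 'a measure" where
  "empirical X x N = dirac_sum X {1..N} (\<lambda>_. 1 / real N) x"

text \<open>Accumulation points of a sequence that is indexed by \<open>D\<close>, a set of positive integers.\<close>

definition accumulation_points :: "'b topology \<Rightarrow> nat set \<Rightarrow> (nat \<Rightarrow> 'b) \<Rightarrow> 'b set" where
  "accumulation_points T D y = (\<Inter>n\<^sub>0\<in>{1..}. T closure_of (y ` {n \<in> D. n \<ge> n\<^sub>0}))"

definition limit_measures :: "'a::topological_space set \<Rightarrow> (nat \<Rightarrow> 'a) \<Rightarrow> 'a measure set" where
  "limit_measures X x = accumulation_points (weak_topology X) {1..} (empirical X x)"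

definition seq_shift :: "(nat \<Rightarrow> 'a) \<Rightarrow> nat \<Rightarrow> 'a" where
  "seq_shift x = (\<lambda>n. x (n + 1))"

text \<open>Since the limit \<open>lam\<close> does not depend on \<open>k\<close>, uniform convergence means that every
  neighbourhood of \<open>lam\<close> captures the measures from some \<open>N\<^sub>0\<close> on that works for all \<open>k\<close>.\<close>

definition well_distributed ::
    "'a::topological_space set \<Rightarrow> (nat \<Rightarrow> 'a) \<Rightarrow> 'a measure \<Rightarrow> bool" where
  "well_distributed X x lam \<longleftrightarrow>
     (\<forall>U. openin (weak_topology X) U \<and> lam \<in> U \<longrightarrow>
        (\<exists>N\<^sub>0. \<forall>N\<ge>N\<^sub>0. \<forall>k\<ge>1. empirical X ((seq_shift ^^ k) x) N \<in> U))"

definition S0 :: "(nat \<Rightarrow> nat) set" where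
  "S0 = {n. n 0 = 0 \<and> strict_mono n}"

definition cylinder :: "nat \<Rightarrow> (nat \<Rightarrow> nat) \<Rightarrow> (nat \<Rightarrow> nat) set" where
  "cylinder k n' = {n \<in> S0. \<forall>i\<in>{1..k}. n i = n' i}"

definition S0_topology :: "(nat \<Rightarrow> nat) topology" where
  "S0_topology = topology_generated_by {cylinder k n' | k n'. k \<ge> 1 \<and> n' \<in> S0}"

definition block_length :: "(nat \<Rightarrow> nat) \<Rightarrow> nat \<Rightarrow> nat" where
  "block_length a j = a j - a (j - 1)"

text \<open>A partition of the positive integers into intervals is given by its endpoints \<open>a\<close>; the
  second argument \<open>m\<close> prescribes how many members are selected from each interval.\<close>

definition interval_data :: "(nat \<Rightarrow> nat) \<Rightarrow> (nat \<Rightarrow> nat) \<Rightarrow> bool" where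
  "interval_data a m \<longleftrightarrow> a 0 = 0 \<and> strict_mono a \<and> (\<forall>j\<ge>1. m j \<le> block_length a j)"

definition block :: "(nat \<Rightarrow> nat) \<Rightarrow> nat \<Rightarrow> nat set" where
  "block a j = {a (j - 1)<..a j}"

definition cum :: "(nat \<Rightarrow> nat) \<Rightarrow> nat \<Rightarrow> nat" where
  "cum m k = (\<Sum>j=1..k. m j)"

definition ratio :: "(nat \<Rightarrow> nat) \<Rightarrow> (nat \<Rightarrow> nat) \<Rightarrow> nat \<Rightarrow> real" where
  "ratio a m j = real (m j) / real (block_length a j)"

text \<open>If \<open>m\<close> vanishes at all positive indices, the quotients below are \<open>0 / 0 = 0\<close>; in that case
  \<open>S_space a m\<close> is empty.\<close>

definition admissible :: "(nat \<Rightarrow> nat) \<Rightarrow> (nat \<Rightarrow> nat) \<Rightarrow> bool" where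
  "admissible a m \<longleftrightarrow>
     filterlim (block_length a) at_top sequentially \<and>
     (\<lambda>n. real (m n) / real (cum m n)) \<longlonglongrightarrow> 0"

definition S_space :: "(nat \<Rightarrow> nat) \<Rightarrow> (nat \<Rightarrow> nat) \<Rightarrow> (nat \<Rightarrow> nat) set" where
  "S_space a m = {n \<in> S0. \<forall>j\<ge>1. card (n ` {1..} \<inter> block a j) = m j}"

definition S_topology :: "(nat \<Rightarrow> nat) \<Rightarrow> (nat \<Rightarrow> nat) \<Rightarrow> (nat \<Rightarrow> nat) topology" where
  "S_topology a m = subtopology S0_topology (S_space a m)"

definition nowhere_dense_in :: "'b topology \<Rightarrow> 'b set \<Rightarrow> bool" where
  "nowhere_dense_in T A \<longleftrightarrow> A \<subseteq> topspace T \<and> T interior_of (T closure_of A) = {}"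

definition meager_in :: "'b topology \<Rightarrow> 'b set \<Rightarrow> bool" where
  "meager_in T A \<longleftrightarrow> (\<exists>\<G>. countable \<G> \<and> (\<forall>G\<in>\<G>. nowhere_dense_in T G) \<and> A = \<Union>\<G>)"

definition ratio_distribution :: "(nat \<Rightarrow> nat) \<Rightarrow> (nat \<Rightarrow> nat) \<Rightarrow> nat \<Rightarrow> real measure" where
  "ratio_distribution a m N =
     dirac_sum {0..1} {1..N} (\<lambda>j. real (m j) / real (cum m N)) (ratio a m)"

definition limit_ratio_distributions ::
    "(nat \<Rightarrow> nat) \<Rightarrow> (nat \<Rightarrow> nat) \<Rightarrow> real measure set" where
  "limit_ratio_distributions a m =
     accumulation_points (weak_topology {0..1}) {N. cum m N > 0} (ratio_distribution a m)"

definition F :: "real measure \<Rightarrow> real \<Rightarrow> real" where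
  "F \<pi> t\<^sub>0 = measure \<pi> {0..t\<^sub>0} + t\<^sub>0 * (\<integral>t\<in>{t\<^sub>0<..1}. (1 / t) \<partial>\<pi>)"

definition dominated_measures ::
    "'a::topological_space set \<Rightarrow> real measure \<Rightarrow> 'a measure \<Rightarrow> 'a measure set" where
  "dominated_measures X \<pi> lam =
     {\<mu> \<in> borel_probs X. \<forall>B \<in> sets (restrict_space borel X). measure \<mu> B \<le> F \<pi> (measure lam B)}"

definition predicted_measures ::
    "'a::topological_space set \<Rightarrow> 'a measure \<Rightarrow> (nat \<Rightarrow> nat) \<Rightarrow> (nat \<Rightarrow> nat) \<Rightarrow> 'a measure set" where
  "predicted_measures X lam a m =
     (\<Union>\<pi>\<in>limit_ratio_distributions a m. dominated_measures X \<pi> lam)"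

end

theory Submission
  imports Defs
begin

text \<open>
  Write \<open>F \<pi> l = \<integral>min(1, l/t) d\<pi>(t)\<close>. At most \<open>min(m\<^sub>j, \<Sum> f(x\<^sub>s))\<close> of the mass of a function
  \<open>0 \<le> f \<le> 1\<close> can be selected from the \<open>j\<close>-th block, and well-distribution makes the block sum
  close to \<open>b\<^sub>j \<integral>f d\<lambda>\<close>; passing to the limit bounds every limit measure of every
  selected subsequence by \<open>F \<pi> \<circ> \<lambda>\<close> for a limit \<open>\<pi>\<close> of the ratio distributions.

  Conversely, if \<open>\<mu> \<le> F \<pi> \<circ> \<lambda>\<close>, then selecting the points with the largest values of \<open>G\<close> from each
  block gives an average of at least about \<open>\<integral>G d\<mu>\<close>, as one sees level set by level set. A
  selection minimising a quadratic distance to \<open>\<mu>\<close> has this property for the gradient \<open>G\<close> of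
  the distance, and hence the distance is nearly zero. So every finite beginning extends to a
  selection with an empirical measure near \<open>\<mu>\<close>, and the selections avoiding a given basic
  neighbourhood of \<open>\<mu>\<close> from some index on form a nowhere dense set; countably many
  neighbourhoods suffice.
\<close>

section \<open>Weak topology on probability measures\<close>

text \<open>The quotient \<open>l/t\<close> arises because a block of ratio
  \<open>t = m_j/b_j\<close> has about \<open>l b_j\<close> points in a set of measure
  \<open>l\<close>, and these can make up at most the fraction \<open>l/t\<close> of the
  \<open>m_j\<close> selected ones. Well-distribution controls continuous functions only, so the
  bounds reach Borel sets through approximation in the mean. The obstacle in the converse is that
  domination concerns one set at a time, while weak closeness asks one selection to serve several
  test functions at once. Minimising the energy resolves this: if a selected point had a clearly
  smaller value of the gradient than an unselected one of the same block, exchanging them would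
  lower the energy. So the level set inequalities become available for exactly the function that
  measures the failure. The first inclusion holds for every member of \<open>S_space a m\<close>,
  hence only predicted measures that a sequence misses contribute to the exceptional set. The
  condition \<open>m_n/M_n -> 0\<close> makes it harmless to round an index up to the end of its
  block.\<close>

lemma space_borel_probs: "\<mu> \<in> borel_probs X \<Longrightarrow> space \<mu> = X"
  using sets_eq_imp_space_eq[of \<mu> "restrict_space borel X"]
  by (simp add: borel_probs_def space_restrict_space)

lemma sets_borel_probs: "\<mu> \<in> borel_probs X \<Longrightarrow> sets \<mu> = sets (restrict_space borel X)"
  by (simp add: borel_probs_def)

lemma prob_space_borel_probs: "\<mu> \<in> borel_probs X \<Longrightarrow> prob_space \<mu>"
  by (simp add: borel_probs_def)

lemma measurable_borel_probs:
  assumes "\<mu> \<in> borel_probs X" "f \<in> borel_measurable (restrict_space borel X)"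
  shows "f \<in> borel_measurable \<mu>"
  using assms measurable_cong_sets[OF sets_borel_probs[OF assms(1)] refl] by blast

lemma continuous_measurable_borel_probs:
  assumes "\<mu> \<in> borel_probs X" "continuous_on X f"
  shows "f \<in> borel_measurable \<mu>"
  by (rule measurable_borel_probs[OF assms(1)]) (rule borel_measurable_continuous_on_restrict[OF assms(2)])

lemma integrable_bounded_borel_probs:
  fixes f :: "_ \<Rightarrow> real"
  assumes "\<mu> \<in> borel_probs X" "f \<in> borel_measurable \<mu>" "\<And>t. t \<in> X \<Longrightarrow> \<bar>f t\<bar> \<le> B"
  shows "integrable \<mu> f"
proof -
  interpret prob_space \<mu> by (rule prob_space_borel_probs[OF assms(1)])
  show ?thesis
    by (rule integrable_const_bound[where B=B]) (use assms space_borel_probs[OF assms(1)] in auto)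
qed

lemma compact_continuous_bound:
  fixes f :: "'a::topological_space \<Rightarrow> real"
  assumes "compact X" "continuous_on X f"
  obtains B where "B > 0" "\<And>t. t \<in> X \<Longrightarrow> \<bar>f t\<bar> \<le> B"
proof -
  have "bounded (f ` X)"
    using compact_imp_bounded[OF compact_continuous_image[OF assms(2,1)]] .
  then obtain B where "B > 0" "\<forall>y\<in>f ` X. norm y \<le> B"
    by (auto simp: bounded_pos)
  then show ?thesis using that by auto
qed

lemma integrable_continuous_borel_probs:
  fixes f :: "_ \<Rightarrow> real"
  assumes "\<mu> \<in> borel_probs X" "compact X" "continuous_on X f"
  shows "integrable \<mu> f"
proof -
  obtain B where "\<And>t. t \<in> X \<Longrightarrow> \<bar>f t\<bar> \<le> B"
    using compact_continuous_bound[OF assms(2,3)] by blast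
  then show ?thesis
    using integrable_bounded_borel_probs continuous_measurable_borel_probs assms by metis
qed

lemma integral_diff_le:
  fixes f g :: "_ \<Rightarrow> real"
  assumes "\<mu> \<in> borel_probs X" "integrable \<mu> f" "integrable \<mu> g"
    and "\<And>t. t \<in> X \<Longrightarrow> \<bar>f t - g t\<bar> \<le> e"
  shows "\<bar>(\<integral>t. f t \<partial>\<mu>) - (\<integral>t. g t \<partial>\<mu>)\<bar> \<le> e"
proof -
  interpret prob_space \<mu> by (rule prob_space_borel_probs[OF assms(1)])
  have "\<bar>(\<integral>t. f t \<partial>\<mu>) - (\<integral>t. g t \<partial>\<mu>)\<bar> = \<bar>\<integral>t. f t - g t \<partial>\<mu>\<bar>"
    using assms by simp
  also have "\<dots> \<le> (\<integral>t. \<bar>f t - g t\<bar> \<partial>\<mu>)"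
    by (rule integral_abs_bound)
  also have "\<dots> \<le> (\<integral>t. e \<partial>\<mu>)"
    by (intro integral_mono) (use assms space_borel_probs[OF assms(1)] in auto)
  finally show ?thesis by (simp add: prob_space)
qed

lemma integral_continuous_diff_le:
  fixes f g :: "_ \<Rightarrow> real"
  assumes "compact X" "continuous_on X f" "continuous_on X g" "\<mu> \<in> borel_probs X"
    and "\<And>t. t \<in> X \<Longrightarrow> \<bar>f t - g t\<bar> \<le> e"
  shows "\<bar>(\<integral>t. f t \<partial>\<mu>) - (\<integral>t. g t \<partial>\<mu>)\<bar> \<le> e"
  by (intro integral_diff_le[OF assms(4)] integrable_continuous_borel_probs[OF assms(4,1)] assms(2,3,5))

text \<open>The definition gives values on sets only. As the image of a point measure, the same
  measure admits a change of variables, which turns integrals into finite sums.\<close>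

lemma dirac_sum_eq_distr:
  assumes "finite J" "\<And>j. j \<in> J \<Longrightarrow> p j \<in> X"
  shows "dirac_sum X J w p = distr (point_measure J (\<lambda>j. ennreal (w j))) (restrict_space borel X) p"
    (is "_ = ?D")
proof (rule measure_eqI)
  show "sets (dirac_sum X J w p) = sets ?D" by simp
next
  fix B assume "B \<in> sets (dirac_sum X J w p)"
  then have B: "B \<in> sets (restrict_space borel X)" by simp
  have p: "p \<in> measurable (point_measure J (\<lambda>j. ennreal (w j))) (restrict_space borel X)"
    using assms by (auto simp: space_restrict_space)
  have "emeasure ?D B = emeasure (point_measure J (\<lambda>j. ennreal (w j))) (p -` B \<inter> J)"
    by (simp add: emeasure_distr[OF p B] space_point_measure)
  also have "\<dots> = (\<Sum>j\<in>p -` B \<inter> J. ennreal (w j))"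
    using assms by (subst emeasure_point_measure_finite) auto
  also have "\<dots> = (\<Sum>j\<in>J. ennreal (w j) * indicator B (p j))"
    using assms(1) by (intro sum.mono_neutral_cong_left) (auto simp: indicator_def)
  finally show "emeasure (dirac_sum X J w p) B = emeasure ?D B"
    by (simp add: emeasure_dirac_sum[OF B])
qed

lemma integral_dirac_sum:
  fixes f :: "_ \<Rightarrow> real"
  assumes "finite J" "\<And>j. j \<in> J \<Longrightarrow> p j \<in> X" "\<And>j. j \<in> J \<Longrightarrow> 0 \<le> w j"
    and "f \<in> borel_measurable (restrict_space borel X)"
  shows "(\<integral>t. f t \<partial>(dirac_sum X J w p)) = (\<Sum>j\<in>J. w j * f (p j))"
proof -
  have p: "p \<in> measurable (point_measure J (\<lambda>j. ennreal (w j))) (restrict_space borel X)"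
    using assms by (auto simp: space_restrict_space)
  \<comment> \<open>Truncation at \<open>0\<close> changes no weight on \<open>J\<close> and makes
    the weights nonnegative at every index.\<close>
  have "point_measure J (\<lambda>j. ennreal (w j)) = point_measure J (\<lambda>j. ennreal (max 0 (w j)))"
    using assms(3) by (auto simp: point_measure_def intro!: density_cong AE_I2)
  then show ?thesis
    using assms lebesgue_integral_point_measure_finite[of J "\<lambda>j. max 0 (w j)" "\<lambda>j. f (p j)"]
    by (simp add: dirac_sum_eq_distr integral_distr[OF p assms(4)] cong: sum.cong)
qed

lemma dirac_sum_borel_probs:
  assumes "finite J" "\<And>j. j \<in> J \<Longrightarrow> p j \<in> X" "\<And>j. j \<in> J \<Longrightarrow> 0 \<le> w j" "(\<Sum>j\<in>J. w j) = 1"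
  shows "dirac_sum X J w p \<in> borel_probs X"
proof -
  have sp: "space (dirac_sum X J w p) = X"
    using sets_eq_imp_space_eq[OF sets_dirac_sum] by (simp add: space_restrict_space)
  have "X \<in> sets (restrict_space borel X)"
    using sets.top[of "restrict_space borel X"] by (simp add: space_restrict_space)
  then have "emeasure (dirac_sum X J w p) X = (\<Sum>j\<in>J. ennreal (w j) * indicator X (p j))"
    by (rule emeasure_dirac_sum)
  also have "\<dots> = (\<Sum>j\<in>J. ennreal (w j))"
    using assms by (intro sum.cong) auto
  also have "\<dots> = 1"
    using assms by (simp add: sum_ennreal)
  finally show ?thesis
    by (auto simp: borel_probs_def sp intro!: prob_spaceI)
qed

lemma empirical_borel_probs:
  assumes "\<And>i. i \<ge> 1 \<Longrightarrow> x i \<in> X" "N \<ge> 1"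
  shows "empirical X x N \<in> borel_probs X"
  unfolding empirical_def by (rule dirac_sum_borel_probs) (use assms in auto)

lemma integral_empirical:
  fixes f :: "_ \<Rightarrow> real"
  assumes "\<And>i. i \<ge> 1 \<Longrightarrow> x i \<in> X" "continuous_on X f"
  shows "(\<integral>t. f t \<partial>(empirical X x N)) = (\<Sum>i=1..N. f (x i)) / real N"
  unfolding empirical_def
  by (subst integral_dirac_sum)
    (use assms borel_measurable_continuous_on_restrict[OF assms(2)] in \<open>auto simp: sum_divide_distrib\<close>)

lemma topspace_weak_topology:
  fixes X :: "'a::topological_space set"
  shows "topspace (weak_topology X) = borel_probs X"
proof -
  have "\<exists>(f :: 'a \<Rightarrow> real) U. {\<mu> \<in> borel_probs X. (\<integral>t. f t \<partial>\<mu>) \<in> U} = borel_probs X \<and>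
     continuous_on X f \<and> bounded (f ` X) \<and> open U"
    by (rule exI[of _ "\<lambda>_. 0::real"], rule exI[of _ UNIV]) (auto intro: boundedI)
  then show ?thesis
    unfolding weak_topology_def by (subst topology_generated_by_topspace) auto
qed

lemma openin_weak_topology_ball:
  fixes f :: "_ \<Rightarrow> real"
  assumes "compact X" "continuous_on X f"
  shows "openin (weak_topology X) {\<mu> \<in> borel_probs X. \<bar>(\<integral>t. f t \<partial>\<mu>) - c\<bar> < e}"
proof -
  have "{\<mu> \<in> borel_probs X. \<bar>(\<integral>t. f t \<partial>\<mu>) - c\<bar> < e} = {\<mu> \<in> borel_probs X. (\<integral>t. f t \<partial>\<mu>) \<in> ball c e}"
    by (auto simp: dist_real_def)
  moreover have "bounded (f ` X)"
    using compact_imp_bounded[OF compact_continuous_image[OF assms(2,1)]] .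
  ultimately show ?thesis
    unfolding weak_topology_def using assms open_ball[of c e]
    by (intro topology_generated_by_Basis) blast
qed

lemma openin_weak_topology_nbhd:
  fixes f :: "nat \<Rightarrow> _ \<Rightarrow> real"
  assumes "compact X" "\<And>k. continuous_on X (f k)"
  shows "openin (weak_topology X)
     {\<mu> \<in> borel_probs X. \<forall>k<d. \<bar>(\<integral>t. f k t \<partial>\<mu>) - c k\<bar> < e}"
proof (induction d)
  case 0
  then show ?case using openin_topspace[of "weak_topology X"] by (simp add: topspace_weak_topology)
next
  case (Suc d)
  have "{\<mu> \<in> borel_probs X. \<forall>k<Suc d. \<bar>(\<integral>t. f k t \<partial>\<mu>) - c k\<bar> < e} =
      {\<mu> \<in> borel_probs X. \<forall>k<d. \<bar>(\<integral>t. f k t \<partial>\<mu>) - c k\<bar> < e} \<inter>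
      {\<mu> \<in> borel_probs X. \<bar>(\<integral>t. f d t \<partial>\<mu>) - c d\<bar> < e}"
    by (auto simp: less_Suc_eq)
  then show ?case
    using openin_Int[OF Suc openin_weak_topology_ball[OF assms(1) assms(2)[of d]]] by simp
qed

text \<open>Countably many test functions then decide weak convergence. They allow sequences in
  place of general neighbourhoods and, later, a countable decomposition of the exceptional
  set.\<close>

definition dense_functions :: "'a::topological_space set \<Rightarrow> (nat \<Rightarrow> 'a \<Rightarrow> real) \<Rightarrow> bool" where
  "dense_functions X f \<longleftrightarrow> (\<forall>k. continuous_on X (f k)) \<and>
     (\<forall>g e. continuous_on X g \<longrightarrow> e > 0 \<longrightarrow> (\<exists>k. \<forall>t\<in>X. \<bar>f k t - g t\<bar> \<le> e))"

text \<open>Boxes in the first \<open>d\<close> test functions form a neighbourhood base at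
  \<open>\<mu>\<close>. For a subbasic set given by \<open>g\<close>, one \<open>f k\<close> within
  \<open>e / 4\<close> of \<open>g\<close> suffices: two replacements of \<open>g\<close> by
  \<open>f k\<close> and one box inequality cost less than \<open>e\<close>.\<close>

lemma weak_nbhd_dense_functions:
  assumes "compact X" "dense_functions X f" "openin (weak_topology X) U" "\<mu> \<in> U"
  shows "\<exists>d p. \<forall>\<nu>\<in>borel_probs X.
    (\<forall>k<d. \<bar>(\<integral>t. f k t \<partial>\<nu>) - (\<integral>t. f k t \<partial>\<mu>)\<bar> < 1 / Suc p) \<longrightarrow> \<nu> \<in> U"
proof -
  have mu: "\<mu> \<in> borel_probs X"
    using openin_subset[OF assms(3)] assms(4) by (auto simp: topspace_weak_topology)
  have "generate_topology_on {{\<mu> \<in> borel_probs X. (\<integral>t. f t \<partial>\<mu>) \<in> U} | (f :: 'a \<Rightarrow> real) U.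
        continuous_on X f \<and> bounded (f ` X) \<and> open U} U"
    using assms(3) unfolding weak_topology_def openin_topology_generated_by_iff .
  then show ?thesis using assms(4)
  proof induction
    case Empty
    then show ?case by simp
  next
    case (Int a b)
    obtain d p where 1: "\<And>\<nu>. \<nu>\<in>borel_probs X \<Longrightarrow>
      (\<forall>k<d. \<bar>(\<integral>t. f k t \<partial>\<nu>) - (\<integral>t. f k t \<partial>\<mu>)\<bar> < 1 / Suc p) \<Longrightarrow> \<nu> \<in> a"
      using Int by blast
    obtain d' p' where 2: "\<And>\<nu>. \<nu>\<in>borel_probs X \<Longrightarrow>
      (\<forall>k<d'. \<bar>(\<integral>t. f k t \<partial>\<nu>) - (\<integral>t. f k t \<partial>\<mu>)\<bar> < 1 / Suc p') \<Longrightarrow> \<nu> \<in> b"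
      using Int by blast
    have le: "1 / real (Suc (max p p')) \<le> 1 / Suc p" "1 / real (Suc (max p p')) \<le> 1 / Suc p'"
      by (auto intro!: divide_left_mono)
    have "\<nu> \<in> a \<inter> b" if nu: "\<nu>\<in>borel_probs X"
      and *: "\<forall>k<max d d'. \<bar>(\<integral>t. f k t \<partial>\<nu>) - (\<integral>t. f k t \<partial>\<mu>)\<bar> < 1 / Suc (max p p')" for \<nu>
    proof
      show "\<nu> \<in> a"
      proof (intro 1[OF nu] allI impI)
        fix k assume "k < d"
        then have "\<bar>(\<integral>t. f k t \<partial>\<nu>) - (\<integral>t. f k t \<partial>\<mu>)\<bar> < 1 / Suc (max p p')" using * by auto
        then show "\<bar>(\<integral>t. f k t \<partial>\<nu>) - (\<integral>t. f k t \<partial>\<mu>)\<bar> < 1 / Suc p" using le(1) by (rule less_le_trans)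
      qed
      show "\<nu> \<in> b"
      proof (intro 2[OF nu] allI impI)
        fix k assume "k < d'"
        then have "\<bar>(\<integral>t. f k t \<partial>\<nu>) - (\<integral>t. f k t \<partial>\<mu>)\<bar> < 1 / Suc (max p p')" using * by auto
        then show "\<bar>(\<integral>t. f k t \<partial>\<nu>) - (\<integral>t. f k t \<partial>\<mu>)\<bar> < 1 / Suc p'" using le(2) by (rule less_le_trans)
      qed
    qed
    then show ?case by blast
  next
    case (UN K)
    then obtain k where k: "k \<in> K" "\<mu> \<in> k" by auto
    with UN.IH[OF k] show ?case by blast
  next
    case (Basis s)
    from Basis(1) obtain g :: "'a \<Rightarrow> real" and V where s: "s = {\<mu> \<in> borel_probs X. (\<integral>t. g t \<partial>\<mu>) \<in> V}"
      and g: "continuous_on X g" "open V" unfolding mem_Collect_eq by (elim exE conjE) (rule that)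
    from Basis(2) s have "(\<integral>t. g t \<partial>\<mu>) \<in> V" by auto
    then obtain e where e: "e > 0" "\<And>y. \<bar>y - (\<integral>t. g t \<partial>\<mu>)\<bar> < e \<Longrightarrow> y \<in> V"
      using g(2) unfolding open_dist dist_real_def by blast
    obtain p where p: "1 / Suc p < e / 4"
      using reals_Archimedean[of "e/4"] e(1) by (auto simp: inverse_eq_divide)
    obtain k where k: "\<And>t. t \<in> X \<Longrightarrow> \<bar>f k t - g t\<bar> \<le> e / 4"
      using assms(2) g(1) e(1) unfolding dense_functions_def by (meson zero_less_divide_iff zero_less_numeral)
    have fk: "continuous_on X (f k)" using assms(2) by (auto simp: dense_functions_def)
    have "\<nu> \<in> s" if nu: "\<nu> \<in> borel_probs X"
       and "\<forall>j<Suc k. \<bar>(\<integral>t. f j t \<partial>\<nu>) - (\<integral>t. f j t \<partial>\<mu>)\<bar> < 1 / Suc p" for \<nu>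
    proof -
      have "\<bar>(\<integral>t. f k t \<partial>\<nu>) - (\<integral>t. f k t \<partial>\<mu>)\<bar> < e / 4" using that p by fastforce
      moreover have "\<bar>(\<integral>t. f k t \<partial>\<nu>) - (\<integral>t. g t \<partial>\<nu>)\<bar> \<le> e / 4"
        "\<bar>(\<integral>t. f k t \<partial>\<mu>) - (\<integral>t. g t \<partial>\<mu>)\<bar> \<le> e / 4"
        using integral_continuous_diff_le[OF assms(1) fk g(1) _ k] nu mu by blast+
      ultimately have "\<bar>(\<integral>t. g t \<partial>\<nu>) - (\<integral>t. g t \<partial>\<mu>)\<bar> < e" using e(1) by linarith
      then show ?thesis using e(2) nu by (simp add: s)
    qed
    then show ?case by blast
  qed
qed

lemma tendsto_integral_dense_functions:
  fixes g :: "'a::topological_space \<Rightarrow> real"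
  assumes "compact X" "dense_functions X f" "\<And>i. y i \<in> borel_probs X" "\<mu> \<in> borel_probs X"
    and "\<And>k. (\<lambda>i. \<integral>t. f k t \<partial>(y i)) \<longlonglongrightarrow> (\<integral>t. f k t \<partial>\<mu>)" and g: "continuous_on X g"
  shows "(\<lambda>i::nat. \<integral>t. g t \<partial>(y i)) \<longlonglongrightarrow> (\<integral>t. g t \<partial>\<mu>)"
proof (rule LIMSEQ_I)
  fix e :: real assume e: "e > 0"
  obtain k where k: "\<And>t. t \<in> X \<Longrightarrow> \<bar>f k t - g t\<bar> \<le> e / 4"
    using assms(2) g(1) e(1) unfolding dense_functions_def by (meson zero_less_divide_iff zero_less_numeral)
  have fk: "continuous_on X (f k)" using assms(2) by (auto simp: dense_functions_def)
  have *: "\<bar>(\<integral>t. f k t \<partial>\<nu>) - (\<integral>t. g t \<partial>\<nu>)\<bar> \<le> e / 4" if "\<nu> \<in> borel_probs X" for \<nu>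
    using integral_continuous_diff_le[OF assms(1) fk g that k] .
  have "\<exists>no. \<forall>n\<ge>no. norm ((\<integral>t. f k t \<partial>(y n)) - (\<integral>t. f k t \<partial>\<mu>)) < e / 4"
    using e by (intro LIMSEQ_D[OF assms(5)[of k]]) auto
  then obtain no where no: "\<And>n. n \<ge> no \<Longrightarrow> \<bar>(\<integral>t. f k t \<partial>(y n)) - (\<integral>t. f k t \<partial>\<mu>)\<bar> < e / 4"
    by auto
  have "\<bar>(\<integral>t. g t \<partial>(y n)) - (\<integral>t. g t \<partial>\<mu>)\<bar> < e" if "n \<ge> no" for n
    using no[OF that] *[OF assms(3)[of n]] *[OF assms(4)] e by linarith
  then show "\<exists>no. \<forall>n\<ge>no. norm ((\<integral>t. g t \<partial>(y n)) - (\<integral>t. g t \<partial>\<mu>)) < e"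
    by auto
qed

text \<open>Diagonal choice: \<open>r i\<close> is taken beyond \<open>i\<close> and such that the
  first \<open>i\<close> test functions are matched up to \<open>1 / Suc i\<close>. The indices
  \<open>r i\<close> tend to infinity but need not increase.\<close>

lemma accumulation_point_subsequence:
  fixes X :: "'a::topological_space set"
  assumes "compact X" "dense_functions X f"
    and "\<And>n. n \<in> D \<Longrightarrow> y n \<in> borel_probs X"
    and "\<mu> \<in> accumulation_points (weak_topology X) D y"
  obtains r where "\<And>i. r i \<in> D" "filterlim r at_top sequentially"
    "\<And>g :: _ \<Rightarrow> real. continuous_on X g \<Longrightarrow> (\<lambda>i::nat. \<integral>t. g t \<partial>(y (r i))) \<longlonglongrightarrow> (\<integral>t. g t \<partial>\<mu>)"
proof -
  have fc: "continuous_on X (f k)" for k using assms(2) by (auto simp: dense_functions_def)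
  have mu: "\<mu> \<in> borel_probs X"
    using assms(4) closure_of_subset_topspace[of "weak_topology X"]
    by (force simp: accumulation_points_def topspace_weak_topology)
  have "\<exists>n\<in>D. n \<ge> i + 1 \<and> (\<forall>k<i. \<bar>(\<integral>t. f k t \<partial>(y n)) - (\<integral>t. f k t \<partial>\<mu>)\<bar> < 1 / Suc i)" for i
  proof -
    let ?U = "{\<nu> \<in> borel_probs X. \<forall>k<i. \<bar>(\<integral>t. f k t \<partial>\<nu>) - (\<integral>t. f k t \<partial>\<mu>)\<bar> < 1 / Suc i}"
    have "\<mu> \<in> ?U" "openin (weak_topology X) ?U"
      using mu openin_weak_topology_nbhd[OF assms(1) fc] by auto
    moreover have "\<mu> \<in> weak_topology X closure_of (y ` {n \<in> D. n \<ge> i + 1})"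
      using assms(4) by (auto simp: accumulation_points_def)
    ultimately have "\<exists>\<nu>. \<nu> \<in> y ` {n \<in> D. n \<ge> i + 1} \<and> \<nu> \<in> ?U"
      unfolding in_closure_of by (elim conjE) (erule allE, erule mp, intro conjI)
    then show ?thesis by auto
  qed
  then obtain r where r: "\<And>i. r i \<in> D" "\<And>i. r i \<ge> i + 1"
    "\<And>i k. k < i \<Longrightarrow> \<bar>(\<integral>t. f k t \<partial>(y (r i))) - (\<integral>t. f k t \<partial>\<mu>)\<bar> < 1 / Suc i"
    by metis
  have "(\<lambda>i. (\<integral>t. f k t \<partial>(y (r i))) - (\<integral>t. f k t \<partial>\<mu>)) \<longlonglongrightarrow> 0" for k
  proof (rule Lim_null_comparison)
    show "\<forall>\<^sub>F i in sequentially. norm ((\<integral>t. f k t \<partial>(y (r i))) - (\<integral>t. f k t \<partial>\<mu>)) \<le> 1 / Suc i"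
      using eventually_gt_at_top[of k] by eventually_elim (use r(3) in \<open>auto intro: less_imp_le\<close>)
    show "(\<lambda>i. 1 / real (Suc i)) \<longlonglongrightarrow> 0"
      using LIMSEQ_inverse_real_of_nat by (simp add: inverse_eq_divide)
  qed
  then have lim: "(\<lambda>i. \<integral>t. f k t \<partial>(y (r i))) \<longlonglongrightarrow> (\<integral>t. f k t \<partial>\<mu>)" for k
    by (rule LIM_zero_cancel)
  have "filterlim r at_top sequentially"
    using r(2) by (intro filterlim_at_top_mono[OF filterlim_ident] always_eventually allI) (metis Suc_eq_plus1 Suc_leD)
  moreover have "(\<lambda>i. \<integral>t. g t \<partial>(y (r i))) \<longlonglongrightarrow> (\<integral>t. g t \<partial>\<mu>)" if "continuous_on X g" for g :: "'a \<Rightarrow> real"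
    using tendsto_integral_dense_functions[of X f "\<lambda>i. y (r i)" \<mu> g] assms lim mu r that by auto
  ultimately show ?thesis using that r(1) by blast
qed

lemma limit_in_accumulation_points:
  assumes "compact X" "dense_functions X f" "\<mu> \<in> borel_probs X"
    and "\<And>i. y (r i) \<in> borel_probs X" "\<And>i. r i \<in> D" "filterlim r at_top sequentially"
    and "\<And>g :: _ \<Rightarrow> real. continuous_on X g \<Longrightarrow> (\<lambda>i::nat. \<integral>t. g t \<partial>(y (r i))) \<longlonglongrightarrow> (\<integral>t. g t \<partial>\<mu>)"
  shows "\<mu> \<in> accumulation_points (weak_topology X) D y"
proof -
  have "\<exists>n\<in>{n \<in> D. n \<ge> n0}. y n \<in> U" if U: "openin (weak_topology X) U" "\<mu> \<in> U" for n0 U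
  proof -
    obtain d p where dp: "\<And>\<nu>. \<nu>\<in>borel_probs X \<Longrightarrow>
      (\<forall>k<d. \<bar>(\<integral>t. f k t \<partial>\<nu>) - (\<integral>t. f k t \<partial>\<mu>)\<bar> < 1 / Suc p) \<Longrightarrow> \<nu> \<in> U"
      using weak_nbhd_dense_functions[OF assms(1,2) U] by blast
    have "\<forall>\<^sub>F i in sequentially. \<forall>k\<in>{..<d}. \<bar>(\<integral>t. f k t \<partial>(y (r i))) - (\<integral>t. f k t \<partial>\<mu>)\<bar> < 1 / Suc p"
    proof (rule eventually_ball_finite)
      show "\<forall>k\<in>{..<d}. \<forall>\<^sub>F i in sequentially. \<bar>(\<integral>t. f k t \<partial>(y (r i))) - (\<integral>t. f k t \<partial>\<mu>)\<bar> < 1 / Suc p"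
      proof
        fix k
        have "continuous_on X (f k)" using assms(2) by (simp add: dense_functions_def)
        from tendstoD[OF assms(7)[OF this], of "1 / Suc p"]
        show "\<forall>\<^sub>F i in sequentially. \<bar>(\<integral>t. f k t \<partial>(y (r i))) - (\<integral>t. f k t \<partial>\<mu>)\<bar> < 1 / Suc p"
          by (simp add: dist_real_def)
      qed
    qed simp
    moreover have "\<forall>\<^sub>F i in sequentially. r i \<ge> n0"
      using assms(6) by (auto simp: filterlim_at_top)
    ultimately have "\<forall>\<^sub>F i in sequentially. r i \<ge> n0 \<and> y (r i) \<in> U"
      by eventually_elim (use dp[OF assms(4)] in auto)
    then obtain i where "r i \<ge> n0" "y (r i) \<in> U"
      using eventually_happens'[OF sequentially_bot] by blast
    then show ?thesis using assms(5) by blast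
  qed
  then show ?thesis
    using assms(3) by (auto simp: accumulation_points_def in_closure_of topspace_weak_topology)
qed

section \<open>Separability and approximation\<close>

text \<open>The union over \<open>n\<close> of finite nets of radius \<open>1 / Suc n\<close>
  contains a finite net of every radius.\<close>

lemma compact_countable_nets:
  fixes X :: "'a::metric_space set"
  assumes "compact X"
  shows "\<exists>D. countable D \<and> D \<subseteq> X \<and>
    (\<forall>e>0. \<exists>K. finite K \<and> K \<subseteq> D \<and> X \<subseteq> (\<Union>p\<in>K. ball p e))"
proof -
  have "\<exists>K. finite K \<and> K \<subseteq> X \<and> X \<subseteq> (\<Union>p\<in>K. ball p (1 / Suc n))" for n
    using seq_compact_imp_totally_bounded[of X] assms by (simp add: compact_eq_seq_compact_metric)
  then obtain K where K: "\<And>n. finite (K n)" "\<And>n. K n \<subseteq> X" "\<And>n. X \<subseteq> (\<Union>p\<in>K n. ball p (1 / Suc n))"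
    by metis
  have "\<exists>K'. finite K' \<and> K' \<subseteq> (\<Union>n. K n) \<and> X \<subseteq> (\<Union>p\<in>K'. ball p e)" if "e > 0" for e
  proof -
    obtain n where n: "1 / Suc n < e"
      using reals_Archimedean[of e] \<open>e > 0\<close> by (auto simp: inverse_eq_divide)
    then have "(\<Union>p\<in>K n. ball p (1 / Suc n)) \<subseteq> (\<Union>p\<in>K n. ball p e)"
      by (intro UN_mono) (auto simp: subset_ball)
    then show ?thesis
      using K(1)[of n] K(3)[of n] by (intro exI[of _ "K n"]) blast
  qed
  moreover have "countable (\<Union>n. K n)" "(\<Union>n. K n) \<subseteq> X"
    using K by (auto intro: countable_finite)
  ultimately show ?thesis by (intro exI[of _ "\<Union>n. K n"]) simp
qed

text \<open>Maxima of finitely many cones with vertices in a countable set and rational data approximate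
  every continuous function, because a uniformly continuous function lies above steep cones with
  vertices just below its graph.\<close>

definition cone_max :: "real \<Rightarrow> real \<Rightarrow> ('a::metric_space \<times> real) list \<Rightarrow> 'a \<Rightarrow> real" where
  "cone_max L c l t = foldr (\<lambda>(p, r) y. max (r - L * dist t p) y) l c"

text \<open>This serves both estimates: upper bounds are checked cone by cone, and taking
  \<open>v\<close> to be the maximum itself shows that each cone lies below it.\<close>

lemma cone_max_le_iff:
  "cone_max L c l t \<le> v \<longleftrightarrow> c \<le> v \<and> (\<forall>(p, r) \<in> set l. r - L * dist t p \<le> v)"
  unfolding cone_max_def by (induction l) auto

lemma continuous_on_cone_max: "continuous_on X (cone_max L c l)"
  unfolding cone_max_def by (induction l) (auto simp: case_prod_beta intro!: continuous_intros)

lemma ex_dense_functions: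
  fixes X :: "'a::metric_space set"
  assumes "compact X"
  obtains f where "dense_functions X f"
proof -
  obtain D where D: "countable D" "D \<subseteq> X"
    "\<forall>e>0. \<exists>K. finite K \<and> K \<subseteq> D \<and> X \<subseteq> (\<Union>p\<in>K. ball p e)"
    using compact_countable_nets[OF assms] by (elim exE conjE)
  define S where "S = (\<lambda>(L, c, l). cone_max (real L) (- real c) l) ` (UNIV \<times> UNIV \<times> lists (D \<times> \<rat>))"
  have S: "countable S" "S \<noteq> {}"
  proof -
    show "countable S" unfolding S_def
      by (intro countable_image countable_SIGMA countable_lists countableI_type countable_rat D(1))
    show "S \<noteq> {}" unfolding S_def by auto
  qed
  have approx: "\<exists>h\<in>S. \<forall>t\<in>X. \<bar>h t - g t\<bar> \<le> e" if g: "continuous_on X g" and e: "e > 0" for g e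
  proof -
    obtain B where B: "B > 0" "\<And>t. t \<in> X \<Longrightarrow> \<bar>g t\<bar> \<le> B"
      using compact_continuous_bound[OF assms g] by blast
    obtain d where d: "d > 0" "\<And>s t. s \<in> X \<Longrightarrow> t \<in> X \<Longrightarrow> dist s t < d \<Longrightarrow> \<bar>g s - g t\<bar> < e / 4"
      using compact_uniformly_continuous[OF g assms] e unfolding uniformly_continuous_on_def
      by (metis dist_real_def zero_less_divide_iff zero_less_numeral)
    \<comment> \<open>The slope is so steep that a cone with vertex below \<open>B\<close> has
      dropped below \<open>-B\<close>, hence below \<open>g\<close>, at distance
      \<open>d\<close>.\<close>
    obtain L :: nat where L: "2 * B / d \<le> real L" using real_arch_simple by blast
    obtain c :: nat where c: "B \<le> real c" using real_arch_simple by blast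
    \<comment> \<open>The net radius: the nearest vertex is close enough for uniform continuity, and
      its cone has lost at most \<open>e / 4\<close> on the way. Adding \<open>1\<close> avoids a
      zero denominator when \<open>L = 0\<close>.\<close>
    define h where "h = min d (e / (4 * (real L + 1)))"
    have h: "h > 0" "h \<le> d" "real L * h \<le> e / 4"
    proof -
      show "h > 0" "h \<le> d" using d e by (auto simp: h_def)
      have "real L * h \<le> real L * (e / (4 * (real L + 1)))"
        by (intro mult_left_mono) (auto simp: h_def)
      also have "\<dots> \<le> e / 4" using e by (simp add: field_simps)
      finally show "real L * h \<le> e / 4" .
    qed
    obtain K where K: "finite K" "K \<subseteq> D" "X \<subseteq> (\<Union>p\<in>K. ball p h)" using D(3)[rule_format, OF h(1)] by (elim exE conjE)
    obtain ps where ps: "set ps = K" using finite_list[OF K(1)] by blast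
    have "\<exists>r\<in>\<rat>. g p - e / 4 < r \<and> r < g p" for p
      by (rule Rats_dense_in_real) (use e in simp)
    then obtain r where r: "\<And>p. r p \<in> \<rat>" "\<And>p. g p - e / 4 < r p" "\<And>p. r p < g p" by metis
    let ?h = "cone_max (real L) (- real c) (map (\<lambda>p. (p, r p)) ps)"
    have "?h \<in> S"
      unfolding S_def using ps K(2) r(1)
      by (intro image_eqI[of _ _ "(L, c, map (\<lambda>p. (p, r p)) ps)"]) auto
    moreover have "\<bar>?h t - g t\<bar> \<le> e" if t: "t \<in> X" for t
    proof -
      have "?h t \<le> g t + e"
        unfolding cone_max_le_iff
      proof (intro conjI ballI)
        show "- real c \<le> g t + e" using B(2)[OF t] c e by linarith
        fix z assume "z \<in> set (map (\<lambda>p. (p, r p)) ps)"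
        then obtain p where p: "p \<in> K" "z = (p, r p)" using ps by auto
        then have pX: "p \<in> X" using K(2) D(2) by blast
        have "r p - real L * dist t p \<le> g t + e"
        proof (cases "dist t p < d")
          case True
          have "0 \<le> real L * dist t p" by simp
          then show ?thesis using d(2)[OF t pX True] r(3)[of p] e by linarith
        next
          case False
          have "2 * B \<le> real L * d" using L d(1) by (simp add: field_simps)
          also have "\<dots> \<le> real L * dist t p" using False by (intro mult_left_mono) auto
          finally show ?thesis using r(3)[of p] B(2)[OF t] B(2)[OF pX] e by linarith
        qed
        then show "case z of (p, r) \<Rightarrow> r - real L * dist t p \<le> g t + e" using p by simp
      qed
      moreover have "?h t \<ge> g t - e"
      proof -
        obtain p where p: "p \<in> K" "dist t p < h" using K(3) t by (auto simp: dist_commute)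
        then have pX: "p \<in> X" using K(2) D(2) by blast
        have "r p - real L * dist t p \<le> ?h t"
          using cone_max_le_iff[of "real L" "- real c" "map (\<lambda>p. (p, r p)) ps" t "?h t"] p(1) ps by auto
        moreover have "real L * dist t p \<le> real L * h" using p(2) by (intro mult_left_mono) auto
        moreover have "\<bar>g t - g p\<bar> < e / 4" using d(2)[OF t pX] p(2) h(2) by linarith
        ultimately show ?thesis using r(2)[of p] h(3) e by linarith
      qed
      ultimately show ?thesis by linarith
    qed
    ultimately show ?thesis by blast
  qed
  have "dense_functions X (from_nat_into S)"
    unfolding dense_functions_def
  proof (intro conjI allI impI)
    fix k
    have "from_nat_into S k \<in> S" by (rule from_nat_into[OF S(2)])
    then show "continuous_on X (from_nat_into S k)"
      by (auto simp: S_def continuous_on_cone_max)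
  next
    fix g :: "'a \<Rightarrow> real" and e :: real
    assume "continuous_on X g" "e > 0"
    then obtain h where "h \<in> S" "\<forall>t\<in>X. \<bar>h t - g t\<bar> \<le> e" using approx by blast
    then show "\<exists>k. \<forall>t\<in>X. \<bar>from_nat_into S k t - g t\<bar> \<le> e"
      using from_nat_into_surj[OF S(1)] by metis
  qed
  then show ?thesis using that by blast
qed

lemma closed_indicator_approx:
  fixes C :: "'a::metric_space set"
  assumes "closed C"
  obtains f :: "nat \<Rightarrow> 'a \<Rightarrow> real" where "\<forall>n. continuous_on UNIV (f n)" "\<forall>n t. f n t \<in> {0..1}"
    "\<forall>t. (\<lambda>n. f n t) \<longlonglongrightarrow> indicator C t"
proof (cases "C = {}")
  \<comment> \<open>The distance to the empty set is \<open>0\<close> by convention, so the formula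
    used below would give the constant \<open>1\<close> here.\<close>
  case True
  show ?thesis
    by (rule that[of "\<lambda>_ _. 0"]) (auto simp: True)
next
  case False
  define f where "f = (\<lambda>(n::nat) t. max 0 (1 - real n * infdist t C))"
  have "(\<lambda>n. f n t) \<longlonglongrightarrow> indicator C t" for t
  proof (cases "t \<in> C")
    case True
    then have "infdist t C = 0" by simp
    then show ?thesis using True by (simp add: f_def)
  next
    case nt: False
    then have pos: "infdist t C > 0"
      using in_closed_iff_infdist_zero[OF assms False] infdist_nonneg[of t C] by (metis less_eq_real_def)
    obtain N :: nat where N: "1 / infdist t C \<le> real N" using real_arch_simple by blast
    have "f n t = 0" if "n \<ge> N" for n
    proof -
      have "1 \<le> real N * infdist t C" using N pos by (simp add: field_simps)
      also have "\<dots> \<le> real n * infdist t C" using that pos by (intro mult_right_mono) auto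
      finally show ?thesis by (simp add: f_def)
    qed
    then have "eventually (\<lambda>n. f n t = indicator C t) sequentially"
      using nt by (auto simp: eventually_sequentially)
    then show ?thesis by (rule tendsto_eventually)
  qed
  moreover have "continuous_on UNIV (f n)" for n
    unfolding f_def by (intro continuous_intros)
  moreover have "f n t \<in> {0..1}" for n t
    by (auto simp: f_def infdist_nonneg)
  ultimately show ?thesis using that by blast
qed

text \<open>One \<open>f\<close> must serve both measures, since an inequality between integrals of
  the same \<open>f\<close> is to be transferred to sets. Closed sets follow by dominated
  convergence, complements by \<open>1 - f\<close>, and disjoint unions by truncated finite sums;
  closed sets are stable under intersection, so this reaches all Borel sets.\<close>

lemma borel_indicator_approx:
  fixes X :: "'a::metric_space set"
  assumes mu: "\<mu> \<in> borel_probs X" and la: "lam \<in> borel_probs X"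
    and "B \<in> sets (borel :: 'a measure)" "e > 0"
  shows "\<exists>f :: 'a \<Rightarrow> real. continuous_on UNIV f \<and> (\<forall>t. f t \<in> {0..1}) \<and>
     (\<integral>t. \<bar>f t - indicator B t\<bar> \<partial>\<mu>) < e \<and> (\<integral>t. \<bar>f t - indicator B t\<bar> \<partial>lam) < e"
proof -
  define D where "D \<nu> f B = (\<integral>t. \<bar>f t - indicator B t\<bar> \<partial>\<nu>)" for \<nu> :: "'a measure" and f :: "'a \<Rightarrow> real" and B :: "'a set"
  have mi: "(indicator B :: 'a \<Rightarrow> real) \<in> borel_measurable \<nu>" if "\<nu> \<in> {\<mu>, lam}" "B \<in> sets borel" for \<nu> and B :: "'a set"
  proof -
    have "(indicator B :: 'a \<Rightarrow> real) \<in> borel_measurable (restrict_space borel X)"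
      using that(2) by (intro measurable_restrict_space1) simp
    then show ?thesis using that mu la measurable_borel_probs by blast
  qed
  have mf: "f \<in> borel_measurable \<nu>" if "\<nu> \<in> {\<mu>, lam}" "continuous_on UNIV f" for \<nu> and f :: "'a \<Rightarrow> real"
    using that mu la continuous_measurable_borel_probs continuous_on_subset subset_UNIV by blast
  have int: "integrable \<nu> (\<lambda>t. \<bar>f t - indicator B t\<bar>)"
    if "\<nu> \<in> {\<mu>, lam}" "B \<in> sets borel" "continuous_on UNIV f" "\<And>t. f t \<in> {0..1}" for \<nu> and f :: "'a \<Rightarrow> real" and B
  proof (rule integrable_bounded_borel_probs[of _ X _ 1])
    show "\<nu> \<in> borel_probs X" using that(1) mu la by blast
    show "(\<lambda>t. \<bar>f t - indicator B t\<bar>) \<in> borel_measurable \<nu>"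
      using mi[OF that(1,2)] mf[OF that(1,3)] by measurable
    show "\<bar>\<bar>f t - indicator B t\<bar>\<bar> \<le> 1" for t
      using that(4)[of t] by (auto simp: indicator_def abs_if)
  qed
  define P where "P B \<longleftrightarrow> (\<forall>e>0. \<exists>f. continuous_on UNIV f \<and> (\<forall>t. f t \<in> {0..1}) \<and>
     D \<mu> f B < e \<and> D lam f B < e)" for B
  have sb: "sigma_sets UNIV (Collect closed) = sets (borel :: 'a measure)"
    by (simp add: borel_eq_closed)
  have "Int_stable (Collect closed :: 'a set set)"
    by (auto simp: Int_stable_def)
  moreover have "Collect closed \<subseteq> Pow (UNIV :: 'a set)" by simp
  moreover have "B \<in> sigma_sets UNIV (Collect closed)"
    using assms(3) by (simp add: sb)
  ultimately have "P B"
  proof (induction rule: sigma_sets_induct_disjoint)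
    case (basic C)
    then have C: "closed C" by simp
    obtain f where f': "\<forall>n. continuous_on UNIV (f n)" "\<forall>n t. f n t \<in> {0..1::real}"
      "\<forall>t. (\<lambda>n::nat. f n t) \<longlonglongrightarrow> indicator C t" using closed_indicator_approx[OF C] by metis
    note f = f'(1)[rule_format] f'(2)[rule_format] f'(3)[rule_format]
    have Cb: "C \<in> sets borel" using C by simp
    have lim: "(\<lambda>n. D \<nu> (f n) C) \<longlonglongrightarrow> 0" if nu: "\<nu> \<in> {\<mu>, lam}" for \<nu>
    proof -
      interpret prob_space \<nu> using nu mu la prob_space_borel_probs by blast
      have "(\<lambda>n. \<integral>t. \<bar>f n t - indicator C t\<bar> \<partial>\<nu>) \<longlonglongrightarrow> (\<integral>t. 0 \<partial>\<nu>)"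
      proof (rule integral_dominated_convergence[where w="\<lambda>_. 1"])
        show "(\<lambda>t. \<bar>f n t - indicator C t\<bar>) \<in> borel_measurable \<nu>" for n
          using int[OF nu Cb f(1)[of n] f(2)[of n]] by (rule borel_measurable_integrable)
        show "AE t in \<nu>. (\<lambda>n. \<bar>f n t - indicator C t\<bar>) \<longlonglongrightarrow> 0"
        proof (rule AE_I2)
          fix t
          have "(\<lambda>n. \<bar>f n t - indicator C t\<bar>) \<longlonglongrightarrow> \<bar>indicator C t - indicator C t\<bar>"
            by (intro tendsto_intros f(3))
          then show "(\<lambda>n. \<bar>f n t - indicator C t\<bar>) \<longlonglongrightarrow> 0" by simp
        qed
        show "AE t in \<nu>. norm \<bar>f n t - indicator C t\<bar> \<le> 1" for n
        proof (rule AE_I2)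
          fix t show "norm \<bar>f n t - indicator C t\<bar> \<le> 1"
            using f(2)[of n t] by (auto simp: indicator_def abs_if)
        qed
      qed auto
      then show ?thesis by (simp add: D_def)
    qed
    show ?case unfolding P_def
    proof (intro allI impI)
      fix e :: real assume "e > 0"
      then have "\<forall>\<^sub>F n in sequentially. D \<mu> (f n) C < e \<and> D lam (f n) C < e"
        using order_tendstoD(2)[OF lim] by (auto intro: eventually_conj)
      then obtain n where "D \<mu> (f n) C < e \<and> D lam (f n) C < e"
        using eventually_happens'[OF sequentially_bot] by blast
      then show "\<exists>f. continuous_on UNIV f \<and> (\<forall>t. f t \<in> {0..1}) \<and> D \<mu> f C < e \<and> D lam f C < e"
        using f(1,2) by blast
    qed
  next
    case empty
    show ?case unfolding P_def by (auto simp: D_def intro!: exI[of _ "\<lambda>_. 0"])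
  next
    case (compl A)
    have "D \<nu> (\<lambda>t. 1 - f t) (UNIV - A) = D \<nu> f A" for \<nu> f
      unfolding D_def by (intro Bochner_Integration.integral_cong) (auto simp: indicator_def)
    moreover have "continuous_on UNIV (\<lambda>t. 1 - f t)" if "continuous_on UNIV f" for f :: "'a \<Rightarrow> real"
      using that by (intro continuous_intros)
    ultimately show ?case using compl.IH unfolding P_def
      by (smt (verit) atLeastAtMost_iff)
  next
    case (union A)
    have Ab: "A i \<in> sets borel" for i using union.hyps sb by auto
    show ?case unfolding P_def
    proof (intro allI impI)
      fix e :: real assume e: "e > 0"
      \<comment> \<open>These errors sum to less than \<open>e / 2\<close>; the other half is kept
        for the tail of the union.\<close>
      have "\<exists>f. continuous_on UNIV f \<and> (\<forall>t. f t \<in> {0..1}) \<and>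
        D \<mu> f (A i) < e / 2 / 2 ^ Suc i \<and> D lam f (A i) < e / 2 / 2 ^ Suc i" for i
        using union.IH[of i] e unfolding P_def by simp
      then obtain f where f: "\<And>i. continuous_on UNIV (f i)" "\<And>i t. f i t \<in> {0..1}"
        and fD: "\<And>i. D \<mu> (f i) (A i) < e / 2 / 2 ^ Suc i" "\<And>i. D lam (f i) (A i) < e / 2 / 2 ^ Suc i"
        by metis
      \<comment> \<open>Truncation at \<open>1\<close> restores values in the unit interval and does
        not increase the distance to an indicator.\<close>
      define h where "h n t = min 1 (\<Sum>i<n. f i t)" for n t
      have h: "continuous_on UNIV (h n)" "h n t \<in> {0..1}" for n t
        unfolding h_def using f by (auto intro!: continuous_intros sum_nonneg)
      have Un: "(\<Union>i. A i) \<in> sets borel" "(\<Union>i<n. A i) \<in> sets borel" for n using Ab by auto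
      have ev: "\<forall>\<^sub>F n in sequentially. D \<nu> (h n) (\<Union>i. A i) < e"
        if nu: "\<nu> \<in> {\<mu>, lam}" and fD: "\<And>i. D \<nu> (f i) (A i) < e / 2 / 2 ^ Suc i" for \<nu>
      proof -
        interpret prob_space \<nu> using nu mu la prob_space_borel_probs by blast
        have mono: "(indicator (\<Union>i. A i) t :: real) - indicator (\<Union>i<n. A i) t \<ge> 0" for n t
          by (auto simp: indicator_def)
        have lim: "(\<lambda>n. \<integral>t. (indicator (\<Union>i. A i) t :: real) - indicator (\<Union>i<n. A i) t \<partial>\<nu>) \<longlonglongrightarrow> (\<integral>t. 0 \<partial>\<nu>)"
        proof (rule integral_dominated_convergence[where w="\<lambda>_. 1"])
          show "(\<lambda>t. (indicator (\<Union>i. A i) t :: real) - indicator (\<Union>i<n. A i) t) \<in> borel_measurable \<nu>" for n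
            using mi[OF nu Un(1)] mi[OF nu Un(2)[of n]] by measurable
          show "AE t in \<nu>. (\<lambda>n. (indicator (\<Union>i. A i) t :: real) - indicator (\<Union>i<n. A i) t) \<longlonglongrightarrow> 0"
          proof (rule AE_I2, rule tendsto_eventually)
            fix t
            show "\<forall>\<^sub>F n in sequentially. (indicator (\<Union>i. A i) t :: real) - indicator (\<Union>i<n. A i) t = 0"
            proof (cases "t \<in> (\<Union>i. A i)")
              case True
              then obtain i where i: "t \<in> A i" by blast
              show ?thesis
                using eventually_gt_at_top[of i] by eventually_elim (use i in \<open>auto simp: indicator_def\<close>)
            next
              case False
              then show ?thesis by (auto simp: indicator_def)
            qed
          qed
          show "AE t in \<nu>. norm ((indicator (\<Union>i. A i) t :: real) - indicator (\<Union>i<n. A i) t) \<le> 1" for n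
            by (intro AE_I2) (auto simp: indicator_def)
        qed auto
        have bound: "D \<nu> (h n) (\<Union>i. A i) \<le> e / 2 + (\<integral>t. indicator (\<Union>i. A i) t - indicator (\<Union>i<n. A i) t \<partial>\<nu>)" for n
        proof -
          have i1: "integrable \<nu> (\<lambda>t. \<bar>f i t - indicator (A i) t\<bar>)" for i
            by (rule int[OF nu Ab f])
          have i2: "integrable \<nu> (\<lambda>t. (indicator (\<Union>i. A i) t :: real) - indicator (\<Union>i<n. A i) t)"
          proof (intro integrable_const_bound[where B=1])
            show "AE t in \<nu>. norm ((indicator (\<Union>i. A i) t :: real) - indicator (\<Union>i<n. A i) t) \<le> 1"
              by (intro AE_I2) (auto simp: indicator_def)
          qed (intro borel_measurable_diff mi[OF nu Un(1)] mi[OF nu Un(2)])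
          have pw: "\<bar>h n t - indicator (\<Union>i. A i) t\<bar> \<le>
            (\<Sum>i<n. \<bar>f i t - indicator (A i) t\<bar>) + (indicator (\<Union>i. A i) t - indicator (\<Union>i<n. A i) t)" for t
          proof -
            have s: "(\<Sum>i<n. indicator (A i) t) = (indicator (\<Union>i<n. A i) t :: real)"
              using union.hyps(1) by (subst indicator_UN_disjoint) (auto simp: disjoint_family_on_def)
            have "\<bar>h n t - indicator (\<Union>i<n. A i) t\<bar> \<le> \<bar>(\<Sum>i<n. f i t) - indicator (\<Union>i<n. A i) t\<bar>"
              unfolding h_def using sum_nonneg[of "{..<n}" "\<lambda>i. f i t"] f(2)
              by (auto simp: indicator_def min_def abs_if)
            also have "\<dots> = \<bar>\<Sum>i<n. f i t - indicator (A i) t\<bar>"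
              by (simp add: sum_subtractf s)
            also have "\<dots> \<le> (\<Sum>i<n. \<bar>f i t - indicator (A i) t\<bar>)" by (rule sum_abs)
            finally show ?thesis using mono[of t n] by linarith
          qed
          have "D \<nu> (h n) (\<Union>i. A i) \<le> (\<integral>t. (\<Sum>i<n. \<bar>f i t - indicator (A i) t\<bar>) +
              (indicator (\<Union>i. A i) t - indicator (\<Union>i<n. A i) t) \<partial>\<nu>)"
            unfolding D_def
            by (intro integral_mono pw int[OF nu Un(1) h] Bochner_Integration.integrable_add
                Bochner_Integration.integrable_sum i1 i2)
          also have "\<dots> = (\<Sum>i<n. D \<nu> (f i) (A i)) + (\<integral>t. indicator (\<Union>i. A i) t - indicator (\<Union>i<n. A i) t \<partial>\<nu>)"
            unfolding D_def
            using Bochner_Integration.integral_add[OF Bochner_Integration.integrable_sum[of "{..<n}", OF i1] i2]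
              Bochner_Integration.integral_sum[of "{..<n}", OF i1] by simp
          also have "(\<Sum>i<n. D \<nu> (f i) (A i)) \<le> (\<Sum>i<n. e / 2 / 2 ^ Suc i)"
            by (intro sum_mono less_imp_le fD)
          also have "(\<Sum>i<n. e / 2 / 2 ^ Suc i) = e / 2 * (\<Sum>i<n. (1/2) ^ Suc i)"
            by (simp add: sum_distrib_left power_divide)
          also have "(\<Sum>i<n. (1/2::real) ^ Suc i) = 1 - (1/2) ^ n"
            by (induction n) (auto simp: field_simps)
          also have "e / 2 * (1 - (1/2) ^ n) \<le> e / 2" using e by (simp add: mult_left_le)
          finally show ?thesis by simp
        qed
        have "\<forall>\<^sub>F n in sequentially. (\<integral>t. (indicator (\<Union>i. A i) t :: real) - indicator (\<Union>i<n. A i) t \<partial>\<nu>) < e / 2"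
          using e by (intro order_tendstoD(2)[OF lim]) simp
        then show ?thesis
        proof eventually_elim
          case (elim n)
          then show ?case using bound[of n] by linarith
        qed
      qed
      have "\<forall>\<^sub>F n in sequentially. D \<mu> (h n) (\<Union>i. A i) < e \<and> D lam (h n) (\<Union>i. A i) < e"
        using ev fD by (auto intro: eventually_conj)
      then obtain n where "D \<mu> (h n) (\<Union>i. A i) < e \<and> D lam (h n) (\<Union>i. A i) < e"
        using eventually_happens'[OF sequentially_bot] by blast
      then show "\<exists>f. continuous_on UNIV f \<and> (\<forall>t. f t \<in> {0..1}) \<and>
          D \<mu> f (\<Union>i. A i) < e \<and> D lam f (\<Union>i. A i) < e"
        using h by blast
    qed
  qed
  then show ?thesis using assms(4) unfolding P_def D_def by simp
qed

section \<open>Ratio distributions and block averages\<close>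

text \<open>Compactness comes from tightness on the real line: the measures are pushed to
  \<open>borel\<close>, a convergent subsequence is extracted there, and the limit is carried back
  to the unit interval.\<close>

lemma ex_convergent_subsequence_unit_interval:
  assumes y: "\<And>i::nat. y i \<in> borel_probs {0..1::real}"
  shows "\<exists>r \<pi>. strict_mono r \<and> \<pi> \<in> borel_probs {0..1} \<and>
    (\<forall>g::real \<Rightarrow> real. continuous_on {0..1} g \<longrightarrow> (\<lambda>i. \<integral>t. g t \<partial>(y (r i))) \<longlonglongrightarrow> (\<integral>t. g t \<partial>\<pi>))"
proof -
  let ?R = "restrict_space borel {0..1::real}"
  define \<mu> where "\<mu> n = distr (y n) borel (\<lambda>t. t)" for n
  have idm: "(\<lambda>t. t) \<in> measurable (y n) borel" for n
    by (rule measurable_borel_probs[OF y]) (auto intro: measurable_restrict_space1)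
  have rd: "real_distribution (\<mu> n)" for n
    unfolding \<mu>_def by (intro prob_space.real_distribution_distr prob_space_borel_probs[OF y] idm)
  \<comment> \<open>Tightness uses intervals open on the left; the end \<open>-1\<close> keeps a
    possible atom at \<open>0\<close> inside.\<close>
  have "measure (\<mu> n) {-1<..1} = 1" for n
  proof -
    have sp: "space (y n) = {0..1}" by (rule space_borel_probs[OF y])
    have "measure (\<mu> n) {-1<..1} = measure (y n) ((\<lambda>t. t) -` {-1<..1} \<inter> space (y n))"
      unfolding \<mu>_def by (rule measure_distr[OF idm]) simp
    also have "(\<lambda>t. t) -` {-1<..1} \<inter> space (y n) = space (y n)" by (auto simp: sp)
    finally show ?thesis using prob_space.prob_space[OF prob_space_borel_probs[OF y]] by simp
  qed
  then have "tight \<mu>"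
    unfolding tight_def using rd by (intro conjI allI impI exI[of _ "-1"] exI[of _ 1]) auto
  then obtain r M where r: "strict_mono r" and M: "real_distribution M"
    and w: "weak_conv_m (\<mu> \<circ> (\<lambda>i. i) \<circ> r) M"
    using tight_imp_convergent_subsubsequence[of \<mu> "\<lambda>i. i"] by (auto simp: strict_mono_def)
  interpret M: real_distribution M by (rule M)
  \<comment> \<open>Clamping fixes the unit interval pointwise. Pushing the limit \<open>M\<close>
    forward along \<open>c\<close> yields a measure on that interval without first showing that
    \<open>M\<close> is concentrated there.\<close>
  define c :: "real \<Rightarrow> real" where "c t = max 0 (min 1 t)" for t
  have c: "continuous_on UNIV c" "c t \<in> {0..1}" for t
    unfolding c_def by (auto intro!: continuous_intros)
  have cm: "c \<in> measurable M ?R"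
    using c borel_measurable_continuous_onI[OF c(1)]
    by (intro measurable_restrict_space2) auto
  define \<pi> where "\<pi> = distr M ?R c"
  have pi: "\<pi> \<in> borel_probs {0..1}"
    unfolding borel_probs_def \<pi>_def using M.prob_space_distr[OF cm] by auto
  have "(\<lambda>i. \<integral>t. g t \<partial>(y (r i))) \<longlonglongrightarrow> (\<integral>t. g t \<partial>\<pi>)"
    if g: "continuous_on {0..1} g" for g :: "real \<Rightarrow> real"
  proof -
    have gc: "continuous_on UNIV (\<lambda>t. g (c t))"
      by (rule continuous_on_compose2[OF g c(1)]) (use c(2) in auto)
    obtain B where B: "\<And>t. t \<in> {0..1} \<Longrightarrow> \<bar>g t\<bar> \<le> B"
      using compact_continuous_bound[OF compact_Icc g] by metis
    have "(\<lambda>i. \<integral>t. g (c t) \<partial>((\<mu> \<circ> (\<lambda>i. i) \<circ> r) i)) \<longlonglongrightarrow> (\<integral>t. g (c t) \<partial>M)"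
    proof (rule weak_conv_imp_integral_bdd_continuous_conv[OF _ M w])
      show "real_distribution ((\<mu> \<circ> (\<lambda>i. i) \<circ> r) n)" for n using rd by simp
      show "isCont (\<lambda>t. g (c t)) t" for t using gc by (simp add: continuous_on_eq_continuous_at)
      show "norm (g (c t)) \<le> B" for t using B c(2) by simp
    qed
    moreover have "(\<integral>t. g (c t) \<partial>(\<mu> n)) = (\<integral>t. g t \<partial>(y n))" for n
    proof -
      have "(\<integral>t. g (c t) \<partial>(\<mu> n)) = (\<integral>t. g (c t) \<partial>(y n))"
        unfolding \<mu>_def using borel_measurable_continuous_onI[OF gc] by (intro integral_distr[OF idm])
      also have "\<dots> = (\<integral>t. g t \<partial>(y n))"
        by (intro Bochner_Integration.integral_cong) (auto simp: space_borel_probs[OF y] c_def)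
      finally show ?thesis .
    qed
    moreover have "(\<integral>t. g (c t) \<partial>M) = (\<integral>t. g t \<partial>\<pi>)"
      unfolding \<pi>_def
      by (rule integral_distr[OF cm borel_measurable_continuous_on_restrict[OF g], symmetric])
    ultimately show ?thesis by simp
  qed
  then show ?thesis using r pi by blast
qed

text \<open>The largest fraction of the selected points of a block of ratio \<open>t\<close> that
  can lie in a set of measure \<open>l\<close>. The case distinction gives the intended value
  \<open>1\<close> at \<open>t = 0\<close>, where the quotient would be \<open>0\<close>.\<close>

definition theta :: "real \<Rightarrow> real \<Rightarrow> real" where
  "theta l t = (if t \<le> l then 1 else l / t)"

lemma theta_nonneg: "0 \<le> l \<Longrightarrow> 0 \<le> theta l t"
  by (auto simp: theta_def)

lemma theta_le_1: "0 \<le> l \<Longrightarrow> theta l t \<le> 1"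
  by (auto simp: theta_def)

lemma theta_abs_le_1: "0 \<le> l \<Longrightarrow> \<bar>theta l t\<bar> \<le> 1"
  using theta_nonneg[of l t] theta_le_1[of l t] by simp

lemma theta_mono: "0 \<le> l \<Longrightarrow> l \<le> l' \<Longrightarrow> theta l t \<le> theta l' t"
  by (auto simp: theta_def intro: divide_right_mono)

lemma theta_eq_max: "0 < l \<Longrightarrow> theta l t = l / max l t"
  by (auto simp: theta_def max_def)

text \<open>For \<open>l = 0\<close> there is a jump at \<open>t = 0\<close>, so weak limits can be
  taken only for positive \<open>l\<close>. The upper bound secures this by adding a slack
  \<open>e\<close>, the lower bound by full support.\<close>

lemma continuous_on_theta: "0 < l \<Longrightarrow> continuous_on A (theta l)"
  by (subst continuous_on_cong[OF refl theta_eq_max]) (auto intro!: continuous_intros)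

lemma theta_measurable: "theta l \<in> borel_measurable borel"
  unfolding theta_def by measurable

lemma integrable_theta:
  assumes "\<pi> \<in> borel_probs X" "0 \<le> l"
  shows "integrable \<pi> (theta l)"
  by (rule integrable_bounded_borel_probs[OF assms(1) measurable_borel_probs[OF assms(1)]])
    (auto intro: measurable_restrict_space1 theta_measurable theta_abs_le_1[OF assms(2)])

text \<open>The restriction \<open>l \<le> 1\<close> matters: for \<open>l > 1\<close> the set \<open>{0..l}\<close> in the definition of \<open>F\<close> is not an
  event of \<open>\<pi>\<close> and has the junk measure \<open>0\<close>.\<close>

lemma F_eq_integral_theta:
  assumes pi: "\<pi> \<in> borel_probs {0..1}" and l: "0 \<le> l" "l \<le> 1"
  shows "F \<pi> l = (\<integral>t. theta l t \<partial>\<pi>)"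
proof -
  interpret prob_space \<pi> by (rule prob_space_borel_probs[OF pi])
  have sp: "space \<pi> = {0..1}" by (rule space_borel_probs[OF pi])
  have st: "A \<in> sets \<pi>" if "A \<in> sets borel" "A \<subseteq> {0..1}" for A
    using that by (auto simp: sets_borel_probs[OF pi] sets_restrict_space_iff)
  have s0: "{0..l} \<in> sets \<pi>" and s1: "{l<..1} \<in> sets \<pi>" using l by (auto intro!: st)
  have eq: "theta l t = indicator {0..l} t + l * (indicator {l<..1} t * (1 / t))"
    if "t \<in> space \<pi>" for t
    using that l by (auto simp: sp theta_def indicator_def)
  have i1: "integrable \<pi> (\<lambda>t. indicator {0..l} t :: real)"
    using s0 by (simp add: integrable_indicator_iff emeasure_eq_measure)
  \<comment> \<open>The factor \<open>l\<close> stays inside: for \<open>l = 0\<close> the function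
    \<open>1 / t\<close> may fail to be integrable, while the product is a difference of two
    integrable functions.\<close>
  have i2: "integrable \<pi> (\<lambda>t. l * (indicator {l<..1} t * (1 / t)))"
  proof -
    have "integrable \<pi> (\<lambda>t. theta l t - indicator {0..l} t)"
      using integrable_theta[OF pi l(1)] i1 by simp
    then show ?thesis
      by (rule Bochner_Integration.integrable_cong[THEN iffD1, rotated 2]) (auto simp: eq)
  qed
  have "(\<integral>t. theta l t \<partial>\<pi>) = (\<integral>t. indicator {0..l} t + l * (indicator {l<..1} t * (1 / t)) \<partial>\<pi>)"
    by (intro Bochner_Integration.integral_cong eq) auto
  also have "\<dots> = measure \<pi> {0..l} + l * (\<integral>t. indicator {l<..1} t * (1 / t) \<partial>\<pi>)"
  proof -
    have "{0..l} \<inter> space \<pi> = {0..l}" using l by (auto simp: sp)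
    then show ?thesis
      by (simp only: Bochner_Integration.integral_add[OF i1 i2] integral_mult_right_zero
          Bochner_Integration.integral_indicator)
  qed
  finally show ?thesis by (simp add: F_def set_lebesgue_integral_def)
qed

text \<open>Test functions bound the mass of a set only with a slightly larger \<open>l\<close>.
  Continuity from the right, also at \<open>l = 0\<close>, lets this slack vanish: once
  \<open>l + 1 / Suc n < t\<close> the second branch of \<open>theta\<close> applies.\<close>

lemma theta_integral_right_continuous:
  assumes pi: "\<pi> \<in> borel_probs X" and l: "0 \<le> l"
  shows "(\<lambda>n. \<integral>t. theta (l + 1 / Suc n) t \<partial>\<pi>) \<longlonglongrightarrow> (\<integral>t. theta l t \<partial>\<pi>)"
proof (rule integral_dominated_convergence[where w="\<lambda>_. 1"])
  interpret prob_space \<pi> by (rule prob_space_borel_probs[OF pi])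
  show "integrable \<pi> (\<lambda>_. 1::real)" by simp
  show "theta l \<in> borel_measurable \<pi>"
    using integrable_theta[OF pi l] by (rule borel_measurable_integrable)
  show "theta (l + 1 / Suc n) \<in> borel_measurable \<pi>" for n
    using integrable_theta[OF pi, of "l + 1 / Suc n"] l by (intro borel_measurable_integrable) auto
  show "AE t in \<pi>. norm (theta (l + 1 / Suc n) t) \<le> 1" for n
    using l by (intro AE_I2) (auto intro!: theta_abs_le_1)
  have lim: "(\<lambda>n. l + 1 / real (Suc n)) \<longlonglongrightarrow> l"
    using tendsto_add[OF tendsto_const[of l] LIMSEQ_inverse_real_of_nat] by (simp add: inverse_eq_divide)
  show "AE t in \<pi>. (\<lambda>n. theta (l + 1 / Suc n) t) \<longlonglongrightarrow> theta l t"
  proof (rule AE_I2)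
    fix t
    show "(\<lambda>n. theta (l + 1 / Suc n) t) \<longlonglongrightarrow> theta l t"
    proof (cases "t \<le> l")
      case True
      have "theta (l + 1 / Suc n) t = theta l t" for n
      proof -
        have "0 \<le> 1 / real (Suc n)" by simp
        then have "t \<le> l + 1 / Suc n" using True by linarith
        then show ?thesis using True by (simp add: theta_def)
      qed
      then show ?thesis by simp
    next
      case False
      then have "\<forall>\<^sub>F n in sequentially. l + 1 / real (Suc n) < t"
        using order_tendstoD(2)[OF lim] by auto
      then have "\<forall>\<^sub>F n in sequentially. (l + 1 / real (Suc n)) / t = theta (l + 1 / Suc n) t"
        by eventually_elim (auto simp: theta_def)
      moreover have "(\<lambda>n. (l + 1 / real (Suc n)) / t) \<longlonglongrightarrow> l / t"
        using False l by (intro tendsto_divide lim) auto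
      ultimately show ?thesis
        using False by (auto simp: theta_def intro: Lim_transform_eventually)
    qed
  qed
qed

section \<open>Sums over blocks and uniform block averages\<close>

lemma sum_blocks:
  assumes "interval_data a m"
  shows "sum h (T \<inter> {1..a J}) = (\<Sum>j=1..J. sum h (T \<inter> block a j))"
proof (induction J)
  case 0
  then show ?case using assms by (simp add: interval_data_def)
next
  case (Suc J)
  have "a J < a (Suc J)" using assms by (auto simp: interval_data_def strict_mono_def)
  then have "T \<inter> {1..a (Suc J)} = (T \<inter> {1..a J}) \<union> (T \<inter> block a (Suc J))"
    by (auto simp: block_def)
  moreover have "(T \<inter> {1..a J}) \<inter> (T \<inter> block a (Suc J)) = {}" by (auto simp: block_def)
  ultimately show ?case
    using Suc by (simp add: sum.union_disjoint block_def)
qed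

lemma card_blocks:
  assumes "interval_data a m" "\<And>j. 1 \<le> j \<Longrightarrow> j \<le> J \<Longrightarrow> card (T \<inter> block a j) = m j"
  shows "card (T \<inter> {1..a J}) = cum m J"
proof -
  have "card (T \<inter> {1..a J}) = (\<Sum>j=1..J. card (T \<inter> block a j))"
    using sum_blocks[OF assms(1), of "\<lambda>_. 1::nat" T J] by simp
  also have "\<dots> = cum m J"
    unfolding cum_def by (intro sum.cong) (auto simp: assms(2))
  finally show ?thesis .
qed

lemma block_length_pos: "interval_data a m \<Longrightarrow> 1 \<le> j \<Longrightarrow> block_length a j > 0"
  unfolding interval_data_def block_length_def strict_mono_def by simp

lemma block_pos: "s \<in> block a j \<Longrightarrow> 1 \<le> s"
  by (auto simp: block_def)

lemma ratio_range:
  assumes "interval_data a m" "1 \<le> j"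
  shows "ratio a m j \<in> {0..1}"
  using block_length_pos[OF assms] assms by (auto simp: ratio_def interval_data_def)

lemma ratio_distribution_borel_probs:
  assumes "interval_data a m" "cum m N > 0"
  shows "ratio_distribution a m N \<in> borel_probs {0..1}"
  unfolding ratio_distribution_def
proof (rule dirac_sum_borel_probs)
  have "(\<Sum>j=1..N. real (m j) / real (cum m N)) = real (cum m N) / real (cum m N)"
    by (simp add: sum_divide_distrib[symmetric] cum_def)
  then show "(\<Sum>j=1..N. real (m j) / real (cum m N)) = 1"
    using assms(2) by simp
qed (use ratio_range[OF assms(1)] in auto)

lemma integral_ratio_distribution:
  fixes g :: "real \<Rightarrow> real"
  assumes "interval_data a m" "g \<in> borel_measurable borel"
  shows "(\<integral>t. g t \<partial>(ratio_distribution a m N)) = (\<Sum>j=1..N. real (m j) * g (ratio a m j)) / real (cum m N)"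
  unfolding ratio_distribution_def
  by (subst integral_dirac_sum)
    (use ratio_range[OF assms(1)] assms(2) in \<open>auto simp: sum_divide_distrib intro: measurable_restrict_space1\<close>)

lemma seq_shift_funpow: "(seq_shift ^^ k) x i = x (i + k)"
  by (induction k arbitrary: i) (auto simp: seq_shift_def)

lemma well_distributed_averages:
  fixes X :: "'a::topological_space set" and f :: "'a \<Rightarrow> real"
  assumes "compact X" "lam \<in> borel_probs X" "\<And>n. n \<ge> 1 \<Longrightarrow> x n \<in> X"
    "well_distributed X x lam" "continuous_on X f" "e > 0"
  shows "\<exists>N0. \<forall>N\<ge>N0. \<forall>k\<ge>1. \<bar>(\<Sum>i=1..N. f (x (i + k))) / real N - (\<integral>t. f t \<partial>lam)\<bar> < e"
proof -
  let ?U = "{\<mu> \<in> borel_probs X. \<bar>(\<integral>t. f t \<partial>\<mu>) - (\<integral>t. f t \<partial>lam)\<bar> < e}"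
  have "openin (weak_topology X) ?U" "lam \<in> ?U"
    using openin_weak_topology_ball[OF assms(1,5)] assms(2,6) by auto
  then obtain N0 where "\<forall>N\<ge>N0. \<forall>k\<ge>1. empirical X ((seq_shift ^^ k) x) N \<in> ?U"
    using assms(4) unfolding well_distributed_def by (metis (no_types, lifting))
  moreover have "(\<integral>t. f t \<partial>(empirical X ((seq_shift ^^ k) x) N)) = (\<Sum>i=1..N. f (x (i + k))) / real N" for k N
    by (subst integral_empirical) (use assms(3,5) in \<open>auto simp: seq_shift_funpow\<close>)
  ultimately show ?thesis by auto
qed

text \<open>Block \<open>j\<close> is the window of length \<open>block_length a j\<close> seen
  after shifting by \<open>a (j - 1)\<close>. Both numbers vary with \<open>j\<close>, so
  convergence uniform in the shift is exactly what is required.\<close>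

lemma block_averages:
  fixes X :: "'a::topological_space set" and f :: "'a \<Rightarrow> real"
  assumes "compact X" "lam \<in> borel_probs X" "\<And>n. n \<ge> 1 \<Longrightarrow> x n \<in> X"
    "well_distributed X x lam" "interval_data a m" "filterlim (block_length a) at_top sequentially"
    "continuous_on X f" "e > 0"
  shows "\<exists>j1\<ge>1. \<forall>j\<ge>j1. \<bar>(\<Sum>s\<in>block a j. f (x s)) - real (block_length a j) * (\<integral>t. f t \<partial>lam)\<bar>
     \<le> real (block_length a j) * e"
proof -
  obtain N0 where N0: "\<And>N k. N \<ge> N0 \<Longrightarrow> k \<ge> 1 \<Longrightarrow>
      \<bar>(\<Sum>i=1..N. f (x (i + k))) / real N - (\<integral>t. f t \<partial>lam)\<bar> < e"
    using well_distributed_averages[OF assms(1-4,7,8)] by blast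
  have "\<forall>\<^sub>F j in sequentially. block_length a j \<ge> N0"
    using assms(6) by (auto simp: filterlim_at_top)
  then obtain j0 where j0: "\<And>j. j \<ge> j0 \<Longrightarrow> block_length a j \<ge> N0"
    by (auto simp: eventually_sequentially)
  have "\<bar>(\<Sum>s\<in>block a j. f (x s)) - real (block_length a j) * (\<integral>t. f t \<partial>lam)\<bar>
     \<le> real (block_length a j) * e" if j: "j \<ge> max 2 j0" for j
  proof -
    have pos: "block_length a j > 0" using block_length_pos[OF assms(5)] j by simp
    have less: "a (j - 1) < a j" using assms(5) j by (auto simp: interval_data_def strict_mono_def)
    \<comment> \<open>\<open>well_distributed\<close> speaks of shifts \<open>k \<ge> 1\<close>. The
      first block has shift \<open>0\<close>, which is why \<open>j \<ge> 2\<close> is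
      demanded.\<close>
    have "j - 1 \<le> a (j - 1)" using assms(5) by (intro strict_mono_imp_increasing) (auto simp: interval_data_def)
    then have a1: "a (j - 1) \<ge> 1" using j by linarith
    have "(\<Sum>s\<in>block a j. f (x s)) = (\<Sum>i=1..block_length a j. f (x (i + a (j - 1))))"
      by (rule sum.reindex_bij_witness[of _ "\<lambda>i. i + a (j - 1)" "\<lambda>s. s - a (j - 1)"])
        (use less in \<open>auto simp: block_def block_length_def\<close>)
    then have "\<bar>(\<Sum>s\<in>block a j. f (x s)) / real (block_length a j) - (\<integral>t. f t \<partial>lam)\<bar> < e"
      using N0[OF j0 a1, of j] j by simp
    then have "real (block_length a j) * \<bar>(\<Sum>s\<in>block a j. f (x s)) / real (block_length a j) - (\<integral>t. f t \<partial>lam)\<bar>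
        \<le> real (block_length a j) * e"
      by (intro mult_left_mono) auto
    moreover have "(\<Sum>s\<in>block a j. f (x s)) - real (block_length a j) * (\<integral>t. f t \<partial>lam) =
        real (block_length a j) * ((\<Sum>s\<in>block a j. f (x s)) / real (block_length a j) - (\<integral>t. f t \<partial>lam))"
      using pos by (simp add: right_diff_distrib)
    ultimately show ?thesis by (simp add: abs_mult)
  qed
  then show ?thesis by (intro exI[of _ "max 2 j0"]) auto
qed

section \<open>Members of \<open>S0\<close> viewed as sets of positive integers\<close>

lemma S0_mono: "n \<in> S0 \<Longrightarrow> n i \<le> n j \<longleftrightarrow> i \<le> j"
  by (simp add: S0_def strict_mono_less_eq)

lemma S0_increasing: "n \<in> S0 \<Longrightarrow> i \<le> n i"
  unfolding S0_def by (auto intro: strict_mono_imp_increasing)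

lemma S0_inj: "n \<in> S0 \<Longrightarrow> inj_on n A"
  by (auto simp: S0_def intro: strict_mono_imp_inj_on inj_on_subset)

lemma S0_initial_segment:
  assumes n: "n \<in> S0"
  shows "n ` {1..card (n ` {1..} \<inter> {1..v})} = n ` {1..} \<inter> {1..v}"
proof -
  \<comment> \<open>The last index with value at most \<open>v\<close>. It exists because
    \<open>n 0 = 0\<close> puts \<open>0\<close> into the set and \<open>i \<le> n i\<close> bounds
    the set.\<close>
  define c where "c = Max {i. n i \<le> v}"
  have fin: "finite {i. n i \<le> v}"
    by (rule finite_subset[of _ "{..v}"]) (use S0_increasing[OF n] le_trans in blast)+
  have "n 0 = 0" using n by (simp add: S0_def)
  then have ne: "0 \<in> {i. n i \<le> v}" by simp
  have iff: "n i \<le> v \<longleftrightarrow> i \<le> c" for i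
  proof
    assume "n i \<le> v" then show "i \<le> c" unfolding c_def by (intro Max_ge fin) simp
  next
    assume "i \<le> c"
    then have "n i \<le> n c" using S0_mono[OF n] by simp
    moreover have "n c \<le> v" using Max_in[OF fin] ne unfolding c_def by blast
    ultimately show "n i \<le> v" by simp
  qed
  have eq: "n ` {1..} \<inter> {1..v} = n ` {1..c}"
  proof -
    have "1 \<le> n i" if "1 \<le> i" for i using that S0_increasing[OF n, of i] by simp
    then show ?thesis using iff by auto
  qed
  then have "card (n ` {1..} \<inter> {1..v}) = c"
    by (simp add: card_image[OF S0_inj[OF n]])
  then show ?thesis using eq by simp
qed

text \<open>Converts averages over indices, stopped at a block end, into sums over a set of
  positions; all estimates are made in the latter form.\<close>

lemma S_space_initial_segment:
  assumes "interval_data a m" "n \<in> S_space a m"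
  shows "n ` {1..cum m J} = n ` {1..} \<inter> {1..a J}"
  using S0_initial_segment[of n "a J"] card_blocks[OF assms(1), of J "n ` {1..}"] assms(2)
  by (auto simp: S_space_def)

lemma mono_cum: "i \<le> j \<Longrightarrow> cum m i \<le> cum m j"
  unfolding cum_def by (intro sum_mono2) auto

text \<open>A member is an infinite sequence, so its existence forces the prescribed counts to add
  up without bound. The index \<open>n N\<close> is a crude choice: \<open>n N \<le> a (n N)\<close>
  places the first \<open>N\<close> members within the first \<open>n N\<close> blocks.\<close>

lemma S_space_cum_unbounded:
  assumes "interval_data a m" "n \<in> S_space a m"
  shows "N \<le> cum m (n N)"
proof -
  have n: "n \<in> S0" using assms by (simp add: S_space_def)
  have "n N \<le> a (n N)"
    using assms(1) by (intro strict_mono_imp_increasing) (auto simp: interval_data_def)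
  have "1 \<le> n i \<and> n i \<le> a (n N)" if "i \<in> {1..N}" for i
    using that S0_mono[OF n, of i N] S0_increasing[OF n, of i] \<open>n N \<le> a (n N)\<close> by auto
  then have "n ` {1..N} \<subseteq> n ` {1..} \<inter> {1..a (n N)}"
    by auto
  then have "n ` {1..N} \<subseteq> n ` {1..cum m (n N)}"
    by (simp only: S_space_initial_segment[OF assms])
  then have "card (n ` {1..N}) \<le> card (n ` {1..cum m (n N)})" by (intro card_mono) auto
  then show ?thesis by (simp add: card_image[OF S0_inj[OF n]])
qed

section \<open>Limit measures are dominated\<close>

text \<open>The selected sum in a block is bounded both by the number \<open>m j\<close> of its
  terms and by the sum over the whole block; the smaller bound is \<open>m j\<close> times
  \<open>theta\<close>. Up to \<open>j1\<close> block sums are not controlled, and those blocks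
  contribute at most \<open>cum m j1\<close>.\<close>

lemma selection_sum_le:
  fixes f :: "'a \<Rightarrow> real"
  assumes "interval_data a m" "\<And>j. 1 \<le> j \<Longrightarrow> card (T \<inter> block a j) = m j"
    and f: "\<And>s. 1 \<le> s \<Longrightarrow> f (x s) \<in> {0..1}" and l: "0 < l"
    and bd: "\<And>j. j \<ge> j1 \<Longrightarrow> (\<Sum>s\<in>block a j. f (x s)) \<le> real (block_length a j) * l"
  shows "(\<Sum>s\<in>T \<inter> {1..a J}. f (x s)) \<le> (\<Sum>j=1..J. real (m j) * theta l (ratio a m j)) + cum m j1"
proof -
  have "(\<Sum>s\<in>T \<inter> {1..a J}. f (x s)) = (\<Sum>j=1..J. \<Sum>s\<in>T \<inter> block a j. f (x s))"
    by (rule sum_blocks[OF assms(1)])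
  also have "\<dots> \<le> (\<Sum>j=1..J. real (m j) * theta l (ratio a m j) + (if j \<le> j1 then real (m j) else 0))"
  proof (rule sum_mono)
    fix j assume "j \<in> {1..J}"
    then have j: "1 \<le> j" by simp
    have fin: "finite (block a j)" by (simp add: block_def)
    have f01: "f (x s) \<in> {0..1}" if "s \<in> block a j" for s using f block_pos that by blast
    have "(\<Sum>s\<in>T \<inter> block a j. f (x s)) \<le> (\<Sum>s\<in>T \<inter> block a j. 1)"
      using f01 by (intro sum_mono) auto
    then have 1: "(\<Sum>s\<in>T \<inter> block a j. f (x s)) \<le> real (m j)" using assms(2)[OF j] by simp
    have nn: "0 \<le> real (m j) * theta l (ratio a m j)" using l by (intro mult_nonneg_nonneg theta_nonneg) auto
    show "(\<Sum>s\<in>T \<inter> block a j. f (x s)) \<le> real (m j) * theta l (ratio a m j) + (if j \<le> j1 then real (m j) else 0)"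
    proof (cases "j \<le> j1")
      case True
      then show ?thesis using 1 nn by simp
    next
      case False
      have "(\<Sum>s\<in>T \<inter> block a j. f (x s)) \<le> (\<Sum>s\<in>block a j. f (x s))"
        using f01 fin by (intro sum_mono2) auto
      also have "\<dots> \<le> real (block_length a j) * l" using bd False by simp
      finally have 2: "(\<Sum>s\<in>T \<inter> block a j. f (x s)) \<le> real (block_length a j) * l" .
      show ?thesis
      proof (cases "ratio a m j \<le> l")
        case True
        then show ?thesis using 1 False by (simp add: theta_def)
      next
        case gt: False
        then have "m j > 0" using l by (auto simp: ratio_def intro: Nat.gr0I)
        then have "real (m j) * theta l (ratio a m j) = real (block_length a j) * l"
          using gt by (simp add: theta_def ratio_def)
        then show ?thesis using 2 False by simp
      qed
    qed
  qed
  also have "\<dots> = (\<Sum>j=1..J. real (m j) * theta l (ratio a m j)) + (\<Sum>j=1..J. if j \<le> j1 then real (m j) else 0)"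
    by (rule sum.distrib)
  also have "(\<Sum>j=1..J. if j \<le> j1 then real (m j) else 0) = (\<Sum>j\<in>{1..J} \<inter> {j. j \<le> j1}. real (m j))"
    by (simp add: sum.inter_restrict)
  also have "\<dots> \<le> (\<Sum>j=1..j1. real (m j))"
    by (intro sum_mono2) auto
  also have "\<dots> = cum m j1" by (simp add: cum_def)
  finally show ?thesis by simp
qed

text \<open>The indicator of \<open>B\<close> is approximated in the mean for \<open>\<mu>\<close>
  and \<open>lam\<close> together. The positive slack \<open>e\<close> in the hypothesis matches the
  right continuity of the integral of \<open>theta\<close>.\<close>

lemma le_F_of_continuous:
  fixes X :: "'a::metric_space set"
  assumes mu: "\<mu> \<in> borel_probs X" and la: "lam \<in> borel_probs X" and pi: "\<pi> \<in> borel_probs {0..1}"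
    and le: "\<And>f e. continuous_on X f \<Longrightarrow> (\<And>t. f t \<in> {0..1}) \<Longrightarrow> e > 0 \<Longrightarrow>
      (\<integral>t. f t \<partial>\<mu>) \<le> (\<integral>t. theta ((\<integral>t. f t \<partial>lam) + e) t \<partial>\<pi>)"
    and B: "B \<in> sets (restrict_space borel X)"
  shows "measure \<mu> B \<le> F \<pi> (measure lam B)"
proof -
  interpret mu: prob_space \<mu> by (rule prob_space_borel_probs[OF mu])
  interpret la: prob_space lam by (rule prob_space_borel_probs[OF la])
  obtain B' where B': "B' \<in> sets borel" "B = X \<inter> B'"
    using B by (auto simp: sets_restrict_space)
  have meas: "(indicator B' :: 'a \<Rightarrow> real) \<in> borel_measurable \<nu>" if "\<nu> \<in> borel_probs X" for \<nu>
    using B'(1) by (intro measurable_borel_probs[OF that] measurable_restrict_space1) simp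
  have int: "integrable \<nu> (indicator B' :: 'a \<Rightarrow> real)" if "\<nu> \<in> borel_probs X" for \<nu>
    by (rule integrable_bounded_borel_probs[OF that meas[OF that], of 1]) (auto simp: indicator_def)
  have eq: "(\<integral>t. indicator B' t \<partial>\<nu>) = measure \<nu> B" if "\<nu> \<in> borel_probs X" for \<nu>
    using B'(2) by (simp add: space_borel_probs[OF that] Int_commute)
  have "measure \<mu> B \<le> (\<integral>t. theta (measure lam B + 1 / Suc n) t \<partial>\<pi>) + 1 / Suc n" for n
  proof -
    \<comment> \<open>Half of \<open>1 / Suc n\<close>: one \<open>e\<close> pays for the
      approximation under \<open>lam\<close>, the other is the slack of the hypothesis.\<close>
    define e where "e = 1 / (2 * real (Suc n))"
    have e: "e > 0" "2 * e = 1 / Suc n" by (auto simp: e_def field_simps)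
    obtain f :: "'a \<Rightarrow> real" where f: "continuous_on UNIV f" "\<And>t. f t \<in> {0..1}"
      "(\<integral>t. \<bar>f t - indicator B' t\<bar> \<partial>\<mu>) < e" "(\<integral>t. \<bar>f t - indicator B' t\<bar> \<partial>lam) < e"
      using borel_indicator_approx[OF mu la B'(1) e(1)] by blast
    have fX: "continuous_on X f" using f(1) continuous_on_subset by blast
    have close: "\<bar>(\<integral>t. f t \<partial>\<nu>) - measure \<nu> B\<bar> \<le> (\<integral>t. \<bar>f t - indicator B' t\<bar> \<partial>\<nu>)"
      if nu: "\<nu> \<in> borel_probs X" for \<nu>
    proof -
      have if': "integrable \<nu> f"
        by (rule integrable_bounded_borel_probs[OF nu continuous_measurable_borel_probs[OF nu fX], of 1])
          (use f(2) in \<open>auto simp: abs_le_iff intro: order_trans[of _ 0]\<close>)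
      show ?thesis
        unfolding eq[OF nu, symmetric] Bochner_Integration.integral_diff[OF if' int[OF nu], symmetric]
        by (rule integral_abs_bound)
    qed
    have nn: "0 \<le> (\<integral>t. f t \<partial>lam)" using f(2) by (intro integral_nonneg_AE AE_I2) auto
    have "(\<integral>t. f t \<partial>lam) + e \<le> measure lam B + 1 / Suc n" using close[OF la] f(4) e by linarith
    then have "(\<integral>t. theta ((\<integral>t. f t \<partial>lam) + e) t \<partial>\<pi>) \<le> (\<integral>t. theta (measure lam B + 1 / Suc n) t \<partial>\<pi>)"
      using nn e(1) by (intro integral_mono integrable_theta[OF pi] theta_mono) auto
    then show ?thesis using le[OF fX f(2) e(1)] close[OF mu] f(3) e by linarith
  qed
  moreover have "(\<lambda>n. (\<integral>t. theta (measure lam B + 1 / Suc n) t \<partial>\<pi>) + 1 / Suc n) \<longlonglongrightarrow>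
      (\<integral>t. theta (measure lam B) t \<partial>\<pi>) + 0"
    using LIMSEQ_inverse_real_of_nat
    by (intro tendsto_add theta_integral_right_continuous[OF pi]) (simp_all add: inverse_eq_divide)
  ultimately have "measure \<mu> B \<le> (\<integral>t. theta (measure lam B) t \<partial>\<pi>) + 0"
    by (intro LIMSEQ_le_const) auto
  then show ?thesis
    by (simp add: F_eq_integral_theta[OF pi])
qed

text \<open>Taking the least such \<open>J\<close>, rounding the index \<open>N\<close> up to a
  block end adds at most \<open>m J\<close> terms. Admissibility makes this negligible relative to
  \<open>cum m J\<close>.\<close>

lemma ex_block_index:
  assumes "interval_data a m" "n \<in> S_space a m" and N: "N \<ge> 1"
  shows "\<exists>J. N \<le> cum m J \<and> cum m J \<le> N + m J"
proof -
  define J where "J = (LEAST J. N \<le> cum m J)"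
  have "N \<le> cum m J"
    unfolding J_def by (rule LeastI[of _ "n N"]) (rule S_space_cum_unbounded[OF assms(1,2)])
  moreover have "J \<noteq> 0"
    using calculation N by (intro notI) (simp add: cum_def)
  then obtain J' where J': "J = Suc J'" using not0_implies_Suc by blast
  then have "cum m J' < N"
    using not_less_Least[of J' "\<lambda>J. N \<le> cum m J"] by (simp add: J_def)
  moreover have "cum m J = cum m J' + m J" by (simp add: J' cum_def)
  ultimately show ?thesis by (intro exI[of _ J]) simp
qed

text \<open>The measure \<open>\<pi>\<close> is found from \<open>\<mu>\<close>: along the indices
  producing \<open>\<mu>\<close>, rounded up to block ends, a further subsequence of ratio
  distributions converges by compactness.\<close>

lemma limit_measures_subset_predicted_measures:
  fixes X :: "'a::metric_space set"
  assumes X: "compact X" and la: "lam \<in> borel_probs X" and x: "\<And>n. n \<ge> 1 \<Longrightarrow> x n \<in> X"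
    and wd: "well_distributed X x lam" and id: "interval_data a m" and ad: "admissible a m"
    and n: "n \<in> S_space a m"
  shows "limit_measures X (x \<circ> n) \<subseteq> predicted_measures X lam a m"
proof
  fix \<mu> assume "\<mu> \<in> limit_measures X (x \<circ> n)"
  then have acc: "\<mu> \<in> accumulation_points (weak_topology X) {1..} (empirical X (x \<circ> n))"
    by (simp add: limit_measures_def)
  have mu: "\<mu> \<in> borel_probs X"
    using acc closure_of_subset_topspace[of "weak_topology X"]
    by (force simp: accumulation_points_def topspace_weak_topology)
  have nS0: "n \<in> S0" using n by (simp add: S_space_def)
  have n1: "1 \<le> n i" if "1 \<le> i" for i using S0_increasing[OF nS0, of i] that by simp
  have xn: "(x \<circ> n) i \<in> X" if "1 \<le> i" for i using x[OF n1[OF that]] by simp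
  obtain f0 where f0: "dense_functions X f0" using ex_dense_functions[OF X] by metis
  obtain h0 where h0: "dense_functions {0..1::real} h0" using ex_dense_functions[OF compact_Icc] by metis
  obtain r where r: "\<And>i. r i \<in> {1::nat..}" "filterlim r at_top sequentially"
    "\<And>g::'a \<Rightarrow> real. continuous_on X g \<Longrightarrow> (\<lambda>i::nat. \<integral>t. g t \<partial>(empirical X (x \<circ> n) (r i))) \<longlonglongrightarrow> (\<integral>t. g t \<partial>\<mu>)"
    using accumulation_point_subsequence[OF X f0 _ acc] empirical_borel_probs[of "x \<circ> n", OF xn]
    by (metis atLeast_iff)
  have "\<forall>i. \<exists>J. r i \<le> cum m J \<and> cum m J \<le> r i + m J"
    using ex_block_index[OF id n] r(1) by auto
  then obtain J where J: "\<And>i. r i \<le> cum m (J i)" "\<And>i. cum m (J i) \<le> r i + m (J i)" by metis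
  have r1: "r i \<ge> 1" for i using r(1)[of i] by simp
  have cpos: "cum m (J i) > 0" for i using J(1)[of i] r1[of i] by linarith
  have Jinf: "filterlim J at_top sequentially"
    unfolding filterlim_at_top
  proof
    fix K
    have "\<forall>\<^sub>F i in sequentially. r i \<ge> Suc (cum m K)" using r(2) unfolding filterlim_at_top by blast
    then show "\<forall>\<^sub>F i in sequentially. K \<le> J i"
    proof eventually_elim
      case (elim i)
      then have "\<not> cum m (J i) \<le> cum m K" using J(1)[of i] by simp
      then show ?case using mono_cum[of "J i" K m] by linarith
    qed
  qed
  have mc: "(\<lambda>i. real (m (J i)) / real (cum m (J i))) \<longlonglongrightarrow> 0"
    using filterlim_compose[OF _ Jinf] ad unfolding admissible_def by blast
  have rc: "(\<lambda>i. real (r i) / real (cum m (J i))) \<longlonglongrightarrow> 1"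
  proof (rule tendsto_sandwich[OF always_eventually always_eventually])
    show "\<forall>i. 1 - real (m (J i)) / real (cum m (J i)) \<le> real (r i) / real (cum m (J i))"
    proof
      fix i
      have "real (cum m (J i)) \<le> real (r i) + real (m (J i))" using J(2)[of i] by linarith
      then have "real (cum m (J i)) / real (cum m (J i)) \<le> (real (r i) + real (m (J i))) / real (cum m (J i))"
        by (rule divide_right_mono) simp
      then show "1 - real (m (J i)) / real (cum m (J i)) \<le> real (r i) / real (cum m (J i))"
        using cpos[of i] by (simp add: add_divide_distrib)
    qed
    show "\<forall>i. real (r i) / real (cum m (J i)) \<le> 1" using J(1) cpos by (simp add: divide_le_eq_1)
    show "(\<lambda>i. 1 - real (m (J i)) / real (cum m (J i))) \<longlonglongrightarrow> 1"
      using tendsto_diff[OF tendsto_const[of 1] mc] by simp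
  qed simp
  have cinf: "filterlim (\<lambda>i. real (cum m (J i))) at_top sequentially"
    using filterlim_at_top_mono[OF r(2), of "\<lambda>i. cum m (J i)"] J(1)
    by (intro filterlim_compose[OF filterlim_real_sequentially]) auto
  have yb: "ratio_distribution a m (J i) \<in> borel_probs {0..1}" for i
    by (rule ratio_distribution_borel_probs[OF id cpos])
  obtain s \<pi> where s: "strict_mono (s::nat\<Rightarrow>nat)" and pi: "\<pi> \<in> borel_probs {0..1}"
    and lim: "\<And>g::real \<Rightarrow> real. continuous_on {0..1} g \<Longrightarrow>
      (\<lambda>i. \<integral>t. g t \<partial>(ratio_distribution a m (J (s i)))) \<longlonglongrightarrow> (\<integral>t. g t \<partial>\<pi>)"
    using ex_convergent_subsequence_unit_interval[of "\<lambda>i. ratio_distribution a m (J i)", OF yb] by metis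
  have sinf: "filterlim s at_top sequentially" by (rule filterlim_subseq[OF s])
  have "\<pi> \<in> limit_ratio_distributions a m"
    unfolding limit_ratio_distributions_def
  proof (rule limit_in_accumulation_points[OF compact_Icc h0 pi])
    show "ratio_distribution a m ((\<lambda>i. J (s i)) i) \<in> borel_probs {0..1}" for i by (rule yb)
    show "(\<lambda>i. J (s i)) i \<in> {N. cum m N > 0}" for i using cpos by simp
    show "filterlim (\<lambda>i. J (s i)) at_top sequentially" by (rule filterlim_compose[OF Jinf sinf])
  qed (rule lim)
  moreover have "measure \<mu> B \<le> F \<pi> (measure lam B)" if "B \<in> sets (restrict_space borel X)" for B
  proof (rule le_F_of_continuous[OF mu la pi _ that])
    fix f :: "'a \<Rightarrow> real" and e :: real
    assume f: "continuous_on X f" "\<And>t. f t \<in> {0..1}" and e: "e > 0"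
    define l where "l = (\<integral>t. f t \<partial>lam) + e"
    have "0 \<le> (\<integral>t. f t \<partial>lam)" using f(2) by (intro integral_nonneg_AE AE_I2) auto
    then have l: "l > 0" using e by (simp add: l_def)
    obtain j1 where j1: "\<And>j. j \<ge> j1 \<Longrightarrow>
        \<bar>(\<Sum>s\<in>block a j. f (x s)) - real (block_length a j) * (\<integral>t. f t \<partial>lam)\<bar> \<le> real (block_length a j) * e"
      using block_averages[OF X la x wd id _ f(1) e] ad unfolding admissible_def by blast
    have bd: "(\<Sum>s\<in>block a j. f (x s)) \<le> real (block_length a j) * l" if "j \<ge> j1" for j
      using j1[OF that] by (simp add: l_def distrib_left abs_le_iff)
    \<comment> \<open>Since \<open>f\<close> is nonnegative, the sum may be extended to the block
      end. The factor \<open>r i / cum m (J i)\<close> tends to \<open>1\<close>, and the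
      contribution of the early blocks tends to \<open>0\<close>.\<close>
    have key: "(\<integral>t. f t \<partial>(empirical X (x \<circ> n) (r i))) * (real (r i) / real (cum m (J i))) \<le>
       (\<integral>t. theta l t \<partial>(ratio_distribution a m (J i))) + real (cum m j1) / real (cum m (J i))" for i
    proof -
      have "(\<integral>t. f t \<partial>(empirical X (x \<circ> n) (r i))) * real (r i) = (\<Sum>k=1..r i. f ((x \<circ> n) k))"
        using r1[of i] by (subst integral_empirical[OF xn f(1)]) auto
      also have "\<dots> \<le> (\<Sum>k=1..cum m (J i). f ((x \<circ> n) k))"
        using f(2) J(1)[of i] by (intro sum_mono2) auto
      also have "\<dots> = (\<Sum>s\<in>n ` {1..cum m (J i)}. f (x s))"
        by (subst sum.reindex[OF S0_inj[OF nS0]]) simp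
      also have "\<dots> = (\<Sum>s\<in>n ` {1..} \<inter> {1..a (J i)}. f (x s))"
        by (simp only: S_space_initial_segment[OF id n])
      also have "\<dots> \<le> (\<Sum>j=1..J i. real (m j) * theta l (ratio a m j)) + cum m j1"
        by (rule selection_sum_le[where f=f and x=x and l=l, OF id _ _ l bd]) (use n f(2) in \<open>auto simp: S_space_def\<close>)
      also have "(\<Sum>j=1..J i. real (m j) * theta l (ratio a m j)) =
          (\<integral>t. theta l t \<partial>(ratio_distribution a m (J i))) * real (cum m (J i))"
        using cpos[of i] by (subst integral_ratio_distribution[OF id theta_measurable]) simp
      finally have "(\<integral>t. f t \<partial>(empirical X (x \<circ> n) (r i))) * real (r i) \<le>
         (\<integral>t. theta l t \<partial>(ratio_distribution a m (J i))) * real (cum m (J i)) + real (cum m j1)"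
        by (simp add: o_def)
      then have "((\<integral>t. f t \<partial>(empirical X (x \<circ> n) (r i))) * real (r i)) / real (cum m (J i)) \<le>
         ((\<integral>t. theta l t \<partial>(ratio_distribution a m (J i))) * real (cum m (J i)) + real (cum m j1)) / real (cum m (J i))"
        by (intro divide_right_mono) auto
      then show ?thesis using cpos[of i] by (simp add: add_divide_distrib o_def)
    qed
    have L: "(\<lambda>i. (\<integral>t. f t \<partial>(empirical X (x \<circ> n) (r (s i)))) * (real (r (s i)) / real (cum m (J (s i)))))
        \<longlonglongrightarrow> (\<integral>t. f t \<partial>\<mu>) * 1"
      by (intro tendsto_mult filterlim_compose[OF r(3)[OF f(1)] sinf] filterlim_compose[OF rc sinf])
    have R: "(\<lambda>i. (\<integral>t. theta l t \<partial>(ratio_distribution a m (J (s i)))) + real (cum m j1) / real (cum m (J (s i))))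
        \<longlonglongrightarrow> (\<integral>t. theta l t \<partial>\<pi>) + 0"
      by (intro tendsto_add lim continuous_on_theta[OF l] real_tendsto_divide_at_top[OF tendsto_const]
          filterlim_compose[OF cinf sinf])
    have "(\<integral>t. f t \<partial>\<mu>) * 1 \<le> (\<integral>t. theta l t \<partial>\<pi>) + 0"
      by (rule LIMSEQ_le[OF L R]) (use key in blast)
    then show "(\<integral>t. f t \<partial>\<mu>) \<le> (\<integral>t. theta ((\<integral>t. f t \<partial>lam) + e) t \<partial>\<pi>)"
      by (simp add: l_def)
  qed
  ultimately show "\<mu> \<in> predicted_measures X lam a m"
    using mu by (auto simp: predicted_measures_def dominated_measures_def)
qed

section \<open>Selections that are large on a given function\<close>

text \<open>If some selected point has height at most \<open>u\<close>, every unselected one has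
  height at most \<open>u + \<Delta>\<close>, so all higher points are selected. Otherwise all
  selected points lie above \<open>u\<close>.\<close>

lemma card_top_selection:
  fixes h :: "'i \<Rightarrow> real"
  assumes "finite I" "0 \<le> \<Delta>"
    and top: "\<And>s s'. s \<in> T \<inter> I \<Longrightarrow> s' \<in> I - T \<Longrightarrow> h s' \<le> h s + \<Delta>"
  shows "min (card (T \<inter> I)) (card {s \<in> I. h s > u + \<Delta>}) \<le> card ({s \<in> T. h s > u} \<inter> I)"
proof (cases "\<exists>s\<in>T \<inter> I. h s \<le> u")
  case True
  then obtain s where "s \<in> T \<inter> I" "h s \<le> u" by blast
  then have "h s' \<le> u + \<Delta>" if "s' \<in> I - T" for s' using top that by fastforce
  then have "{s \<in> I. h s > u + \<Delta>} \<subseteq> {s \<in> T. h s > u} \<inter> I"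
    using assms(2) by force
  then have "card {s \<in> I. h s > u + \<Delta>} \<le> card ({s \<in> T. h s > u} \<inter> I)"
    using assms(1) by (intro card_mono) auto
  then show ?thesis by simp
next
  case False
  then have "{s \<in> T. h s > u} \<inter> I = T \<inter> I" by force
  then show ?thesis by simp
qed

text \<open>The count is \<open>nat \<lceil>w\<rceil>\<close>. It recovers a real value, up to one
  unit, from the number of equally spaced levels below it.\<close>

lemma card_less_real_bounds:
  assumes "w \<le> real p"
  shows "w \<le> real (card {i. i < p \<and> real i < w})"
    and "0 \<le> w \<Longrightarrow> real (card {i. i < p \<and> real i < w}) \<le> w + 1"
proof -
  have "{i. i < p \<and> real i < w} = {..<nat \<lceil>w\<rceil>}"
    using assms by (auto simp: less_ceiling_iff zless_nat_eq_int_zless)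
  then have c: "card {i. i < p \<and> real i < w} = nat \<lceil>w\<rceil>" by simp
  show "w \<le> real (card {i. i < p \<and> real i < w})" unfolding c by linarith
  show "real (card {i. i < p \<and> real i < w}) \<le> w + 1" if "0 \<le> w" unfolding c using that by linarith
qed

text \<open>Each coordinate is rounded down to a multiple of \<open>h\<close>. Restricting to
  extensional functions on the first \<open>d\<close> indices makes the set of rounded vectors
  finite.\<close>

lemma finite_coefficient_net:
  fixes c h :: real
  assumes "h > 0"
  shows "\<exists>E. finite E \<and> (\<forall>g::nat \<Rightarrow> real. (\<forall>k<d. \<bar>g k\<bar> \<le> c) \<longrightarrow> (\<exists>e\<in>E. \<forall>k<d. \<bar>g k - e k\<bar> \<le> h))"
proof -
  define grid where "grid = (\<lambda>z. of_int z * h) ` {\<lfloor>- c / h\<rfloor>..\<lfloor>c / h\<rfloor>}"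
  have "\<exists>e\<in>PiE {..<d} (\<lambda>_. grid). \<forall>k<d. \<bar>g k - e k\<bar> \<le> h" if g: "\<forall>k<d. \<bar>g k\<bar> \<le> c" for g :: "nat \<Rightarrow> real"
  proof (rule bexI[of _ "restrict (\<lambda>k. of_int \<lfloor>g k / h\<rfloor> * h) {..<d}"])
    have "\<lfloor>g k / h\<rfloor> \<in> {\<lfloor>- c / h\<rfloor>..\<lfloor>c / h\<rfloor>}" if "k < d" for k
    proof -
      have "- c \<le> g k" "g k \<le> c" using g that by (auto simp: abs_le_iff)
      then show ?thesis
        unfolding atLeastAtMost_iff using assms by (intro conjI floor_mono divide_right_mono) simp_all
    qed
    then show "restrict (\<lambda>k. of_int \<lfloor>g k / h\<rfloor> * h) {..<d} \<in> PiE {..<d} (\<lambda>_. grid)"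
      by (auto simp: grid_def)
    have "\<bar>g k - of_int \<lfloor>g k / h\<rfloor> * h\<bar> \<le> h" for k
    proof -
      have "of_int \<lfloor>g k / h\<rfloor> * h \<le> g k"
        using of_int_floor_le[of "g k / h"] unfolding pos_le_divide_eq[OF assms] .
      moreover have "g k \<le> (of_int \<lfloor>g k / h\<rfloor> + 1) * h"
        using real_of_int_floor_add_one_ge[of "g k / h"] unfolding pos_divide_le_eq[OF assms] .
      ultimately show ?thesis by (simp add: algebra_simps abs_le_iff)
    qed
    then show "\<forall>k<d. \<bar>g k - restrict (\<lambda>k. of_int \<lfloor>g k / h\<rfloor> * h) {..<d} k\<bar> \<le> h" by simp
  qed
  moreover have "finite (PiE {..<d} (\<lambda>_. grid))"
    by (intro finite_PiE) (auto simp: grid_def)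
  ultimately show ?thesis by blast
qed

text \<open>Fixes one \<open>\<pi>\<close> through which \<open>\<mu>\<close> is dominated, with a
  sequence along which the ratio distributions converge to it. The numbers \<open>r i\<close> count
  blocks, so all averages are taken at block ends.\<close>

locale dominated_limit =
  fixes X :: "'a::metric_space set" and lam \<mu> :: "'a measure" and x :: "nat \<Rightarrow> 'a"
    and a m r :: "nat \<Rightarrow> nat" and \<pi> :: "real measure"
  assumes compact_X: "compact X" and lam: "lam \<in> borel_probs X" and supp_lam: "supp lam = X"
    and x_in_X: "\<And>n. n \<ge> 1 \<Longrightarrow> x n \<in> X" and wd: "well_distributed X x lam"
    and interval_data: "interval_data a m"
    and block_length_limit: "filterlim (block_length a) at_top sequentially"
    and r_limit: "filterlim r at_top sequentially"
    and cum_limit: "filterlim (\<lambda>i. real (cum m (r i))) at_top sequentially"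
    and pi: "\<pi> \<in> borel_probs {0..1}"
    and ratio_limit: "\<And>g :: real \<Rightarrow> real. continuous_on {0..1} g \<Longrightarrow>
      (\<lambda>i. \<integral>t. g t \<partial>(ratio_distribution a m (r i))) \<longlonglongrightarrow> (\<integral>t. g t \<partial>\<pi>)"
    and mu: "\<mu> \<in> dominated_measures X \<pi> lam"
begin

text \<open>Beginnings of members of \<open>S_space a m\<close>, cut at the end of block
  \<open>J\<close> and stored as sets. There are finitely many, so an energy minimiser
  exists.\<close>

definition selections :: "nat \<Rightarrow> nat set set" where
  "selections J = {T. T \<subseteq> {1..a J} \<and> (\<forall>j. 1 \<le> j \<longrightarrow> j \<le> J \<longrightarrow> card (T \<inter> block a j) = m j)}"

text \<open>Blocks up to \<open>J0\<close> are exempt because they carry a prescribed beginning. The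
  tolerance \<open>\<Delta>\<close> absorbs the error of the optimality condition and of the finite
  net.\<close>

definition top_selection :: "nat \<Rightarrow> nat \<Rightarrow> ('a \<Rightarrow> real) \<Rightarrow> real \<Rightarrow> nat set \<Rightarrow> bool" where
  "top_selection J0 J G \<Delta> T \<longleftrightarrow> (\<forall>j s s'. J0 < j \<longrightarrow> j \<le> J \<longrightarrow>
     s \<in> T \<inter> block a j \<longrightarrow> s' \<in> block a j - T \<longrightarrow> G (x s') \<le> G (x s) + \<Delta>)"

lemma mu_borel_probs: "\<mu> \<in> borel_probs X"
  using mu by (simp add: dominated_measures_def)

lemma finite_selection: "T \<in> selections J \<Longrightarrow> finite T"
  unfolding selections_def by (auto intro: finite_subset)

lemma card_selection: "T \<in> selections J \<Longrightarrow> card T = cum m J"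
  using card_blocks[OF interval_data, of J T] by (auto simp: selections_def Int_absorb2)

lemma cum_pos_eventually: "\<forall>\<^sub>F i in sequentially. cum m (r i) > 0"
  using cum_limit unfolding filterlim_at_top_dense by (auto dest!: spec[of _ 0])

lemma open_superlevel_measure:
  fixes G :: "'a \<Rightarrow> real"
  assumes "continuous_on X G" "t \<in> X" "G t > u"
  shows "{t \<in> X. G t > u} \<in> sets (restrict_space borel X)" "measure lam {t \<in> X. G t > u} > 0"
proof -
  interpret prob_space lam by (rule prob_space_borel_probs[OF lam])
  have sp: "space lam = X" by (rule space_borel_probs[OF lam])
  have "\<exists>U. open U \<and> U \<inter> X = G -` {u<..} \<inter> X"
    using assms(1) open_greaterThan[of u] unfolding continuous_on_open_invariant by blast
  then obtain U where U: "open U" "U \<inter> X = G -` {u<..} \<inter> X" by blast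
  have eq: "{t \<in> X. G t > u} = U \<inter> X" using U(2) by auto
  show "{t \<in> X. G t > u} \<in> sets (restrict_space borel X)"
    unfolding eq Int_commute[of U X] sets_restrict_space using U(1) by (intro imageI) simp
  have "t \<in> supp lam" using assms(2) supp_lam by simp
  moreover have "t \<in> U" using assms(2,3) U(2) by blast
  ultimately have "emeasure lam (U \<inter> X) > 0" using U(1) by (auto simp: supp_def sp)
  then show "measure lam {t \<in> X. G t > u} > 0"
    by (simp add: eq emeasure_eq_measure)
qed

text \<open>The function \<open>h\<close> is a continuous ramp between the indicators of the levels
  \<open>u + \<Delta>\<close> and \<open>u\<close>; block averages apply to it, although not to the
  indicators.\<close>

lemma superlevel_block_count:
  fixes G :: "'a \<Rightarrow> real"
  assumes G: "continuous_on X G" and \<Delta>: "\<Delta> > 0" and \<eta>: "\<eta> > 0"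
    and l: "l = measure lam {t \<in> X. G t > u + \<Delta>}" "l > 0"
  shows "\<exists>j1\<ge>1. \<forall>j\<ge>j1. real (block_length a j) * (l * (1 - \<eta>)) \<le> real (card {s \<in> block a j. G (x s) > u})"
proof -
  define h where "h t = max 0 (min 1 ((G t - u) / \<Delta>))" for t
  have hc: "continuous_on X h" unfolding h_def by (intro continuous_intros G) (use \<Delta> in simp)
  have h1: "h t = 1" if "G t > u + \<Delta>" for t using that \<Delta> by (auto simp: h_def field_simps)
  have h0: "h t = 0" if "\<not> G t > u" for t using that \<Delta> by (auto simp: h_def field_simps)
  have h01: "0 \<le> h t" "h t \<le> 1" for t by (auto simp: h_def)
  interpret prob_space lam by (rule prob_space_borel_probs[OF lam])
  have sp: "space lam = X" by (rule space_borel_probs[OF lam])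
  have "{t \<in> X. G t > u + \<Delta>} \<noteq> {}" using l by (metis measure_empty less_irrefl)
  then have W: "{t \<in> X. G t > u + \<Delta>} \<in> sets lam"
    using open_superlevel_measure(1)[OF G] sets_borel_probs[OF lam] by auto
  have "l = (\<integral>t. indicator {t \<in> X. G t > u + \<Delta>} t \<partial>lam)"
    using l(1) W by (simp add: sp Int_absorb2)
  also have "\<dots> \<le> (\<integral>t. h t \<partial>lam)"
  proof (intro integral_mono integrable_continuous_borel_probs[OF lam compact_X hc])
    show "integrable lam (indicat_real {t \<in> X. G t > u + \<Delta>})"
      using W by (simp add: integrable_indicator_iff emeasure_eq_measure)
    show "indicator {t \<in> X. G t > u + \<Delta>} t \<le> h t" for t
      using h1 h01 by (auto simp: indicator_def)
  qed
  finally have lh: "l \<le> (\<integral>t. h t \<partial>lam)" .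
  \<comment> \<open>Accuracy \<open>l * \<eta>\<close> makes the loss a factor
    \<open>1 - \<eta>\<close> instead of an additive error, which matters in blocks where
    \<open>m j\<close> is small compared with the block length.\<close>
  obtain j1 where j1: "j1 \<ge> 1" "\<And>j. j \<ge> j1 \<Longrightarrow>
    \<bar>(\<Sum>s\<in>block a j. h (x s)) - real (block_length a j) * (\<integral>t. h t \<partial>lam)\<bar> \<le> real (block_length a j) * (l * \<eta>)"
    using block_averages[OF compact_X lam x_in_X wd interval_data block_length_limit hc, of "l * \<eta>"] l(2) \<eta>
    by auto
  have "real (block_length a j) * (l * (1 - \<eta>)) \<le> real (card {s \<in> block a j. G (x s) > u})" if "j \<ge> j1" for j
  proof -
    have "real (block_length a j) * l \<le> real (block_length a j) * (\<integral>t. h t \<partial>lam)"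
      using lh by (intro mult_left_mono) auto
    then have "real (block_length a j) * (l * (1 - \<eta>)) \<le> (\<Sum>s\<in>block a j. h (x s))"
      using j1(2)[OF that] by (simp add: algebra_simps abs_le_iff)
    also have "\<dots> \<le> (\<Sum>s\<in>block a j. if G (x s) > u then 1 else 0)"
      using h0 h01 by (intro sum_mono) auto
    also have "\<dots> = real (card {s \<in> block a j. G (x s) > u})"
      by (simp add: block_def sum.If_cases Int_def)
    finally show ?thesis .
  qed
  then show ?thesis using j1(1) by blast
qed

text \<open>Full support enters here: a nonempty superlevel set has positive measure \<open>l\<close>, so \<open>theta l\<close> is
  continuous and the error in the block counts can be made small relative to \<open>l\<close>, uniformly over
  blocks with small \<open>ratio a m j\<close>.\<close>

lemma top_selection_superlevel:
  fixes G :: "'a \<Rightarrow> real"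
  assumes G: "continuous_on X G" and \<Delta>: "\<Delta> > 0" and \<eta>: "\<eta> > 0"
  shows "\<forall>\<^sub>F i in sequentially. \<forall>T\<in>selections (r i). top_selection J0 (r i) G \<Delta> T \<longrightarrow>
     measure \<mu> {t \<in> X. G t > u + 2 * \<Delta>} - \<eta> \<le> real (card {s \<in> T. G (x s) > u}) / real (cum m (r i))"
proof (cases "{t \<in> X. G t > u + 2 * \<Delta>} = {}")
  case True
  have "- \<eta> \<le> c / real N" if "0 \<le> c" for c N
    using \<eta> divide_nonneg_nonneg[OF that of_nat_0_le_iff[of N]] by linarith
  then show ?thesis unfolding True by (intro always_eventually) auto
next
  case False
  interpret la: prob_space lam by (rule prob_space_borel_probs[OF lam])
  let ?W = "{t \<in> X. G t > u + 2 * \<Delta>}"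
  define l where "l = measure lam ?W"
  have l: "l > 0" and W: "?W \<in> sets (restrict_space borel X)"
    using open_superlevel_measure[OF G] False by (auto simp: l_def)
  have l1: "l \<le> 1" by (simp add: l_def)
  \<comment> \<open>Strictly below \<open>\<eta>\<close>, so that the limit inequality is strict,
    and at most \<open>1\<close>, so that \<open>1 - \<eta>'\<close> is nonnegative.\<close>
  define \<eta>' where "\<eta>' = min (\<eta> / 2) 1"
  have \<eta>': "\<eta>' > 0" "\<eta>' \<le> 1" "\<eta>' < \<eta>" using \<eta> by (auto simp: \<eta>'_def)
  \<comment> \<open>One \<open>\<Delta>\<close> is spent here, from \<open>u + 2 * \<Delta>\<close>
    to \<open>u + \<Delta>\<close>; \<open>card_top_selection\<close> spends the other.\<close>
  obtain j1 where j1: "\<And>j. j \<ge> j1 \<Longrightarrow>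
     real (block_length a j) * (l * (1 - \<eta>')) \<le> real (card {s \<in> block a j. G (x s) > u + \<Delta>})"
    using superlevel_block_count[OF G \<Delta> \<eta>'(1), of l "u + \<Delta>"] l by (auto simp: l_def algebra_simps)
  \<comment> \<open>Blocks up to \<open>J1\<close> are prescribed or not yet equidistributed. They
    are given up at the cost of \<open>cum m J1 / cum m J\<close>, which vanishes in the
    limit.\<close>
  define J1 where "J1 = max J0 j1"
  have bound: "(1 - \<eta>') * (\<integral>t. theta l t \<partial>(ratio_distribution a m J)) - real (cum m J1) / real (cum m J)
      \<le> real (card {s \<in> T. G (x s) > u}) / real (cum m J)"
    if c: "cum m J > 0" and T: "T \<in> selections J" and top: "top_selection J0 J G \<Delta> T" for J T
  proof -
    have "(1 - \<eta>') * (\<Sum>j=1..J. real (m j) * theta l (ratio a m j)) - real (cum m J1) \<le>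
        (\<Sum>j=1..J. (1 - \<eta>') * (real (m j) * theta l (ratio a m j)) - (if j \<le> J1 then real (m j) else 0))"
    proof -
      have "(\<Sum>j=1..J. if j \<le> J1 then real (m j) else 0) = (\<Sum>j\<in>{1..J} \<inter> {j. j \<le> J1}. real (m j))"
        by (simp add: sum.inter_restrict)
      also have "\<dots> \<le> (\<Sum>j=1..J1. real (m j))" by (intro sum_mono2) auto
      also have "\<dots> = cum m J1" by (simp add: cum_def)
      finally show ?thesis by (simp add: sum_subtractf sum_distrib_left)
    qed
    also have "\<dots> \<le> (\<Sum>j=1..J. real (card ({s \<in> T. G (x s) > u} \<inter> block a j)))"
    proof (rule sum_mono)
      fix j assume j: "j \<in> {1..J}"
      have t01: "0 \<le> theta l (ratio a m j)" "theta l (ratio a m j) \<le> 1"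
        using l by (auto intro: theta_nonneg theta_le_1)
      have le_m: "(1 - \<eta>') * (real (m j) * theta l (ratio a m j)) \<le> real (m j)"
      proof -
        have "real (m j) * theta l (ratio a m j) \<le> real (m j) * 1" using t01 by (intro mult_left_mono) auto
        moreover have "(1 - \<eta>') * (real (m j) * theta l (ratio a m j)) \<le> 1 * (real (m j) * theta l (ratio a m j))"
          using \<eta>' t01 by (intro mult_right_mono) auto
        ultimately show ?thesis by simp
      qed
      show "(1 - \<eta>') * (real (m j) * theta l (ratio a m j)) - (if j \<le> J1 then real (m j) else 0)
         \<le> real (card ({s \<in> T. G (x s) > u} \<inter> block a j))"
      proof (cases "j \<le> J1")
        case True
        then show ?thesis using le_m by (simp add: order_trans[of _ 0])
      next
        case gt: False
        have "min (card (T \<inter> block a j)) (card {s \<in> block a j. G (x s) > u + \<Delta>})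
            \<le> card ({s \<in> T. G (x s) > u} \<inter> block a j)"
        proof (rule card_top_selection)
          have "J0 < j" "j \<le> J" using gt j by (simp_all add: J1_def)
          moreover fix s s' assume "s \<in> T \<inter> block a j" "s' \<in> block a j - T"
          ultimately show "G (x s') \<le> G (x s) + \<Delta>"
            using top unfolding top_selection_def by blast
        qed (use \<Delta> in \<open>auto simp: block_def\<close>)
        moreover have "card (T \<inter> block a j) = m j" using T j by (simp add: selections_def)
        ultimately have mn: "min (real (m j)) (real (card {s \<in> block a j. G (x s) > u + \<Delta>}))
            \<le> real (card ({s \<in> T. G (x s) > u} \<inter> block a j))"
          by linarith
        have bj: "real (block_length a j) > 0" using block_length_pos[OF interval_data] j by simp
        have "real (m j) * theta l (ratio a m j) \<le> real (block_length a j) * l"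
        proof (cases "ratio a m j \<le> l")
          case True
          then show ?thesis using bj by (simp add: theta_def ratio_def pos_divide_le_eq mult.commute)
        next
          case False
          then show ?thesis using l bj by (auto simp: theta_def ratio_def)
        qed
        then have "(1 - \<eta>') * (real (m j) * theta l (ratio a m j)) \<le> (1 - \<eta>') * (real (block_length a j) * l)"
          using \<eta>' by (intro mult_left_mono) auto
        also have "\<dots> = real (block_length a j) * (l * (1 - \<eta>'))" by simp
        also have "\<dots> \<le> real (card {s \<in> block a j. G (x s) > u + \<Delta>})"
          using gt by (intro j1) (simp add: J1_def)
        finally show ?thesis using le_m mn gt by simp
      qed
    qed
    also have "\<dots> = real (card {s \<in> T. G (x s) > u})"
    proof -
      have "{s \<in> T. G (x s) > u} \<inter> {1..a J} = {s \<in> T. G (x s) > u}" using T by (auto simp: selections_def)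
      then show ?thesis
        using sum_blocks[OF interval_data, of "\<lambda>_. 1::real" "{s \<in> T. G (x s) > u}" J] by simp
    qed
    finally have "((1 - \<eta>') * (\<Sum>j=1..J. real (m j) * theta l (ratio a m j)) - real (cum m J1)) / real (cum m J)
       \<le> real (card {s \<in> T. G (x s) > u}) / real (cum m J)"
      by (rule divide_right_mono) simp
    then show ?thesis
      by (simp add: integral_ratio_distribution[OF interval_data theta_measurable] diff_divide_distrib)
  qed
  have "(\<lambda>i. (1 - \<eta>') * (\<integral>t. theta l t \<partial>(ratio_distribution a m (r i))) - real (cum m J1) / real (cum m (r i)))
     \<longlonglongrightarrow> (1 - \<eta>') * (\<integral>t. theta l t \<partial>\<pi>) - 0"
    by (intro tendsto_intros ratio_limit continuous_on_theta[OF l] real_tendsto_divide_at_top[OF tendsto_const cum_limit])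
  moreover have "measure \<mu> ?W - \<eta> < (1 - \<eta>') * (\<integral>t. theta l t \<partial>\<pi>) - 0"
  proof -
    interpret pi: prob_space \<pi> by (rule prob_space_borel_probs[OF pi])
    have Fl: "F \<pi> l = (\<integral>t. theta l t \<partial>\<pi>)" using l l1 by (intro F_eq_integral_theta[OF pi]) auto
    have "(\<integral>t. theta l t \<partial>\<pi>) \<le> (\<integral>t. 1 \<partial>\<pi>)"
      using l by (intro integral_mono integrable_theta[OF pi] theta_le_1) auto
    then have "\<eta>' * (\<integral>t. theta l t \<partial>\<pi>) \<le> \<eta>'" using \<eta>' by (simp add: pi.prob_space mult_left_le)
    moreover have "measure \<mu> ?W \<le> F \<pi> l"
      using mu W by (simp add: dominated_measures_def l_def)
    moreover have "(1 - \<eta>') * (\<integral>t. theta l t \<partial>\<pi>) = (\<integral>t. theta l t \<partial>\<pi>) - \<eta>' * (\<integral>t. theta l t \<partial>\<pi>)"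
      by (simp add: left_diff_distrib)
    ultimately show ?thesis using \<eta>' Fl by linarith
  qed
  ultimately have "\<forall>\<^sub>F i in sequentially. measure \<mu> ?W - \<eta> <
     (1 - \<eta>') * (\<integral>t. theta l t \<partial>(ratio_distribution a m (r i))) - real (cum m J1) / real (cum m (r i))"
    by (rule order_tendstoD(1))
  then show ?thesis using cum_pos_eventually
  proof eventually_elim
    case (elim i)
    then show ?case using bound[of "r i"] by (meson less_imp_le order_trans)
  qed
qed

text \<open>A discrete layer cake: \<open>G\<close> is compared with \<open>\<Delta>\<close> times
  the number of levels below it, and each level is handled by the superlevel estimate. With
  \<open>e = 4 * \<Delta>\<close>, discretisation costs \<open>2 * \<Delta>\<close> in the integral
  and \<open>\<Delta>\<close> in the average, and the \<open>p\<close> errors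
  \<open>1 / (2 * real p)\<close> cost \<open>\<Delta> / 2\<close> together.\<close>

lemma top_selection_average:
  fixes G :: "'a \<Rightarrow> real"
  assumes G: "continuous_on X G" and e: "e > 0"
  shows "\<forall>\<^sub>F i in sequentially. \<forall>T\<in>selections (r i). top_selection J0 (r i) G (e / 4) T \<longrightarrow>
     (\<integral>t. G t \<partial>\<mu>) - e \<le> (\<Sum>s\<in>T. G (x s)) / real (cum m (r i))"
proof -
  interpret mu: prob_space \<mu> by (rule prob_space_borel_probs[OF mu_borel_probs])
  have sp: "space \<mu> = X" by (rule space_borel_probs[OF mu_borel_probs])
  obtain R where R: "R > 0" "\<And>t. t \<in> X \<Longrightarrow> \<bar>G t\<bar> \<le> R"
    using compact_continuous_bound[OF compact_X G] by metis
  define \<Delta> where "\<Delta> = e / 4"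
  have \<Delta>: "\<Delta> > 0" using e by (simp add: \<Delta>_def)
  \<comment> \<open>Enough levels of spacing \<open>\<Delta>\<close>, starting at \<open>-R\<close>,
    to exhaust the range of \<open>G\<close>.\<close>
  obtain p :: nat where p: "2 * R / \<Delta> \<le> real p" using real_arch_simple by blast
  have p0: "p > 0" using p R(1) \<Delta> by (intro Nat.gr0I) (auto simp: divide_le_0_iff)
  define u where "u i = real i * \<Delta> - R" for i :: nat
  \<comment> \<open>The upper bound counts levels raised by \<open>2 * \<Delta>\<close>, since the
    superlevel estimate compares exactly these with the unraised levels of the lower bound.\<close>
  have lo: "-R - \<Delta> + \<Delta> * (\<Sum>i<p. if v > u i then 1 else 0) \<le> v"
    and hi: "v \<le> -R + 2 * \<Delta> + \<Delta> * (\<Sum>i<p. if v > u i + 2 * \<Delta> then 1 else 0)"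
    if "\<bar>v\<bar> \<le> R" for v
  proof -
    have w: "(v + R) / \<Delta> \<le> real p" "0 \<le> (v + R) / \<Delta>"
      using that \<Delta> p by (auto simp: abs_le_iff divide_right_mono intro!: order_trans[OF divide_right_mono p])
    have \<Delta>w: "\<Delta> * ((v + R) / \<Delta>) = v + R" using \<Delta> by simp
    have iff: "v > u i \<longleftrightarrow> real i < (v + R) / \<Delta>" "v > u i + 2 * \<Delta> \<longleftrightarrow> real i < (v + R) / \<Delta> - 2" for i
      using \<Delta> by (auto simp: u_def field_simps)
    have "(\<Sum>i<p. if v > u i then 1 else 0) \<le> (v + R) / \<Delta> + 1"
      using card_less_real_bounds(2)[OF w] by (simp add: iff sum.If_cases Int_def lessThan_def)
    then have "\<Delta> * (\<Sum>i<p. if v > u i then 1 else 0) \<le> \<Delta> * ((v + R) / \<Delta> + 1)"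
      using \<Delta> by (intro mult_left_mono) auto
    then show "-R - \<Delta> + \<Delta> * (\<Sum>i<p. if v > u i then 1 else 0) \<le> v"
      unfolding distrib_left \<Delta>w by linarith
    have "(v + R) / \<Delta> - 2 \<le> (\<Sum>i<p. if v > u i + 2 * \<Delta> then 1 else 0)"
      using card_less_real_bounds(1)[of "(v + R) / \<Delta> - 2" p] w by (simp add: iff sum.If_cases Int_def lessThan_def)
    then have "\<Delta> * ((v + R) / \<Delta> - 2) \<le> \<Delta> * (\<Sum>i<p. if v > u i + 2 * \<Delta> then 1 else 0)"
      using \<Delta> by (intro mult_left_mono) auto
    then show "v \<le> -R + 2 * \<Delta> + \<Delta> * (\<Sum>i<p. if v > u i + 2 * \<Delta> then 1 else 0)"
      unfolding right_diff_distrib \<Delta>w by linarith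
  qed
  let ?W = "\<lambda>i. {t \<in> X. G t > u i + 2 * \<Delta>}"
  have Wm: "?W i \<in> sets \<mu>" for i
  proof (cases "?W i = {}")
    case True
    then show ?thesis by (metis sets.empty_sets)
  next
    case False
    then show ?thesis using open_superlevel_measure(1)[OF G] sets_borel_probs[OF mu_borel_probs] by auto
  qed
  have iW: "integrable \<mu> (indicat_real (?W i))" for i
    using Wm by (simp add: integrable_indicator_iff mu.emeasure_eq_measure)
  define K where "K = -R + 2 * \<Delta>"
  have muG: "(\<integral>t. G t \<partial>\<mu>) \<le> K + \<Delta> * (\<Sum>i<p. measure \<mu> (?W i))"
  proof -
    have "(\<integral>t. G t \<partial>\<mu>) \<le> (\<integral>t. K + \<Delta> * (\<Sum>i<p. indicator (?W i) t) \<partial>\<mu>)"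
    proof (intro integral_mono integrable_continuous_borel_probs[OF mu_borel_probs compact_X G]
        Bochner_Integration.integrable_add Bochner_Integration.integrable_mult_right
        Bochner_Integration.integrable_sum iW)
      show "integrable \<mu> (\<lambda>t. K)" by simp
      fix t assume "t \<in> space \<mu>"
      then have t: "t \<in> X" by (simp add: sp)
      have "indicat_real (?W i) t = (if G t > u i + 2 * \<Delta> then 1 else 0)" for i
        using t by (simp add: indicator_def)
      then show "G t \<le> K + \<Delta> * (\<Sum>i<p. indicator (?W i) t)"
        using hi[OF R(2)[OF t]] by (simp add: K_def)
    qed
    also have "\<dots> = K + \<Delta> * (\<Sum>i<p. \<integral>t. indicator (?W i) t \<partial>\<mu>)"
      using iW by (simp add: mu.prob_space)
    also have "\<dots> = K + \<Delta> * (\<Sum>i<p. measure \<mu> (?W i))"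
      using Wm by (simp add: sp Int_absorb2)
    finally show ?thesis .
  qed
  have "\<forall>\<^sub>F i in sequentially. \<forall>q\<in>{..<p}. \<forall>T\<in>selections (r i). top_selection J0 (r i) G \<Delta> T \<longrightarrow>
     measure \<mu> (?W q) - 1 / (2 * real p) \<le> real (card {s \<in> T. G (x s) > u q}) / real (cum m (r i))"
  proof (rule eventually_ball_finite)
    show "\<forall>q\<in>{..<p}. \<forall>\<^sub>F i in sequentially. \<forall>T\<in>selections (r i). top_selection J0 (r i) G \<Delta> T \<longrightarrow>
     measure \<mu> (?W q) - 1 / (2 * real p) \<le> real (card {s \<in> T. G (x s) > u q}) / real (cum m (r i))"
      using p0 by (intro ballI top_selection_superlevel G \<Delta>) simp
  qed simp
  then show ?thesis using cum_pos_eventually unfolding \<Delta>_def[symmetric]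
  proof eventually_elim
    case (elim i)
    show ?case
    proof (intro ballI impI)
      fix T assume T: "T \<in> selections (r i)" and top: "top_selection J0 (r i) G \<Delta> T"
      define M where "M = real (cum m (r i))"
      have M: "M > 0" using elim(2) by (simp add: M_def)
      have fin: "finite T" by (rule finite_selection[OF T])
      have cT: "real (card T) = M" using card_selection[OF T] by (simp add: M_def)
      have "(\<Sum>s\<in>T. -R - \<Delta> + \<Delta> * (\<Sum>q<p. if G (x s) > u q then 1 else 0)) \<le> (\<Sum>s\<in>T. G (x s))"
      proof (intro sum_mono lo R(2) x_in_X)
        fix s assume "s \<in> T" then show "1 \<le> s" using T by (auto simp: selections_def)
      qed
      also have "(\<Sum>s\<in>T. -R - \<Delta> + \<Delta> * (\<Sum>q<p. if G (x s) > u q then 1 else 0)) =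
          M * (-R - \<Delta>) + \<Delta> * (\<Sum>q<p. \<Sum>s\<in>T. if G (x s) > u q then 1 else 0)"
        by (subst sum.swap) (simp add: sum.distrib cT[symmetric] sum_distrib_left sum_subtractf)
      also have "(\<Sum>q<p. \<Sum>s\<in>T. if G (x s) > u q then 1 else 0) = (\<Sum>q<p. real (card {s \<in> T. G (x s) > u q}))"
        using fin by (simp add: sum.If_cases Int_def)
      finally have "(M * (-R - \<Delta>) + \<Delta> * (\<Sum>q<p. real (card {s \<in> T. G (x s) > u q}))) / M \<le> (\<Sum>s\<in>T. G (x s)) / M"
        using M by (intro divide_right_mono) auto
      then have 1: "-R - \<Delta> + \<Delta> * (\<Sum>q<p. real (card {s \<in> T. G (x s) > u q}) / M) \<le> (\<Sum>s\<in>T. G (x s)) / M"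
        using M by (simp add: add_divide_distrib sum_divide_distrib[symmetric])
      have "(\<Sum>q<p. measure \<mu> (?W q) - 1 / (2 * real p)) \<le> (\<Sum>q<p. real (card {s \<in> T. G (x s) > u q}) / M)"
        using elim(1) T top by (intro sum_mono) (auto simp: M_def)
      then have "(\<Sum>q<p. measure \<mu> (?W q)) - 1 / 2 \<le> (\<Sum>q<p. real (card {s \<in> T. G (x s) > u q}) / M)"
        using p0 by (simp add: sum_subtractf)
      then have "\<Delta> * ((\<Sum>q<p. measure \<mu> (?W q)) - 1 / 2) \<le> \<Delta> * (\<Sum>q<p. real (card {s \<in> T. G (x s) > u q}) / M)"
        using \<Delta> by (intro mult_left_mono) auto
      moreover have "e = 4 * \<Delta>" by (simp add: \<Delta>_def)
      ultimately show "(\<integral>t. G t \<partial>\<mu>) - e \<le> (\<Sum>s\<in>T. G (x s)) / real (cum m (r i))"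
        using muG 1 \<Delta> by (simp add: M_def K_def right_diff_distrib)
    qed
  qed
qed

end

section \<open>Exchanges within a block and minimisation of the energy\<close>

lemma block_unique:
  assumes "interval_data a m" "s \<in> block a j" "s \<in> block a j'"
  shows "j = j'"
proof -
  have mono: "i \<le> i' \<Longrightarrow> a i \<le> a i'" for i i'
    using assms(1) by (simp add: interval_data_def strict_mono_less_eq)
  have "\<not> i < i'" if "s \<in> block a i" "s \<in> block a i'" for i i'
  proof
    assume "i < i'"
    then have "a i \<le> a (i' - 1)" by (intro mono) simp
    then show False using that by (simp add: block_def)
  qed
  then show ?thesis using assms(2,3) by (meson linorder_neqE_nat)
qed

text \<open>The assumption says that exchanging one selected point for another does not decrease the energy
  \<open>\<Sum>k<d. (g k)\<^sup>2\<close> of the residuals \<open>g\<close>; the conclusion is the first-order optimality condition.\<close>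

lemma quadratic_exchange_bound:
  fixes g \<delta> :: "nat \<Rightarrow> real"
  assumes "M > 0" "\<And>k. k < d \<Longrightarrow> \<bar>\<delta> k\<bar> \<le> D"
    and le: "(\<Sum>k<d. (g k)\<^sup>2) \<le> (\<Sum>k<d. (g k - \<delta> k / M)\<^sup>2)"
  shows "(\<Sum>k<d. g k * \<delta> k) \<le> real d * D\<^sup>2 / (2 * M)"
proof -
  have "(\<Sum>k<d. (g k - \<delta> k / M)\<^sup>2) = (\<Sum>k<d. (g k)\<^sup>2 - 2 / M * (g k * \<delta> k) + (\<delta> k)\<^sup>2 / M\<^sup>2)"
    by (intro sum.cong) (auto simp: power2_diff power_divide)
  also have "\<dots> = (\<Sum>k<d. (g k)\<^sup>2) - 2 / M * (\<Sum>k<d. g k * \<delta> k) + (\<Sum>k<d. (\<delta> k)\<^sup>2) / M\<^sup>2"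
    by (simp add: sum.distrib sum_subtractf sum_distrib_left sum_divide_distrib)
  \<comment> \<open>An exchange changes the energy by a linear term of order \<open>1/M\<close> and
    a quadratic one of order \<open>1/M^2\<close>, so minimality bounds the linear coefficient by a
    quantity of order \<open>1/M\<close>.\<close>
  finally have "2 / M * (\<Sum>k<d. g k * \<delta> k) \<le> (\<Sum>k<d. (\<delta> k)\<^sup>2) / M\<^sup>2" using le by linarith
  also have "\<dots> \<le> (\<Sum>k<d. D\<^sup>2) / M\<^sup>2"
    using assms(2) by (intro divide_right_mono sum_mono abs_le_square_iff[THEN iffD1]) (auto intro: order_trans[OF _ abs_ge_self])
  finally have "2 / M * (\<Sum>k<d. g k * \<delta> k) \<le> real d * D\<^sup>2 / M\<^sup>2" by simp
  then have "M / 2 * (2 / M * (\<Sum>k<d. g k * \<delta> k)) \<le> M / 2 * (real d * D\<^sup>2 / M\<^sup>2)"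
    using assms(1) by (intro mult_left_mono) auto
  then show ?thesis using assms(1) by (simp add: power2_eq_square field_simps)
qed

context dominated_limit
begin

lemma selection_exchange:
  assumes T: "T \<in> selections J" and j: "1 \<le> j" "j \<le> J"
    and s: "s \<in> T \<inter> block a j" "s' \<in> block a j - T"
  shows "insert s' (T - {s}) \<in> selections J"
proof -
  have "a j \<le> a J" using interval_data j by (simp add: interval_data_def strict_mono_less_eq)
  then have "s' \<in> {1..a J}" using s(2) block_pos[of s' a j] by (auto simp: block_def)
  moreover have "card (insert s' (T - {s}) \<inter> block a i) = m i" if i: "1 \<le> i" "i \<le> J" for i
  proof (cases "i = j")
    case True
    have fin: "finite (T \<inter> block a j)" by (simp add: block_def)
    have "insert s' (T - {s}) \<inter> block a j = insert s' ((T \<inter> block a j) - {s})" using s by auto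
    then have "card (insert s' (T - {s}) \<inter> block a j) = Suc (card (T \<inter> block a j - {s}))"
      using fin s by simp
    also have "\<dots> = card (T \<inter> block a j)" by (rule card.remove[OF fin s(1), symmetric])
    finally show ?thesis using T i True by (simp add: selections_def)
  next
    case False
    then have "s \<notin> block a i" "s' \<notin> block a i" using s block_unique[OF interval_data] by blast+
    then have "insert s' (T - {s}) \<inter> block a i = T \<inter> block a i" by auto
    then show ?thesis using T i by (simp add: selections_def)
  qed
  ultimately show ?thesis using T by (auto simp: selections_def)
qed

text \<open>Among the finitely many selections that extend the prescribed beginning, take one minimising the
  squared distance of the averages of the \<open>f k\<close> to their \<open>\<mu>\<close>-integrals. It nearly selects the largest values
  of the residual combination \<open>G\<close> in each block, so its average of \<open>G\<close> nearly exceeds \<open>\<integral>G \<partial>\<mu>\<close>; but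
  the energy equals \<open>\<integral>G \<partial>\<mu>\<close> minus that average. As \<open>G\<close> depends on the selection, it is replaced by a
  member of a finite net.\<close>

lemma ex_selection_approx:
  fixes f :: "nat \<Rightarrow> 'a \<Rightarrow> real"
  assumes f: "\<And>k. k < d \<Longrightarrow> continuous_on X (f k)" and e: "e > 0"
    and T0: "\<And>J. T0 \<inter> {1..a J} \<in> selections J"
  shows "\<exists>i. J0 \<le> r i \<and> N0 \<le> cum m (r i) \<and> 0 < cum m (r i) \<and>
    (\<exists>T\<in>selections (r i). T \<inter> {1..a J0} = T0 \<inter> {1..a J0} \<and>
      (\<forall>k<d. \<bar>(\<Sum>s\<in>T. f k (x s)) / real (cum m (r i)) - (\<integral>t. f k t \<partial>\<mu>)\<bar> < e))"
proof -
  have "\<exists>B>0. \<forall>t\<in>X. \<bar>f k t\<bar> \<le> B" if "k < d" for k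
    using compact_continuous_bound[OF compact_X f[OF that]] by metis
  then obtain B where B: "\<And>k. k < d \<Longrightarrow> B k > 0" "\<And>k t. k < d \<Longrightarrow> t \<in> X \<Longrightarrow> \<bar>f k t\<bar> \<le> B k" by metis
  \<comment> \<open>A common bound for all test functions; the summand \<open>1\<close> keeps it
    positive when \<open>d = 0\<close>.\<close>
  define C where "C = 1 + (\<Sum>k<d. B k)"
  have "0 \<le> (\<Sum>k<d. B k)" using B(1) by (intro sum_nonneg less_imp_le) auto
  then have C0: "C > 0" by (simp add: C_def)
  have C: "\<bar>f k t\<bar> \<le> C" if "k < d" "t \<in> X" for k t
  proof -
    have "B k \<le> (\<Sum>k<d. B k)" using that B(1) by (intro member_le_sum) (auto intro: less_imp_le)
    then show ?thesis using B(2)[OF that] by (simp add: C_def)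
  qed
  \<comment> \<open>The average estimate is applied with error \<open>e\<^sup>2 / 2\<close>, and its
    tolerance is a quarter of that.\<close>
  define \<Delta> where "\<Delta> = e\<^sup>2 / 2 / 4"
  have \<Delta>: "\<Delta> > 0" "e\<^sup>2 = 8 * \<Delta>" using e by (auto simp: \<Delta>_def)
  \<comment> \<open>The mesh is chosen so that replacing residuals by net coefficients moves
    \<open>G\<close> by at most \<open>d * h * C\<close>, hence by at most
    \<open>\<Delta> / 4\<close>.\<close>
  define h where "h = \<Delta> / 4 / (real d * C + 1)"
  have dC: "real d * C + 1 > 0" using C0 by (intro add_nonneg_pos) auto
  have h: "h > 0" using \<Delta> dC by (simp add: h_def)
  have hd: "real d * (h * C) \<le> \<Delta> / 4"
  proof -
    have "real d * (h * C) \<le> h * (real d * C + 1)" using h by (simp add: algebra_simps)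
    also have "\<dots> = \<Delta> / 4" by (metis h_def nonzero_eq_divide_eq dC less_irrefl)
    finally show ?thesis .
  qed
  \<comment> \<open>Residuals are differences of two averages bounded by \<open>C\<close>, hence the
    range \<open>2 * C\<close>.\<close>
  obtain E :: "(nat \<Rightarrow> real) set" where E: "finite E"
    "\<And>g. \<forall>k<d. \<bar>g k\<bar> \<le> 2 * C \<Longrightarrow> \<exists>e\<in>E. \<forall>k<d. \<bar>g k - e k\<bar> \<le> h"
    using finite_coefficient_net[OF h, of d "2 * C"] by blast
  define G where "G g t = (\<Sum>k<d. g k * f k t)" for g t
  have Gc: "continuous_on X (G g)" for g
    unfolding G_def by (intro continuous_intros f) simp
  have "\<forall>\<^sub>F i in sequentially. \<forall>g\<in>E. \<forall>T\<in>selections (r i). top_selection J0 (r i) (G g) \<Delta> T \<longrightarrow>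
     (\<integral>t. G g t \<partial>\<mu>) - e\<^sup>2 / 2 \<le> (\<Sum>s\<in>T. G g (x s)) / real (cum m (r i))"
    unfolding \<Delta>_def using e
    by (intro eventually_ball_finite[OF E(1)] ballI top_selection_average Gc) simp
  moreover have "\<forall>\<^sub>F i in sequentially. J0 \<le> r i" using r_limit by (auto simp: filterlim_at_top)
  \<comment> \<open>The second bound brings the exchange error
    \<open>d * (2 * C)\<^sup>2 / (2 * M)\<close> down to \<open>\<Delta> / 2\<close>.\<close>
  moreover have "\<forall>\<^sub>F i in sequentially. max (real N0) (4 * (real d * C\<^sup>2) / \<Delta>) \<le> real (cum m (r i))"
    using cum_limit unfolding filterlim_at_top by blast
  ultimately have "\<forall>\<^sub>F i in sequentially. J0 \<le> r i \<and> 0 < cum m (r i) \<and>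
      max (real N0) (4 * (real d * C\<^sup>2) / \<Delta>) \<le> real (cum m (r i)) \<and>
      (\<forall>g\<in>E. \<forall>T\<in>selections (r i). top_selection J0 (r i) (G g) \<Delta> T \<longrightarrow>
     (\<integral>t. G g t \<partial>\<mu>) - e\<^sup>2 / 2 \<le> (\<Sum>s\<in>T. G g (x s)) / real (cum m (r i)))"
    using cum_pos_eventually by eventually_elim simp
  from eventually_happens'[OF sequentially_bot this]
  obtain i where i: "J0 \<le> r i" "0 < cum m (r i)"
      "max (real N0) (4 * (real d * C\<^sup>2) / \<Delta>) \<le> real (cum m (r i))"
      "\<forall>g\<in>E. \<forall>T\<in>selections (r i). top_selection J0 (r i) (G g) \<Delta> T \<longrightarrow>
     (\<integral>t. G g t \<partial>\<mu>) - e\<^sup>2 / 2 \<le> (\<Sum>s\<in>T. G g (x s)) / real (cum m (r i))"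
    by (elim exE conjE)
  define J where "J = r i"
  define M where "M = real (cum m J)"
  have M: "M > 0" using i(2) by (simp add: M_def J_def)
  have aJ: "a J0 \<le> a J" using i(1) interval_data by (simp add: J_def interval_data_def strict_mono_less_eq)
  define TT where "TT = {T \<in> selections J. T \<inter> {1..a J0} = T0 \<inter> {1..a J0}}"
  define g where "g T k = (\<integral>t. f k t \<partial>\<mu>) - (\<Sum>s\<in>T. f k (x s)) / M" for T k
  define En where "En T = (\<Sum>k<d. (g T k)\<^sup>2)" for T
  have "TT \<subseteq> Pow {1..a J}" by (auto simp: TT_def selections_def)
  then have "finite TT" by (rule finite_subset) simp
  \<comment> \<open>The given sequence itself supplies an admissible competitor, so the minimum is
    over a nonempty set.\<close>
  moreover have "T0 \<inter> {1..a J} \<in> TT" using T0[of J] aJ by (auto simp: TT_def)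
  ultimately have "Min (En ` TT) \<in> En ` TT" by (intro Min_in) auto
  then obtain T where T: "T \<in> TT" "En T = Min (En ` TT)" by (metis imageE)
  have min: "En T \<le> En T'" if "T' \<in> TT" for T'
    unfolding T(2) using \<open>finite TT\<close> that by (intro Min_le) auto
  have Ts: "T \<in> selections J" and TJ0: "T \<inter> {1..a J0} = T0 \<inter> {1..a J0}" using T(1) by (auto simp: TT_def)
  have fin: "finite T" by (rule finite_selection[OF Ts])
  have xX: "x s \<in> X" if "s \<in> T" for s using that Ts by (intro x_in_X) (auto simp: selections_def)
  have gb: "\<bar>g T k\<bar> \<le> 2 * C" if k: "k < d" for k
  proof -
    have "\<bar>(\<integral>t. f k t \<partial>\<mu>) - (\<integral>t. 0 \<partial>\<mu>)\<bar> \<le> C"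
      using C[OF k] by (intro integral_continuous_diff_le[OF compact_X f[OF k] _ mu_borel_probs]) auto
    moreover have "\<bar>(\<Sum>s\<in>T. f k (x s)) / M\<bar> \<le> C"
    proof -
      have "\<bar>\<Sum>s\<in>T. f k (x s)\<bar> \<le> (\<Sum>s\<in>T. \<bar>f k (x s)\<bar>)" by (rule sum_abs)
      also have "\<dots> \<le> (\<Sum>s\<in>T. C)" by (intro sum_mono C[OF k] xX)
      also have "\<dots> = C * M" using card_selection[OF Ts] by (simp add: M_def)
      finally show ?thesis using M by (simp add: abs_divide pos_divide_le_eq)
    qed
    ultimately show ?thesis unfolding g_def integral_zero by linarith
  qed
  obtain c where c: "c \<in> E" "\<And>k. k < d \<Longrightarrow> \<bar>g T k - c k\<bar> \<le> h" using E(2)[of "g T"] gb by blast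
  have Gclose: "\<bar>G (g T) t - G c t\<bar> \<le> \<Delta> / 4" if "t \<in> X" for t
  proof -
    have "\<bar>G (g T) t - G c t\<bar> = \<bar>\<Sum>k<d. (g T k - c k) * f k t\<bar>"
      by (simp add: G_def sum_subtractf left_diff_distrib)
    also have "\<dots> \<le> (\<Sum>k<d. \<bar>g T k - c k\<bar> * \<bar>f k t\<bar>)"
      by (rule order_trans[OF sum_abs]) (simp add: abs_mult)
    also have "\<dots> \<le> (\<Sum>k<d. h * C)" using c(2) C that by (intro sum_mono mult_mono) (auto simp: less_imp_le[OF h])
    finally show ?thesis using hd by simp
  qed
  \<comment> \<open>Exchanges beyond block \<open>J0\<close> keep the prescribed beginning and so
    stay among the competitors. The change of \<open>G\<close> is the linear coefficient of the
    change of energy.\<close>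
  have swap: "G (g T) (x s') - G (g T) (x s) \<le> \<Delta> / 2"
    if j: "J0 < j" "j \<le> J" and s: "s \<in> T \<inter> block a j" "s' \<in> block a j - T" for j s s'
  proof -
    let ?T' = "insert s' (T - {s})"
    define \<delta> where "\<delta> k = f k (x s') - f k (x s)" for k
    have ss: "s \<noteq> s'" using s by blast
    have x1: "x s \<in> X" "x s' \<in> X" using s by (auto intro: x_in_X block_pos)
    have "a J0 \<le> a (j - 1)" using j interval_data by (simp add: interval_data_def strict_mono_less_eq)
    then have "s \<notin> {1..a J0}" "s' \<notin> {1..a J0}" using s by (auto simp: block_def)
    then have "?T' \<inter> {1..a J0} = T \<inter> {1..a J0}" by auto
    then have "?T' \<in> TT" using selection_exchange[OF Ts _ j(2) s] j TJ0 by (simp add: TT_def)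
    then have "En T \<le> En ?T'" by (rule min)
    moreover have "g ?T' k = g T k - \<delta> k / M" for k
    proof -
      have "(\<Sum>s\<in>?T'. f k (x s)) = f k (x s') + (\<Sum>s\<in>T - {s}. f k (x s))"
        using fin s by simp
      also have "(\<Sum>s\<in>T - {s}. f k (x s)) = (\<Sum>s\<in>T. f k (x s)) - f k (x s)"
        using fin s by (simp add: sum_diff1)
      finally show ?thesis by (simp add: g_def \<delta>_def add_divide_distrib diff_divide_distrib)
    qed
    ultimately have "(\<Sum>k<d. (g T k)\<^sup>2) \<le> (\<Sum>k<d. (g T k - \<delta> k / M)\<^sup>2)" by (simp add: En_def)
    moreover have "\<bar>\<delta> k\<bar> \<le> 2 * C" if "k < d" for k
      using C[OF that x1(1)] C[OF that x1(2)] unfolding \<delta>_def by linarith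
    ultimately have "(\<Sum>k<d. g T k * \<delta> k) \<le> real d * (2 * C)\<^sup>2 / (2 * M)"
      by (intro quadratic_exchange_bound[OF M]) auto
    also have "\<dots> \<le> \<Delta> / 2"
    proof -
      have "4 * (real d * C\<^sup>2) / \<Delta> \<le> M" using i(3) by (simp add: M_def J_def)
      then have "4 * (real d * C\<^sup>2) \<le> M * \<Delta>" using \<Delta>(1) by (simp add: pos_divide_le_eq)
      then show ?thesis using M by (simp add: pos_divide_le_eq power_mult_distrib mult.commute)
    qed
    finally show ?thesis by (simp add: G_def \<delta>_def sum_subtractf right_diff_distrib)
  qed
  have "top_selection J0 J (G c) \<Delta> T"
    unfolding top_selection_def
  proof (intro allI impI)
    fix j s s' assume j: "J0 < j" "j \<le> J" and s: "s \<in> T \<inter> block a j" "s' \<in> block a j - T"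
    have x1: "x s \<in> X" "x s' \<in> X" using s by (auto intro: x_in_X block_pos)
    \<comment> \<open>The exchange error \<open>\<Delta> / 2\<close> and two net errors
      \<open>\<Delta> / 4\<close> exhaust the tolerance \<open>\<Delta>\<close>.\<close>
    show "G c (x s') \<le> G c (x s) + \<Delta>"
      using swap[OF j s] Gclose[OF x1(1)] Gclose[OF x1(2)] by linarith
  qed
  then have avg: "(\<integral>t. G c t \<partial>\<mu>) - e\<^sup>2 / 2 \<le> (\<Sum>s\<in>T. G c (x s)) / M"
    using i(4)[rule_format, OF c(1), of T] Ts by (simp add: J_def M_def)
  have "En T = (\<integral>t. G (g T) t \<partial>\<mu>) - (\<Sum>s\<in>T. G (g T) (x s)) / M"
  proof -
    have "(\<integral>t. G (g T) t \<partial>\<mu>) = (\<Sum>k<d. g T k * (\<integral>t. f k t \<partial>\<mu>))"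
      unfolding G_def
      by (subst Bochner_Integration.integral_sum)
        (auto intro!: integrable_mult_right integrable_continuous_borel_probs[OF mu_borel_probs compact_X f])
    moreover have "(\<Sum>s\<in>T. G (g T) (x s)) / M = (\<Sum>k<d. g T k * ((\<Sum>s\<in>T. f k (x s)) / M))"
      unfolding G_def by (subst sum.swap) (simp add: sum_distrib_left sum_divide_distrib)
    moreover have "(g T k)\<^sup>2 = g T k * (\<integral>t. f k t \<partial>\<mu>) - g T k * ((\<Sum>s\<in>T. f k (x s)) / M)" for k
      unfolding power2_eq_square right_diff_distrib[symmetric] by (simp only: g_def)
    ultimately show ?thesis by (simp only: En_def sum_subtractf)
  qed
  \<comment> \<open>The average estimate holds for the net function \<open>G c\<close>; passing back
    to \<open>G (g T)\<close> costs \<open>\<Delta> / 4\<close> in the integral and again in the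
    average.\<close>
  also have "\<dots> \<le> e\<^sup>2 / 2 + \<Delta> / 2"
  proof -
    have "\<bar>(\<integral>t. G (g T) t \<partial>\<mu>) - (\<integral>t. G c t \<partial>\<mu>)\<bar> \<le> \<Delta> / 4"
      by (rule integral_continuous_diff_le[OF compact_X Gc Gc mu_borel_probs Gclose])
    moreover have "(\<Sum>s\<in>T. G c (x s)) / M \<le> (\<Sum>s\<in>T. G (g T) (x s)) / M + \<Delta> / 4"
    proof -
      have "(\<Sum>s\<in>T. G c (x s)) \<le> (\<Sum>s\<in>T. G (g T) (x s) + \<Delta> / 4)"
      proof (rule sum_mono)
        fix s assume "s \<in> T"
        from Gclose[OF xX[OF this]] show "G c (x s) \<le> G (g T) (x s) + \<Delta> / 4" by linarith
      qed
      also have "\<dots> = (\<Sum>s\<in>T. G (g T) (x s)) + M * (\<Delta> / 4)"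
        using card_selection[OF Ts] by (simp add: sum.distrib M_def)
      finally have "(\<Sum>s\<in>T. G c (x s)) / M \<le> ((\<Sum>s\<in>T. G (g T) (x s)) + M * (\<Delta> / 4)) / M"
        using M by (intro divide_right_mono) auto
      then show ?thesis using M by (simp add: add_divide_distrib)
    qed
    ultimately show ?thesis using avg by linarith
  qed
  also have "\<dots> < e\<^sup>2" using \<Delta> by simp
  finally have En: "En T < e\<^sup>2" .
  have "\<bar>(\<Sum>s\<in>T. f k (x s)) / real (cum m (r i)) - (\<integral>t. f k t \<partial>\<mu>)\<bar> < e" if k: "k < d" for k
  proof -
    have "(g T k)\<^sup>2 \<le> En T" unfolding En_def using k by (intro member_le_sum) auto
    then have "\<bar>g T k\<bar>\<^sup>2 < e\<^sup>2" using En by simp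
    then have "\<bar>g T k\<bar> < e" by (rule power2_less_imp_less) (rule less_imp_le[OF e])
    then show ?thesis by (simp add: g_def M_def J_def abs_minus_commute)
  qed
  moreover have "N0 \<le> cum m (r i)" using i(3) by simp
  ultimately show ?thesis
    using i(1,2) Ts TJ0 unfolding J_def by (intro exI[of _ i] conjI bexI[of _ T] allI impI)
qed

end

section \<open>Category argument\<close>

lemma cylinder_self: "n \<in> S0 \<Longrightarrow> n \<in> cylinder k n"
  by (simp add: cylinder_def)

lemma cylinder_antimono: "k \<le> l \<Longrightarrow> cylinder l n \<subseteq> cylinder k n"
  by (auto simp: cylinder_def)

lemma openin_cylinder: "n \<in> S0 \<Longrightarrow> 1 \<le> k \<Longrightarrow> openin S0_topology (cylinder k n)"
  unfolding S0_topology_def by (intro topology_generated_by_Basis) blast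

lemma topspace_S0_topology: "topspace S0_topology = S0"
proof -
  have "\<Union> {cylinder k n' | k n'. k \<ge> 1 \<and> n' \<in> S0} = S0"
  proof
    show "\<Union> {cylinder k n' | k n'. k \<ge> 1 \<and> n' \<in> S0} \<subseteq> S0" by (auto simp: cylinder_def)
    show "S0 \<subseteq> \<Union> {cylinder k n' | k n'. k \<ge> 1 \<and> n' \<in> S0}"
      using cylinder_self[of _ 1] by blast
  qed
  then show ?thesis by (simp add: S0_topology_def)
qed

lemma openin_S0_topology_imp_cylinder:
  assumes "openin S0_topology U" "n \<in> U"
  shows "\<exists>k\<ge>1. cylinder k n \<subseteq> U"
proof -
  have "generate_topology_on {cylinder k n' | k n'. k \<ge> 1 \<and> n' \<in> S0} U"
    using assms(1) unfolding S0_topology_def openin_topology_generated_by_iff .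
  then show ?thesis using assms(2)
  proof induction
    case Empty
    then show ?case by simp
  next
    case (Int A B)
    then obtain k l where "k \<ge> 1" "cylinder k n \<subseteq> A" "l \<ge> 1" "cylinder l n \<subseteq> B" by blast
    then show ?case
      using cylinder_antimono[of k "max k l" n] cylinder_antimono[of l "max k l" n]
      by (intro exI[of _ "max k l"]) auto
  next
    case (UN K)
    then show ?case by blast
  next
    case (Basis s)
    then obtain k n' where "s = cylinder k n'" "k \<ge> 1" by blast
    then show ?case using Basis by (intro exI[of _ k]) (auto simp: cylinder_def)
  qed
qed

text \<open>An interior point of the closure would bring a whole relative cylinder into the closure,
  including the point \<open>n'\<close>, although a cylinder around \<open>n'\<close> misses
  \<open>Z\<close>.\<close>

lemma nowhere_dense_in_S_topology:
  assumes Z: "Z \<subseteq> S_space a m"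
    and avoid: "\<And>n k. n \<in> S_space a m \<Longrightarrow>
      \<exists>n'\<in>S_space a m \<inter> cylinder k n. \<exists>l\<ge>1. S_space a m \<inter> cylinder l n' \<inter> Z = {}"
  shows "nowhere_dense_in (S_topology a m) Z"
proof -
  have S0: "S_space a m \<subseteq> S0" by (auto simp: S_space_def)
  have top: "topspace (S_topology a m) = S_space a m"
    using S0 by (auto simp: S_topology_def topspace_S0_topology)
  have "S_topology a m interior_of (S_topology a m closure_of Z) = {}"
  proof (rule ccontr)
    define U where "U = S_topology a m interior_of (S_topology a m closure_of Z)"
    assume "S_topology a m interior_of (S_topology a m closure_of Z) \<noteq> {}"
    then obtain n where n: "n \<in> U" by (auto simp: U_def)
    have U: "U \<subseteq> S_topology a m closure_of Z" unfolding U_def by (rule interior_of_subset)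
    have "openin (S_topology a m) U" by (simp add: U_def)
    then obtain V where V: "openin S0_topology V" "U = V \<inter> S_space a m"
      unfolding S_topology_def openin_subtopology by blast
    then have nS: "n \<in> S_space a m" "n \<in> V" using n by auto
    then obtain k where k: "cylinder k n \<subseteq> V" using openin_S0_topology_imp_cylinder[OF V(1)] by blast
    obtain n' l where n': "n' \<in> S_space a m \<inter> cylinder k n" "l \<ge> 1" "S_space a m \<inter> cylinder l n' \<inter> Z = {}"
      using avoid[OF nS(1)] by blast
    have "n' \<in> S_topology a m closure_of Z"
      using n'(1) k V(2) U by blast
    moreover have "openin (S_topology a m) (cylinder l n' \<inter> S_space a m)"
      unfolding S_topology_def using S0 n' by (intro openin_subtopology_Int openin_cylinder) auto
    moreover have "n' \<in> cylinder l n' \<inter> S_space a m" using n'(1) S0 cylinder_self by blast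
    ultimately have "\<exists>y. y \<in> Z \<and> y \<in> cylinder l n' \<inter> S_space a m"
      unfolding in_closure_of by blast
    then show False using n'(3) by blast
  qed
  then show ?thesis using Z by (simp add: nowhere_dense_in_def top)
qed

text \<open>The terms are the elements of the value set in increasing order. Inductively, each next
  term is a value of the other sequence beyond the common previous term, so neither next term can
  exceed the other.\<close>

lemma S0_agree:
  assumes n: "n \<in> S0" and n': "n' \<in> S0" and eq: "n ` {1..} \<inter> {1..v} = n' ` {1..} \<inter> {1..v}"
    and k: "n k \<le> v"
  shows "i \<le> k \<Longrightarrow> n' i = n i"
proof (induction i)
  case 0
  then show ?case using n n' by (simp add: S0_def)
next
  case (Suc i)
  have less: "p i < p j \<longleftrightarrow> i < j" if "p \<in> S0" for p i j
    using that by (simp add: S0_def strict_mono_less)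
  have IH: "n' i = n i" using Suc by simp
  have "n (Suc i) \<le> n k" using Suc(2) S0_mono[OF n] by simp
  then have v: "n (Suc i) \<le> v" using k by simp
  have "Suc i \<le> n (Suc i)" by (rule S0_increasing[OF n])
  then have "n (Suc i) \<in> n ` {1..} \<inter> {1..v}" using v by auto
  then obtain p where p: "n (Suc i) = n' p" using eq by blast
  have "n' i < n' p" using IH p less[OF n, of i "Suc i"] by simp
  then have "i < p" using less[OF n'] by simp
  then have le: "n' (Suc i) \<le> n (Suc i)" using p S0_mono[OF n', of "Suc i" p] by simp
  have "Suc i \<le> n' (Suc i)" by (rule S0_increasing[OF n'])
  then have "n' (Suc i) \<in> n' ` {1..} \<inter> {1..v}" using le v by auto
  then obtain q where q: "n' (Suc i) = n q" using eq by blast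
  have "n i < n q" using IH q less[OF n', of i "Suc i"] by simp
  then have "i < q" using less[OF n] by simp
  then have "n (Suc i) \<le> n' (Suc i)" using q S0_mono[OF n, of "Suc i" q] by simp
  then show ?case using le by simp
qed

text \<open>The selection \<open>T\<close> is spliced with the members of \<open>n\<close> beyond
  \<open>a J\<close>, so the counts stay correct in every block; increasing enumeration gives the
  new sequence.\<close>

lemma ex_extension:
  assumes id: "interval_data a m" and n: "n \<in> S_space a m" and J0: "J0 \<le> J" and k: "n k \<le> a J0"
    and T: "T \<subseteq> {1..a J}" "\<And>j. 1 \<le> j \<Longrightarrow> j \<le> J \<Longrightarrow> card (T \<inter> block a j) = m j"
    and TJ0: "T \<inter> {1..a J0} = n ` {1..} \<inter> {1..a J0}"
  shows "\<exists>n'\<in>S_space a m \<inter> cylinder k n. n' ` {1..cum m J} = T"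
proof -
  have nS0: "n \<in> S0" using n by (simp add: S_space_def)
  have mono: "i \<le> i' \<Longrightarrow> a i \<le> a i'" for i i'
    using id by (simp add: interval_data_def strict_mono_less_eq)
  define W where "W = T \<union> (n ` {1..} \<inter> {a J<..})"
  \<comment> \<open>Enumeration starts at index \<open>0\<close>. Inserting \<open>0\<close>
    produces the pinned value \<open>n' 0 = 0\<close> and shifts the members of \<open>W\<close> to
    the positive indices.\<close>
  define n' where "n' = enumerate (insert 0 W)"
  have "infinite (n ` {1..})"
    using finite_imageD[OF _ S0_inj[OF nS0]] infinite_Ici[of 1] by blast
  moreover have "n ` {1..} \<subseteq> W \<union> {..a J}" by (auto simp: W_def)
  ultimately have inf: "infinite (insert 0 W)" using finite_subset by (metis finite_UnI finite_atMost finite_insert)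
  have W1: "1 \<le> w" if "w \<in> W" for w
    using that T(1) by (auto simp: W_def)
  have n'0: "n' 0 = 0"
    unfolding n'_def enumerate_0 by (rule Least_equality) auto
  have sm: "strict_mono n'" unfolding n'_def by (rule strict_mono_enumerate[OF inf])
  then have n'S0: "n' \<in> S0" using n'0 by (simp add: S0_def)
  have rng: "range n' = insert 0 W" unfolding n'_def by (rule range_enumerate[OF inf])
  have img: "n' ` {1..} = W"
  proof
    show "n' ` {1..} \<subseteq> W"
    proof
      fix w assume "w \<in> n' ` {1..}"
      then obtain i where i: "1 \<le> i" "w = n' i" by auto
      then have "0 < w" using S0_increasing[OF n'S0, of i] by simp
      then show "w \<in> W" using rng i by (metis insertE less_irrefl rangeI)
    qed
    show "W \<subseteq> n' ` {1..}"
    proof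
      fix w assume w: "w \<in> W"
      then obtain i where i: "w = n' i" using rng by (metis imageE insertI2)
      then have "i \<noteq> 0" using W1[OF w] n'0 by (metis not_one_le_zero)
      then show "w \<in> n' ` {1..}" using i by auto
    qed
  qed
  have WJ: "W \<inter> {1..a J} = T" using T(1) by (auto simp: W_def)
  have "card (W \<inter> block a j) = m j" if j: "1 \<le> j" for j
  proof (cases "j \<le> J")
    case True
    then have "W \<inter> block a j = T \<inter> block a j" using mono[of j J] by (auto simp: W_def block_def)
    then show ?thesis using T(2)[OF j True] by simp
  next
    case False
    then have "a J \<le> a (j - 1)" by (intro mono) simp
    then have "W \<inter> block a j = n ` {1..} \<inter> block a j" using T(1) by (auto simp: W_def block_def)
    then show ?thesis using n j by (simp add: S_space_def)
  qed
  then have n'S: "n' \<in> S_space a m" using n'S0 unfolding S_space_def mem_Collect_eq img by blast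
  have "n' ` {1..} \<inter> {1..a J0} = T \<inter> {1..a J0}"
    unfolding img WJ[symmetric] using mono[OF J0] by auto
  then have "\<forall>i\<in>{1..k}. n' i = n i"
    using S0_agree[OF nS0 n'S0 _ k] TJ0 by simp
  then have "n' \<in> cylinder k n" using n'S0 by (simp add: cylinder_def)
  moreover have "n' ` {1..cum m J} = T"
    by (simp only: S_space_initial_segment[OF id n'S] img WJ)
  ultimately show ?thesis using n'S by blast
qed

lemma finite_positive_slack:
  fixes y b :: "nat \<Rightarrow> real"
  assumes "\<And>k. k < d \<Longrightarrow> y k < b k"
  shows "\<exists>e>0. \<forall>k<d. y k + e \<le> b k"
proof (intro exI conjI allI impI)
  \<comment> \<open>The element \<open>1\<close> keeps the set nonempty when
    \<open>d = 0\<close>.\<close>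
  let ?A = "insert 1 ((\<lambda>k. b k - y k) ` {..<d})"
  show "Min ?A > 0" using assms by auto
  fix k assume "k < d"
  then have "Min ?A \<le> b k - y k" by (intro Min_le) auto
  then show "y k + Min ?A \<le> b k" by simp
qed

text \<open>An accumulation point \<open>\<pi>\<close> yields the sequence \<open>r\<close>; the
  member \<open>n\<close> supplies the divergence of \<open>cum m\<close>.\<close>

lemma predicted_measures_dominated_limit:
  fixes X :: "'a::metric_space set"
  assumes "compact X" "lam \<in> borel_probs X" "supp lam = X" "\<And>n. n \<ge> 1 \<Longrightarrow> x n \<in> X"
    "well_distributed X x lam" and id: "interval_data a m" and ad: "admissible a m"
    and n: "n \<in> S_space a m" and mu: "\<mu> \<in> predicted_measures X lam a m"
  obtains r \<pi> where "dominated_limit X lam \<mu> x a m r \<pi>"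
proof -
  obtain \<pi> where pi: "\<pi> \<in> limit_ratio_distributions a m" and dom: "\<mu> \<in> dominated_measures X \<pi> lam"
    using mu by (auto simp: predicted_measures_def)
  have acc: "\<pi> \<in> accumulation_points (weak_topology {0..1}) {N. cum m N > 0} (ratio_distribution a m)"
    using pi by (simp add: limit_ratio_distributions_def)
  have pib: "\<pi> \<in> borel_probs {0..1}"
    using acc closure_of_subset_topspace[of "weak_topology {0..1::real}"]
    by (force simp: accumulation_points_def topspace_weak_topology)
  obtain h where h: "dense_functions {0..1::real} h" using ex_dense_functions[OF compact_Icc] by metis
  obtain r where r: "filterlim r at_top sequentially"
    "\<And>g::real \<Rightarrow> real. continuous_on {0..1} g \<Longrightarrow>
      (\<lambda>i::nat. \<integral>t. g t \<partial>(ratio_distribution a m (r i))) \<longlonglongrightarrow> (\<integral>t. g t \<partial>\<pi>)"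
    using accumulation_point_subsequence[OF compact_Icc h _ acc] ratio_distribution_borel_probs[OF id]
    by (metis mem_Collect_eq)
  have "filterlim (cum m) at_top sequentially"
    unfolding filterlim_at_top
  proof
    fix K
    show "\<forall>\<^sub>F J in sequentially. K \<le> cum m J"
      using eventually_ge_at_top[of "n K"]
      by eventually_elim (use S_space_cum_unbounded[OF id n, of K] mono_cum order_trans in blast)
  qed
  then have "filterlim (\<lambda>i. real (cum m (r i))) at_top sequentially"
    by (intro filterlim_compose[OF filterlim_real_sequentially] filterlim_compose[OF _ r(1)])
  then have "dominated_limit X lam \<mu> x a m r \<pi>"
    using assms(1-6) ad r dom pib by unfold_locales (auto simp: admissible_def)
  then show ?thesis using that by blast
qed

text \<open>A beginning of any member extends to \<open>n'\<close> whose empirical measure at a late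
  block end lies in the box. That measure depends on finitely many terms, so every sequence in a
  long enough cylinder around \<open>n'\<close> meets the box after \<open>n0\<close> and lies
  outside \<open>Z\<close>.\<close>

lemma nowhere_dense_avoiding:
  fixes X :: "'a::metric_space set" and f :: "nat \<Rightarrow> 'a \<Rightarrow> real"
  assumes X: "compact X" "lam \<in> borel_probs X" "supp lam = X" and x: "\<And>n. n \<ge> 1 \<Longrightarrow> x n \<in> X"
    and wd: "well_distributed X x lam" and id: "interval_data a m" and ad: "admissible a m"
    and f: "\<And>k. continuous_on X (f k)"
    and mu: "\<mu> \<in> predicted_measures X lam a m" and mu_close: "\<forall>k<d. \<bar>(\<integral>t. f k t \<partial>\<mu>) - q k\<bar> < b"
    and ZS: "Z \<subseteq> S_space a m"
    and Z: "\<And>n N. n \<in> Z \<Longrightarrow> N \<ge> n0 \<Longrightarrow>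
      \<not> (\<forall>k<d. \<bar>(\<integral>t. f k t \<partial>(empirical X (x \<circ> n) N)) - q k\<bar> < b)"
  shows "nowhere_dense_in (S_topology a m) Z"
proof (rule nowhere_dense_in_S_topology[OF ZS])
  fix n k assume n: "n \<in> S_space a m"
  obtain r \<pi> where "dominated_limit X lam \<mu> x a m r \<pi>"
    by (rule predicted_measures_dominated_limit[OF X x wd id ad n mu])
  then interpret dominated_limit X lam \<mu> x a m r \<pi> .
  \<comment> \<open>The room left between \<open>\<mu>\<close> and the boundary of the box: averages
    within \<open>e\<close> of the integrals of \<open>\<mu>\<close> stay inside.\<close>
  obtain e where e: "e > 0" "\<And>k. k < d \<Longrightarrow> \<bar>(\<integral>t. f k t \<partial>\<mu>) - q k\<bar> + e \<le> b"
    using finite_positive_slack[of d "\<lambda>k. \<bar>(\<integral>t. f k t \<partial>\<mu>) - q k\<bar>" "\<lambda>_. b"] mu_close by auto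
  have nsel: "n ` {1..} \<inter> {1..a J} \<in> selections J" for J
  proof -
    have "{1..a J} \<inter> block a j = block a j" if "j \<le> J" for j
      using that id by (auto simp: block_def interval_data_def dest: strict_mono_less_eq[THEN iffD2])
    then have "n ` {1..} \<inter> {1..a J} \<inter> block a j = n ` {1..} \<inter> block a j" if "j \<le> J" for j
      using that by (simp add: Int_assoc)
    then show ?thesis using n by (auto simp: selections_def S_space_def)
  qed
  \<comment> \<open>Prescribing the first \<open>n k\<close> blocks protects the first
    \<open>k\<close> terms, because \<open>n k \<le> a (n k)\<close>.\<close>
  obtain i T where i: "n k \<le> r i" "n0 \<le> cum m (r i)" "0 < cum m (r i)"
    and T: "T \<in> selections (r i)" "T \<inter> {1..a (n k)} = n ` {1..} \<inter> {1..a (n k)}"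
    and Tclose': "\<forall>k<d. \<bar>(\<Sum>s\<in>T. f k (x s)) / real (cum m (r i)) - (\<integral>t. f k t \<partial>\<mu>)\<bar> < e"
    using ex_selection_approx[where f=f and d=d and ?J0.0="n k" and ?N0.0=n0, OF f e(1) nsel] by (elim exE bexE conjE)
  note Tclose = Tclose'[rule_format]
  have "n k \<le> a (n k)"
    using id by (intro strict_mono_imp_increasing) (simp add: interval_data_def)
  then have "\<exists>n'\<in>S_space a m \<inter> cylinder k n. n' ` {1..cum m (r i)} = T"
    using T(1) by (intro ex_extension[OF id n i(1) _ _ _ T(2)]) (auto simp: selections_def)
  then obtain n' where n': "n' \<in> S_space a m \<inter> cylinder k n" "n' ` {1..cum m (r i)} = T" by blast
  let ?N = "cum m (r i)"
  have "n'' \<notin> Z" if n'': "n'' \<in> S_space a m \<inter> cylinder ?N n'" for n''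
  proof
    assume nZ: "n'' \<in> Z"
    have S0: "n'' \<in> S0" using n'' by (simp add: S_space_def)
    have "n'' ` {1..?N} = n' ` {1..?N}"
      using n'' by (intro image_cong) (auto simp: cylinder_def)
    then have im: "n'' ` {1..?N} = T" using n'(2) by simp
    have xn: "(x \<circ> n'') i \<in> X" if "1 \<le> i" for i
      using x S0_increasing[OF S0, of i] that by simp
    have "(\<integral>t. f k t \<partial>(empirical X (x \<circ> n'') ?N)) = (\<Sum>s\<in>T. f k (x s)) / real ?N" for k
    proof -
      have "(\<Sum>s\<in>T. f k (x s)) = (\<Sum>i=1..?N. f k ((x \<circ> n'') i))"
        unfolding im[symmetric] sum.reindex[OF S0_inj[OF S0]] by simp
      then show ?thesis by (simp only: integral_empirical[OF xn f])
    qed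
    then have "\<forall>k<d. \<bar>(\<integral>t. f k t \<partial>(empirical X (x \<circ> n'') ?N)) - q k\<bar> < b"
      using Tclose e(2) by (smt (verit, best))
    then show False using Z[OF nZ i(2)] by blast
  qed
  then show "\<exists>n'\<in>S_space a m \<inter> cylinder k n. \<exists>l\<ge>1. S_space a m \<inter> cylinder l n' \<inter> Z = {}"
    using n'(1) i(3) by (intro bexI[of _ n'] exI[of _ ?N]) auto
qed

theorem theorem3p2:
  fixes X :: "'a::metric_space set" and lam :: "'a measure"
    and x :: "nat \<Rightarrow> 'a" and a m :: "nat \<Rightarrow> nat"
  assumes "compact X"
    and "lam \<in> borel_probs X"
    and "supp lam = X"
    and "\<And>n. n \<ge> 1 \<Longrightarrow> x n \<in> X"
    and "well_distributed X x lam"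
    and "interval_data a m"
    and "admissible a m"
  shows "meager_in (S_topology a m)
           {n \<in> S_space a m. limit_measures X (x \<circ> n) \<noteq> predicted_measures X lam a m}"
proof -
  obtain f where f: "dense_functions X f" using ex_dense_functions[OF assms(1)] by metis
  have fc: "continuous_on X (f k)" for k using f by (simp add: dense_functions_def)
  define A where "A = {n \<in> S_space a m. limit_measures X (x \<circ> n) \<noteq> predicted_measures X lam a m}"
  \<comment> \<open>Boxes with rational centres and radii \<open>1 / Suc p\<close> form a countable
    family.\<close>
  define near where "near qs p \<nu> \<longleftrightarrow>
    (\<forall>k<length qs. \<bar>(\<integral>t. f k t \<partial>\<nu>) - of_rat (qs ! k)\<bar> < 1 / Suc p)" for qs :: "rat list" and p :: nat and \<nu>
  \<comment> \<open>The sets are cut down to \<open>A\<close> because \<open>meager_in\<close> asks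
    for equality with the union, not just for inclusion.\<close>
  define Z where "Z = (\<lambda>(qs, p, n0). {n \<in> A. \<forall>N\<ge>n0. \<not> near qs p (empirical X (x \<circ> n) N)})"
  \<comment> \<open>Only boxes containing a predicted measure are indexed; avoiding one of these
    from some index on is a nowhere dense condition.\<close>
  define I where "I = {(qs :: rat list, p :: nat, n0 :: nat). \<exists>\<mu>\<in>predicted_measures X lam a m. near qs p \<mu>}"
  have "nowhere_dense_in (S_topology a m) (Z i)" if "i \<in> I" for i
  proof -
    obtain qs p n0 where i: "i = (qs, p, n0)" by (cases i)
    have "\<exists>\<mu>\<in>predicted_measures X lam a m. near qs p \<mu>"
      using that unfolding i by (simp add: I_def)
    then obtain \<mu> where mu: "\<mu> \<in> predicted_measures X lam a m" "near qs p \<mu>" by blast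
    show ?thesis
    proof (rule nowhere_dense_avoiding[OF assms(1-7) fc mu(1)])
      show "\<forall>k<length qs. \<bar>(\<integral>t. f k t \<partial>\<mu>) - of_rat (qs ! k)\<bar> < 1 / Suc p"
        using mu(2) by (simp add: near_def)
      show "Z i \<subseteq> S_space a m" by (auto simp: Z_def A_def i)
      show "\<not> (\<forall>k<length qs. \<bar>(\<integral>t. f k t \<partial>(empirical X (x \<circ> n) N)) - of_rat (qs ! k)\<bar> < 1 / Suc p)"
        if "n \<in> Z i" "N \<ge> n0" for n N
        using that by (auto simp: Z_def i near_def)
    qed
  qed
  moreover have "A = \<Union> (Z ` I)"
  proof
    show "\<Union> (Z ` I) \<subseteq> A" by (auto simp: Z_def)
    show "A \<subseteq> \<Union> (Z ` I)"
    proof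
      fix n assume n: "n \<in> A"
      then have nS: "n \<in> S_space a m" and ne: "limit_measures X (x \<circ> n) \<noteq> predicted_measures X lam a m"
        by (auto simp: A_def)
      have xn: "(x \<circ> n) i \<in> X" if "1 \<le> i" for i
        using nS assms(4) S0_increasing[of n i] that by (simp add: S_space_def)
      \<comment> \<open>One inclusion always holds, so inequality means that some predicted measure
        is missed.\<close>
      obtain \<mu> where mu: "\<mu> \<in> predicted_measures X lam a m" "\<mu> \<notin> limit_measures X (x \<circ> n)"
        using ne limit_measures_subset_predicted_measures[of X lam x a m n] assms nS by blast
      have mub: "\<mu> \<in> borel_probs X"
        using mu(1) by (auto simp: predicted_measures_def dominated_measures_def)
      obtain n0 where n0: "n0 \<ge> 1"
        "\<mu> \<notin> weak_topology X closure_of (empirical X (x \<circ> n) ` {N \<in> {1..}. N \<ge> n0})"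
        using mu(2) by (auto simp: limit_measures_def accumulation_points_def)
      then obtain U where U: "openin (weak_topology X) U" "\<mu> \<in> U"
        "\<And>N. N \<ge> n0 \<Longrightarrow> empirical X (x \<circ> n) N \<notin> U"
        using mub by (auto simp: in_closure_of topspace_weak_topology)
      obtain d p where dp: "\<And>\<nu>. \<nu> \<in> borel_probs X \<Longrightarrow>
          \<forall>k<d. \<bar>(\<integral>t. f k t \<partial>\<nu>) - (\<integral>t. f k t \<partial>\<mu>)\<bar> < 1 / Suc p \<Longrightarrow> \<nu> \<in> U"
        using weak_nbhd_dense_functions[OF assms(1) f U(1,2)] by blast
      \<comment> \<open>The new radius is half of \<open>1 / Suc p\<close>. A rational box of this
        radius around a centre that close to the integrals of \<open>\<mu>\<close> contains
        \<open>\<mu>\<close> and stays within the original box.\<close>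
      define p' where "p' = 2 * p + 1"
      have p': "2 * (1 / real (Suc p')) = 1 / real (Suc p)" by (simp add: p'_def field_simps)
      have "\<exists>q. \<bar>y - of_rat q\<bar> < 1 / Suc p'" for y :: real
      proof -
        obtain q where "y - 1 / Suc p' < of_rat q" "of_rat q < y"
          using of_rat_dense[of "y - 1 / Suc p'" y] by auto
        then show ?thesis by (intro exI[of _ q]) linarith
      qed
      then obtain q :: "real \<Rightarrow> rat" where q: "\<And>y. \<bar>y - of_rat (q y)\<bar> < 1 / Suc p'" by metis
      define qs where "qs = map (\<lambda>k. q (\<integral>t. f k t \<partial>\<mu>)) [0..<d]"
      have qs: "length qs = d" "\<And>k. k < d \<Longrightarrow> qs ! k = q (\<integral>t. f k t \<partial>\<mu>)" by (auto simp: qs_def)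
      have "near qs p' \<mu>" using q by (simp add: near_def qs)
      then have "(qs, p', n0) \<in> I" using mu(1) by (auto simp: I_def)
      moreover have "\<not> near qs p' (empirical X (x \<circ> n) N)" if N: "N \<ge> n0" for N
      proof
        assume near: "near qs p' (empirical X (x \<circ> n) N)"
        have "\<bar>(\<integral>t. f k t \<partial>(empirical X (x \<circ> n) N)) - (\<integral>t. f k t \<partial>\<mu>)\<bar> < 1 / Suc p" if k: "k < d" for k
        proof -
          have "\<bar>(\<integral>t. f k t \<partial>(empirical X (x \<circ> n) N)) - of_rat (q (\<integral>t. f k t \<partial>\<mu>))\<bar> < 1 / Suc p'"
            using near k by (simp add: near_def qs)
          then show ?thesis using q[of "\<integral>t. f k t \<partial>\<mu>"] p' by linarith
        qed
        moreover have "empirical X (x \<circ> n) N \<in> borel_probs X"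
          using n0(1) N by (intro empirical_borel_probs xn) auto
        ultimately show False using dp U(3)[OF N] by blast
      qed
      then have "n \<in> Z (qs, p', n0)" using n by (simp add: Z_def)
      ultimately show "n \<in> \<Union> (Z ` I)" by blast
    qed
  qed
  ultimately show ?thesis
    unfolding meager_in_def A_def[symmetric] by (intro exI[of _ "Z ` I"]) auto
qed

end
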